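(* Let $X$ be a nonnegative real-valued random variable whose distribution is a generalized gamma convolution. Then for every real $q\ge 1$ the distribution of $X^q$ is a generalized gamma convolution.
   Context: For $\beta,b>0$, the gamma distribution $\mathrm{Gamma}(\beta,b)$ with shape $\beta$ and rate $b$ has density $\frac{b^\beta}{\Gamma(\beta)}x^{\beta-1}e^{-bx}$ on $x>0$. A probability distribution on $[0,\infty)$ is a generalized gamma convolution if it is a weak limit of distributions of finite sums of independent gamma random variables (arbitrary positive shapes and rates). Degenerate distributions, such as the point mass at $0$, are included. $X^q$ is the ordinary power of the nonnegative random variable $X$. *)

theory Defs
  imports "HOL-Probability.Probability"
begin

definition gamma_density :: "real \<Rightarrow> real \<Rightarrow> real \<Rightarrow> real" where
  "gamma_density \<beta> b x =
     (if x > 0 then b powr \<beta> / Gamma \<beta> * x powr (\<beta> - 1) * exp (- b * x) else 0)"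

definition gamma_distribution :: "real \<Rightarrow> real \<Rightarrow> real measure" where
  "gamma_distribution \<beta> b = density lborel (\<lambda>x. ennreal (gamma_density \<beta> b x))"

text \<open>
  The law of a sum of \<open>n\<close> independent gamma variables with shapes \<open>\<beta> i\<close> and rates \<open>b i\<close>,
  realised by the coordinates of the product space. The lemma \<open>distr_sum_indep_gamma\<close> below
  shows that every such sum, on any probability space, has this law. For \<open>n = 0\<close> it is the
  point mass at 0.
\<close>
definition gamma_sum_distribution :: "nat \<Rightarrow> (nat \<Rightarrow> real) \<Rightarrow> (nat \<Rightarrow> real) \<Rightarrow> real measure" where
  "gamma_sum_distribution n \<beta> b =
     distr (PiM {..<n} (\<lambda>i. gamma_distribution (\<beta> i) (b i))) borel (\<lambda>x. \<Sum>i<n. x i)"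

definition is_gamma_sum :: "real measure \<Rightarrow> bool" where
  "is_gamma_sum N \<longleftrightarrow>
     (\<exists>n \<beta> b. (\<forall>i<n. \<beta> i > 0 \<and> b i > 0) \<and> N = gamma_sum_distribution n \<beta> b)"

text \<open>
  Weak convergence of laws on the real line is metrizable, so limits of sequences suffice.
\<close>
definition generalized_gamma_convolution :: "real measure \<Rightarrow> bool" where
  "generalized_gamma_convolution N \<longleftrightarrow>
     real_distribution N \<and> measure N {0..} = 1 \<and>
     (\<exists>S. (\<forall>k. is_gamma_sum (S k)) \<and> weak_conv_m S N)"

lemma borel_measurable_gamma_density [measurable]: "gamma_density \<beta> b \<in> borel_measurable borel"
  unfolding gamma_density_def by measurable

lemma sets_gamma_distribution [simp, measurable_cong]: "sets (gamma_distribution \<beta> b) = sets borel"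
  by (simp add: gamma_distribution_def)

lemma prob_space_gamma_distribution:
  assumes "\<beta> > 0" "b > 0"
  shows "prob_space (gamma_distribution \<beta> b)"
proof (rule prob_spaceI)
  have "emeasure (gamma_distribution \<beta> b) (space (gamma_distribution \<beta> b)) =
      (\<integral>\<^sup>+x. ennreal (gamma_density \<beta> b x) \<partial>lborel)"
    by (simp add: gamma_distribution_def emeasure_density)
  also have "\<dots> = ennreal \<bar>1 / b\<bar> * (\<integral>\<^sup>+x. ennreal (gamma_density \<beta> b (0 + 1 / b * x)) \<partial>lborel)"
    using assms by (subst nn_integral_real_affine[where c = "1 / b" and t = 0])
      (auto simp: nn_integral_cmult)
  also have "\<dots> = (\<integral>\<^sup>+x. ennreal (1 / b * gamma_density \<beta> b (1 / b * x)) \<partial>lborel)"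
    using assms by (subst nn_integral_cmult[symmetric]) (simp_all flip: ennreal_mult')
  also have "\<dots> = (\<integral>\<^sup>+x. ennreal (1 / Gamma \<beta>) *
      ennreal (indicator {0..} x * x powr (\<beta> - 1) / exp x) \<partial>lborel)"
  proof (rule nn_integral_cong)
    fix x :: real
    have "1 / b * gamma_density \<beta> b (1 / b * x) =
        1 / Gamma \<beta> * (indicator {0..} x * x powr (\<beta> - 1) / exp x)"
    proof (cases "x > 0")
      case True
      have "b powr \<beta> = b * b powr (\<beta> - 1)"
        using assms powr_mult_base[of b "\<beta> - 1"] by simp
      then show ?thesis
        using True assms by (simp add: gamma_density_def powr_divide exp_minus field_simps)
    next
      case False
      then show ?thesis
        using assms by (cases "x = 0") (auto simp: gamma_density_def zero_less_divide_iff)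
    qed
    then show "ennreal (1 / b * gamma_density \<beta> b (1 / b * x)) =
        ennreal (1 / Gamma \<beta>) * ennreal (indicator {0..} x * x powr (\<beta> - 1) / exp x)"
      using assms by (simp only:) (rule ennreal_mult', simp add: Gamma_real_pos less_imp_le)
  qed
  also have "\<dots> = ennreal (1 / Gamma \<beta>) * ennreal (Gamma \<beta>)"
    using assms by (subst nn_integral_cmult) (auto simp: Gamma_conv_nn_integral_real)
  also have "\<dots> = 1"
    using Gamma_real_pos[OF assms(1)] by (auto simp flip: ennreal_mult'')
  finally show "emeasure (gamma_distribution \<beta> b) (space (gamma_distribution \<beta> b)) = 1" .
qed

lemma (in prob_space) distr_sum_indep_gamma:
  assumes ind: "indep_vars (\<lambda>_. borel) Y {..<n}"
    and law: "\<And>i. i < n \<Longrightarrow> distr M borel (Y i) = gamma_distribution (\<beta> i) (b i)"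
  shows "distr M borel (\<lambda>\<omega>. \<Sum>i<n. Y i \<omega>) = gamma_sum_distribution n \<beta> b"
proof (cases "n = 0")
  case True
  interpret E: prob_space "PiM {} (\<lambda>i. gamma_distribution (\<beta> i) (b i))"
    by (intro prob_space_PiM) auto
  show ?thesis
    using True by (simp add: gamma_sum_distribution_def distr_const E.distr_const)
next
  case False
  have rv: "Y i \<in> borel_measurable M" if "i < n" for i
    using ind that by (auto simp: indep_vars_def)
  have "PiM {..<n} (\<lambda>i. gamma_distribution (\<beta> i) (b i)) = PiM {..<n} (\<lambda>i. distr M borel (Y i))"
    by (intro PiM_cong) (auto simp: law)
  also have "\<dots> = distr M (PiM {..<n} (\<lambda>_. borel)) (\<lambda>x. \<lambda>i\<in>{..<n}. Y i x)"
    using ind False rv by (subst (asm) indep_vars_iff_distr_eq_PiM') auto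
  finally have eq: "PiM {..<n} (\<lambda>i. gamma_distribution (\<beta> i) (b i)) =
      distr M (PiM {..<n} (\<lambda>_. borel)) (\<lambda>x. \<lambda>i\<in>{..<n}. Y i x)" .
  show ?thesis
    unfolding gamma_sum_distribution_def eq
    by (subst distr_distr) (auto intro!: distr_cong measurable_restrict rv simp: o_def)
qed

end

theory Submission
  imports Defs "HOL-Complex_Analysis.Complex_Analysis"
begin

text \<open>
  By iteration and passage to weak limits, it is enough to take \<open>1 < q < 2\<close> and a finite sum \<open>X\<close> of
  independent gamma variables. The function \<open>\<Psi> \<zeta> = E exp (- \<zeta>\<^sup>2 X\<^sup>q)\<close> extends holomorphically from
  the positive axis to the half plane \<open>Re \<zeta> > 0\<close>, and the heart of the matter is that \<open>|\<Psi>|\<close>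
  decreases along rightward rays there, i.e. \<open>Re (\<Psi>' cnj \<Psi>) \<le> 0\<close>. To see this, write \<open>\<Psi>\<close> as an iterate
  of the operators \<open>A \<mapsto> (\<lambda>z. \<integral>t. t\<^sup>\<gamma>\<^sup>-\<^sup>1 exp (- w t) A (z + t))\<close> applied to \<open>exp (- \<zeta>\<^sup>2\<^sup>-\<^sup>q z\<^sup>q)\<close>; these
  operators preserve the monotonicity in modulus, and a Stein identity expresses \<open>\<zeta> \<Psi>'\<close> through them.
  For \<open>\<gamma> = 1\<close> a maximum principle shows \<open>Re w |B|\<^sup>2 \<le> Re (A cnj B)\<close>, where \<open>B\<close> is the image of \<open>A\<close>. This
  makes \<open>t \<mapsto> A (z + t) cnj (A z)\<close> one half of a positive definite function, which yields the case
  \<open>0 < \<gamma> \<le> 1\<close>; larger \<open>\<gamma>\<close> are reached by composition.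

  Consequently \<open>V = - \<Psi>' / (2 \<Psi>)\<close> has nonnegative real part and is real on the real axis, so a
  discretised Poisson integral approximates it by sums \<open>\<Sum> b z / (z\<^sup>2 + y)\<close> with \<open>b, y \<ge> 0\<close>. In the
  variable \<open>s = \<zeta>\<^sup>2\<close> this says that the logarithmic derivative of the Laplace transform of \<open>X\<^sup>q\<close> is
  approximated by \<open>- \<Sum> b / (s + y)\<close>, the one of a gamma sum. Integrating along \<open>Re s = \<delta>\<close> and
  letting \<open>\<delta>\<close> tend to 0 gives convergence of characteristic functions.
\<close>

section \<open>Holomorphic parameter integrals\<close>

text \<open>The range \<open>1 < q < 2\<close> comes from an angle count. After rescaling, the
  derivative of the exponent carries the power \<open>2 - q\<close> of \<open>\<zeta>\<close> times
  the power \<open>q - 1\<close> of \<open>z\<close>. Both powers are nonnegative and add up to 1,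
  so for \<open>\<zeta>\<close> and \<open>z\<close> in the right half plane the product stays in
  its closure, and the exponential decreases in modulus to the right. The price is that the rates
  \<open>b / \<zeta>\<close> are complex. Cancellation in an integral may weaken as \<open>z\<close>
  moves right, so the preservation of monotonicity is not automatic and has to use holomorphy on the
  whole half plane. The square root is dictated by the target. The poles of
  \<open>\<Sum> b / (s + y)\<close> lie on the negative axis; multiplied by the square root of
  \<open>s\<close> and read in that root, they lie on the imaginary axis, where nonnegative weights
  correspond to a nonnegative real part. This real part is half the logarithmic rate at which
  \<open>|\<Psi>|\<close> decreases to the right, which is why the modulus along rays is the
  quantity to follow.\<close>

lemma norm_deriv_le_on_half_ball:
  assumes hol: "f holomorphic_on ball z r" and r: "r > 0"
    and B: "\<And>y. y \<in> ball z r \<Longrightarrow> norm (f y) \<le> B" and y: "y \<in> ball z (r/2)"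
  shows "norm (deriv f y) \<le> 4 * B / r"
proof -
  have sub: "cball y (r/4) \<subseteq> ball z r"
  proof
    fix x assume "x \<in> cball y (r/4)"
    then have "dist z x \<le> dist z y + r/4"
      using dist_triangle[of z x y] by auto
    then show "x \<in> ball z r" using y r by auto
  qed
  have "norm ((deriv ^^ 1) f y) \<le> fact 1 * B / (r/4) ^ 1"
  proof (rule Cauchy_inequality)
    show "f holomorphic_on ball y (r/4)"
      using hol sub by (meson ball_subset_cball holomorphic_on_subset)
    show "continuous_on (cball y (r/4)) f"
      using hol sub holomorphic_on_imp_continuous_on holomorphic_on_subset by blast
    show "norm (f x) \<le> B" if "norm (y - x) = r/4" for x
      using B sub that r by (auto simp: dist_norm subset_iff)
  qed (use r in auto)
  then show ?thesis by (simp add: mult.commute)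
qed

text \<open>Only the integrand itself has to be dominated locally: Cauchy's estimate turns the bound
  on \<open>f\<close> into one on its derivative on a smaller ball, hence on the difference
  quotients, so dominated convergence applies along sequences.\<close>

proposition
  fixes f :: "complex \<Rightarrow> 'a \<Rightarrow> complex"
  assumes U: "open U"
    and hol: "\<And>t. t \<in> space M \<Longrightarrow> (\<lambda>z. f z t) holomorphic_on U"
    and meas: "\<And>z. z \<in> U \<Longrightarrow> f z \<in> borel_measurable M"
    and dom: "\<And>z. z \<in> U \<Longrightarrow> \<exists>r>0. \<exists>g. ball z r \<subseteq> U \<and> integrable M g \<and>
                 (\<forall>y\<in>ball z r. \<forall>t\<in>space M. norm (f y t) \<le> g t)"
  shows has_field_derivative_lebesgue_integral:
      "z \<in> U \<Longrightarrow> ((\<lambda>z. \<integral>t. f z t \<partial>M) has_field_derivative (\<integral>t. deriv (\<lambda>z. f z t) z \<partial>M)) (at z)"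
    and holomorphic_lebesgue_integral: "(\<lambda>z. \<integral>t. f z t \<partial>M) holomorphic_on U"
proof -
  have main: "((\<lambda>z. \<integral>t. f z t \<partial>M) has_field_derivative (\<integral>t. deriv (\<lambda>z. f z t) z \<partial>M)) (at z)"
    if z: "z \<in> U" for z
  proof -
    obtain r g where r: "r > 0" and rU: "ball z r \<subseteq> U" and g: "integrable M g"
      and fg: "\<And>y t. y \<in> ball z r \<Longrightarrow> t \<in> space M \<Longrightarrow> norm (f y t) \<le> g t"
      using dom[OF z] by blast
    have [measurable]: "g \<in> borel_measurable M" using g by auto
    have intf: "integrable M (f y)" if "y \<in> ball z r" for y
      by (rule Bochner_Integration.integrable_bound[OF g])
         (use fg that meas rU in \<open>auto intro!: AE_I2 order_trans[OF _ abs_ge_self]\<close>)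
    have holb: "(\<lambda>z. f z t) holomorphic_on ball z r" if "t \<in> space M" for t
      using hol[OF that] rU holomorphic_on_subset by blast
    have quot: "norm ((f y t - f z t) / (y - z)) \<le> 4 * g t / r"
      if t: "t \<in> space M" and y: "y \<in> ball z (r/2)" "y \<noteq> z" for y t
    proof -
      have "norm (f y t - f z t) \<le> (4 * g t / r) * norm (y - z)"
      proof (rule field_differentiable_bound[where S = "ball z (r/2)" and f' = "deriv (\<lambda>z. f z t)"])
        fix x assume x: "x \<in> ball z (r/2)"
        then have xr: "x \<in> ball z r" using r by auto
        show "((\<lambda>a. f a t) has_field_derivative deriv (\<lambda>z. f z t) x) (at x within ball z (r/2))"
          using holomorphic_derivI[OF holb[OF t] open_ball xr]
          by (rule DERIV_subset) auto
        show "norm (deriv (\<lambda>z. f z t) x) \<le> 4 * g t / r"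
          by (rule norm_deriv_le_on_half_ball[OF holb[OF t] r]) (use fg t x in auto)
      qed (use y r in auto)
      then show ?thesis using y by (simp add: norm_divide field_simps)
    qed
    have lim: "(\<lambda>n. (f (X n) t - f z t) / (X n - z)) \<longlonglongrightarrow> deriv (\<lambda>z. f z t) z"
      if t: "t \<in> space M" and X: "\<And>n. X n \<noteq> z" "X \<longlonglongrightarrow> z" for X t
    proof -
      have "((\<lambda>y. (f y t - f z t) / (y - z)) \<longlongrightarrow> deriv (\<lambda>z. f z t) z) (at z)"
        using holomorphic_derivI[OF holb[OF t] open_ball, of z] r
        by (simp add: has_field_derivative_iff)
      then show ?thesis using X unfolding tendsto_at_iff_sequentially
        by (auto simp: comp_def)
    qed
    have seq: "(\<lambda>n. \<integral>t. (f (X n) t - f z t) / (X n - z) \<partial>M) \<longlonglongrightarrow> (\<integral>t. deriv (\<lambda>z. f z t) z \<partial>M)"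
      if X: "\<And>n. X n \<noteq> z" "X \<longlonglongrightarrow> z" and Xb: "\<And>n. X n \<in> ball z (r/2)" for X
    proof -
      have XU: "X n \<in> U" for n using Xb[of n] r rU by (auto simp: subset_iff)
      have m1: "(\<lambda>t. (f (X n) t - f z t) / (X n - z)) \<in> borel_measurable M" for n
        using meas[OF XU, of n] meas[OF z] by simp
      have m2: "(\<lambda>t. deriv (\<lambda>z. f z t) z) \<in> borel_measurable M"
        by (rule borel_measurable_LIMSEQ_metric[OF m1, of "\<lambda>n. n"]) (use lim X in auto)
      have g': "integrable M (\<lambda>t. 4 * g t / r)" using g by auto
      have conv: "AE t in M. (\<lambda>n. (f (X n) t - f z t) / (X n - z)) \<longlonglongrightarrow> deriv (\<lambda>z. f z t) z"
        using lim X by auto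
      have bd: "AE t in M. norm ((f (X n) t - f z t) / (X n - z)) \<le> 4 * g t / r" for n
        using quot Xb X by auto
      show ?thesis
        by (rule integral_dominated_convergence[OF m2 m1 g' conv bd])
    qed
    have "((\<lambda>y. ((\<integral>t. f y t \<partial>M) - (\<integral>t. f z t \<partial>M)) / (y - z)) \<longlongrightarrow> (\<integral>t. deriv (\<lambda>z. f z t) z \<partial>M)) (at z)"
      unfolding tendsto_at_iff_sequentially
    proof (intro allI impI)
      fix X assume "\<forall>i. X i \<in> UNIV - {z}" and X: "X \<longlonglongrightarrow> z"
      then have Xn: "X i \<noteq> z" for i by auto
      have ev: "eventually (\<lambda>n. X n \<in> ball z (r/2)) sequentially"
        using X r by (auto simp: tendsto_iff dist_commute elim!: allE[of _ "r/2"])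
      \<comment> \<open>Dominated convergence is applied with every term in the half ball; the
        finitely many others are replaced by a fixed point of it different from
        \<open>z\<close>.\<close>
      define Y where "Y n = (if X n \<in> ball z (r/2) then X n else z + of_real (r/4))" for n
      have evY: "eventually (\<lambda>n. X n = Y n) sequentially"
        using ev by eventually_elim (simp add: Y_def)
      have "Y \<longlonglongrightarrow> z" using X evY by (rule Lim_transform_eventually)
      moreover have "Y n \<noteq> z" "Y n \<in> ball z (r/2)" for n
        using Xn[of n] r by (auto simp: Y_def dist_norm norm_divide)
      ultimately have "(\<lambda>n. \<integral>t. (f (Y n) t - f z t) / (Y n - z) \<partial>M) \<longlonglongrightarrow> (\<integral>t. deriv (\<lambda>z. f z t) z \<partial>M)"
        using seq by blast
      moreover have "eventually (\<lambda>n. (\<integral>t. (f (Y n) t - f z t) / (Y n - z) \<partial>M)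
          = ((\<integral>t. f (X n) t \<partial>M) - (\<integral>t. f z t \<partial>M)) / (X n - z)) sequentially"
        using ev evY
      proof eventually_elim
        case (elim n)
        have "X n \<in> ball z r" "z \<in> ball z r" using elim(1) r by auto
        then have "integrable M (f (X n))" "integrable M (f z)" using intf by auto
        then show ?case unfolding elim(2)[symmetric] by simp
      qed
      ultimately show "((\<lambda>y. ((\<integral>t. f y t \<partial>M) - (\<integral>t. f z t \<partial>M)) / (y - z)) \<circ> X)
          \<longlonglongrightarrow> (\<integral>t. deriv (\<lambda>z. f z t) z \<partial>M)"
        unfolding comp_def by (rule Lim_transform_eventually)
    qed
    then show ?thesis by (simp add: has_field_derivative_iff)
  qed
  show "z \<in> U \<Longrightarrow> ((\<lambda>z. \<integral>t. f z t \<partial>M) has_field_derivative (\<integral>t. deriv (\<lambda>z. f z t) z \<partial>M)) (at z)"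
    using main by auto
  show "(\<lambda>z. \<integral>t. f z t \<partial>M) holomorphic_on U"
    using main U by (auto simp: holomorphic_on_open)
qed

section \<open>The complex gamma integral\<close>

text \<open>The kernel of the gamma integral, extended by 0 so that all integrals run over the whole
  real axis.\<close>

definition pw :: "real \<Rightarrow> real \<Rightarrow> real" where
  "pw \<gamma> t = (if t > 0 then t powr (\<gamma> - 1) else 0)"

lemma pw_measurable [measurable]: "pw \<gamma> \<in> borel_measurable borel"
  unfolding pw_def by measurable

lemma pw_nonneg [simp]: "pw \<gamma> t \<ge> 0"
  by (simp add: pw_def)

lemma pw_zero [simp]: "t \<le> 0 \<Longrightarrow> pw \<gamma> t = 0"
  by (simp add: pw_def)

lemma
  assumes "\<gamma> > 0" "b > 0"
  shows has_bochner_integral_pw_exp: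
      "has_bochner_integral lborel (\<lambda>t. pw \<gamma> t * exp (- b * t)) (Gamma \<gamma> * b powr (- \<gamma>))"
    and integrable_pw_exp: "integrable lborel (\<lambda>t. pw \<gamma> t * exp (- b * t))"
proof -
  interpret prob_space "gamma_distribution \<gamma> b"
    by (rule prob_space_gamma_distribution[OF assms])
  have G: "Gamma \<gamma> > 0" using assms by (simp add: Gamma_real_pos)
  have eq: "gamma_density \<gamma> b t = b powr \<gamma> / Gamma \<gamma> * (pw \<gamma> t * exp (- b * t))" for t
    by (simp add: gamma_density_def pw_def)
  have nn: "gamma_density \<gamma> b t \<ge> 0" for t unfolding eq using G by simp
  have "(\<integral>\<^sup>+t. ennreal (gamma_density \<gamma> b t) \<partial>lborel) = 1"
    using emeasure_space_1 by (simp add: gamma_distribution_def emeasure_density)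
  then have "has_bochner_integral lborel (gamma_density \<gamma> b) 1"
    using nn by (intro has_bochner_integral_nn_integral) auto
  then have "has_bochner_integral lborel (\<lambda>t. (Gamma \<gamma> * b powr (- \<gamma>)) * gamma_density \<gamma> b t)
       (Gamma \<gamma> * b powr (- \<gamma>) * 1)"
    by (rule has_bochner_integral_mult_right)
  also have "(\<lambda>t. (Gamma \<gamma> * b powr (- \<gamma>)) * gamma_density \<gamma> b t) = (\<lambda>t. pw \<gamma> t * exp (- b * t))"
    using G[THEN less_imp_neq] assms by (auto simp: eq powr_minus field_simps)
  finally show *: "has_bochner_integral lborel (\<lambda>t. pw \<gamma> t * exp (- b * t)) (Gamma \<gamma> * b powr (- \<gamma>))"
    by simp
  show "integrable lborel (\<lambda>t. pw \<gamma> t * exp (- b * t))"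
    using * by (auto simp: integrable.simps)
qed

lemma open_rhp: "open {z. Re z > 0}" and convex_rhp: "convex {z. Re z > 0}"
  and connected_rhp: "connected {z. Re z > 0}"
  by (auto simp: open_halfspace_Re_gt convex_halfspace_Re_gt intro: convex_connected)

lemma rhp_ball: "Re z > 0 \<Longrightarrow> y \<in> ball z (Re z / 2) \<Longrightarrow> Re y > Re z / 2"
  using abs_Re_le_cmod[of "z - y"] by (auto simp: dist_norm)

lemma rhp_not_nonpos: "Re z > 0 \<Longrightarrow> z \<notin> \<real>\<^sub>\<le>\<^sub>0"
  by (auto elim!: nonpos_Reals_cases)

text \<open>The identity theorem with \<open>a + 1\<close> as accumulation point. The origin of the
  ray may lie on the boundary, so this covers both the positive axis and a ray that starts at a
  zero.\<close>

lemma rhp_zero_on_ray: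
  assumes hol: "f holomorphic_on {z. Re z > 0}" and a: "Re a \<ge> 0"
    and zero: "\<And>t::real. t > 0 \<Longrightarrow> f (a + of_real t) = 0" and z: "Re z > 0"
  shows "f z = 0"
proof (rule analytic_continuation[where f = f and w = z and S = "{z. Re z > 0}"
      and U = "(\<lambda>t. a + of_real t) ` {0<..}" and \<xi> = "a + 1"])
  define X where "X n = a + complex_of_real (1 + 1 / (real n + 1))" for n
  have "X \<longlonglongrightarrow> a + of_real 1"
    unfolding X_def by (intro tendsto_intros) real_asymp
  moreover have "X n \<in> (\<lambda>t. a + of_real t) ` {0<..} - {a + 1}" for n
  proof -
    have "1 / (real n + 1) > 0" by simp
    then have *: "1 + 1 / (real n + 1) > 0" "1 + 1 / (real n + 1) \<noteq> 1" by linarith+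
    have "X n \<noteq> a + 1"
    proof
      assume "X n = a + 1"
      then have "complex_of_real (1 + 1 / (real n + 1)) = 1"
        by (simp only: X_def add_left_cancel)
      then show False using * of_real_eq_1_iff by blast
    qed
    then show ?thesis using * unfolding X_def by blast
  qed
  ultimately show "a + 1 islimpt ((\<lambda>t. a + of_real t) ` {0<..})"
    unfolding islimpt_sequential by (intro exI[of _ X]) auto
qed (use assms in \<open>auto simp: open_rhp connected_rhp\<close>)

lemma rhp_identity:
  assumes "f holomorphic_on {z. Re z > 0}" "g holomorphic_on {z. Re z > 0}"
    and "\<And>t::real. t > 0 \<Longrightarrow> f (of_real t) = g (of_real t)" "Re z > 0"
  shows "f z = g z"
  using rhp_zero_on_ray[of "\<lambda>z. f z - g z" 0 z] assms by (auto intro: holomorphic_intros)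

text \<open>Both sides are holomorphic in \<open>z\<close> and agree at positive rates, where the
  integral is the normalisation of the gamma density.\<close>

lemma complex_gamma_integral:
  assumes g: "\<gamma> > 0" and z: "Re z > 0"
  shows "(\<integral>t. of_real (pw \<gamma> t) * exp (- z * of_real t) \<partial>lborel) = of_real (Gamma \<gamma>) * z powr (- of_real \<gamma>)"
proof -
  let ?F = "\<lambda>z. \<integral>t. complex_of_real (pw \<gamma> t) * exp (- z * of_real t) \<partial>lborel"
  have hol: "?F holomorphic_on {z. Re z > 0}"
  proof (rule holomorphic_lebesgue_integral[OF open_rhp])
    fix z :: complex assume "z \<in> {z. Re z > 0}"
    then have z: "Re z > 0" by simp
    show "\<exists>r>0. \<exists>g. ball z r \<subseteq> {z. Re z > 0} \<and> integrable lborel g \<and>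
      (\<forall>y\<in>ball z r. \<forall>t\<in>space lborel. norm (complex_of_real (pw \<gamma> t) * exp (- y * of_real t)) \<le> g t)"
    proof (intro exI[of _ "Re z / 2"] exI[of _ "\<lambda>t. pw \<gamma> t * exp (- (Re z / 2) * t)"] conjI ballI)
      show "integrable lborel (\<lambda>t. pw \<gamma> t * exp (- (Re z / 2) * t))"
        by (rule integrable_pw_exp) (use z g in auto)
    next
      fix y t assume y: "y \<in> ball z (Re z / 2)"
      show "norm (complex_of_real (pw \<gamma> t) * exp (- y * of_real t)) \<le> pw \<gamma> t * exp (- (Re z / 2) * t)"
        using rhp_ball[OF z y] by (cases "t > 0") (auto simp: norm_mult mult_right_mono intro!: mult_left_mono)
    next
      show "ball z (Re z / 2) \<subseteq> {z. Re z > 0}" using rhp_ball[OF z] z by force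
    qed (use z in auto)
  next
    show "(\<lambda>z. complex_of_real (pw \<gamma> t) * exp (- z * of_real t)) holomorphic_on {z. Re z > 0}" for t
      by (intro holomorphic_intros)
  qed simp
  show ?thesis
  proof (rule rhp_identity[OF hol _ _ z])
    show "(\<lambda>z. of_real (Gamma \<gamma>) * z powr (- of_real \<gamma>)) holomorphic_on {z. Re z > 0}"
      by (intro holomorphic_intros) (auto dest: rhp_not_nonpos)
    fix b :: real assume b: "b > 0"
    have "?F (of_real b) = (\<integral>t. complex_of_real (pw \<gamma> t * exp (- b * t)) \<partial>lborel)"
      by (simp add: exp_of_real flip: of_real_mult of_real_minus)
    also have "\<dots> = of_real (Gamma \<gamma> * b powr (- \<gamma>))"
      using has_bochner_integral_integral_eq[OF has_bochner_integral_pw_exp[OF g b]]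
      by (simp only: integral_complex_of_real)
    also have "\<dots> = of_real (Gamma \<gamma>) * of_real b powr (- of_real \<gamma>)"
      using b powr_of_real[of b "- \<gamma>"] by simp
    finally show "?F (of_real b) = of_real (Gamma \<gamma>) * of_real b powr (- of_real \<gamma>)" .
  qed
qed

section \<open>Functions decreasing in modulus along rightward rays\<close>

text \<open>Measurability is asked on the whole plane because the integrals see \<open>A\<close> as
  a total function; off the open half plane its values are otherwise arbitrary.\<close>

definition rdecr :: "(complex \<Rightarrow> complex) \<Rightarrow> bool" where
  "rdecr A \<longleftrightarrow> A \<in> borel_measurable borel \<and> A holomorphic_on {z. Re z > 0} \<and>
     (\<forall>z t. Re z > 0 \<longrightarrow> t \<ge> 0 \<longrightarrow> norm (A (z + of_real t)) \<le> norm (A z))"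

text \<open>For real \<open>w > 0\<close> this is, up to a constant, the expectation of
  \<open>A (z + Y)\<close> for a gamma variable \<open>Y\<close> of shape \<open>\<gamma>\<close>
  and rate \<open>w\<close>; complex rates arise from rescaling.\<close>

definition gop :: "complex \<Rightarrow> real \<Rightarrow> (complex \<Rightarrow> complex) \<Rightarrow> complex \<Rightarrow> complex" where
  "gop w \<gamma> A z = (\<integral>t. of_real (pw \<gamma> t) * exp (- w * of_real t) * A (z + of_real t) \<partial>lborel)"

text \<open>The cut-off keeps the derivative Borel on the whole plane.\<close>

definition rderiv :: "(complex \<Rightarrow> complex) \<Rightarrow> complex \<Rightarrow> complex" where
  "rderiv A z = (if Re z > 0 then deriv A z else 0)"

lemma rdecrD:
  assumes "rdecr A"
  shows rdecr_measurable: "A \<in> borel_measurable borel"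
    and rdecr_holomorphic: "A holomorphic_on {z. Re z > 0}"
    and rdecr_le: "Re z > 0 \<Longrightarrow> t \<ge> 0 \<Longrightarrow> norm (A (z + of_real t)) \<le> norm (A z)"
  using assms by (auto simp: rdecr_def)

lemma borel_measurable_continuous_on_rhp:
  assumes "continuous_on {z. Re z > 0} f"
  shows "(\<lambda>z. if Re z > 0 then f z else 0 :: complex) \<in> borel_measurable borel"
proof -
  have "(\<lambda>z. indicator {z. Re z > 0} z *\<^sub>R f z) \<in> borel_measurable borel"
    using assms open_rhp by (intro borel_measurable_continuous_on_indicator) auto
  also have "(\<lambda>z. indicator {z. Re z > 0} z *\<^sub>R f z) = (\<lambda>z. if Re z > 0 then f z else 0)"
    by (auto simp: indicator_def)
  finally show ?thesis .
qed

lemma rderiv_measurable: "A holomorphic_on {z. Re z > 0} \<Longrightarrow> rderiv A \<in> borel_measurable borel"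
  unfolding rderiv_def[abs_def]
  by (intro borel_measurable_continuous_on_rhp holomorphic_on_imp_continuous_on holomorphic_deriv open_rhp)

lemma has_field_derivative_rderiv:
  "A holomorphic_on {z. Re z > 0} \<Longrightarrow> Re z > 0 \<Longrightarrow> (A has_field_derivative rderiv A z) (at z)"
  using holomorphic_derivI[OF _ open_rhp, of A z] by (simp add: rderiv_def)

lemma rderiv_eqI: "Re z > 0 \<Longrightarrow> (A has_field_derivative D) (at z) \<Longrightarrow> rderiv A z = D"
  by (simp add: rderiv_def DERIV_imp_deriv)

text \<open>Cauchy's estimate on a disc around \<open>z + t\<close>: by monotonicity
  \<open>|A|\<close> is there at most its maximum over the disc around \<open>z\<close>, so the
  bound does not depend on \<open>t\<close>.\<close>

lemma rderiv_bound:
  assumes A: "rdecr A" and z: "Re z > 0"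
  obtains B where "\<And>t. t \<ge> 0 \<Longrightarrow> norm (rderiv A (z + of_real t)) \<le> B"
proof -
  let ?r = "Re z / 2"
  have sub: "cball z ?r \<subseteq> {z. Re z > 0}"
  proof
    fix y assume "y \<in> cball z ?r"
    then have "\<bar>Re (z - y)\<bar> \<le> ?r" using abs_Re_le_cmod[of "z - y"] by (auto simp: dist_norm)
    then have "Re z - Re y \<le> Re z / 2" using abs_ge_self[of "Re (z - y)"] by (simp del: abs_ge_self)
    then show "y \<in> {z. Re z > 0}" using z by simp
  qed
  have "compact (A ` cball z ?r)"
    using rdecr_holomorphic[OF A] sub
    by (intro compact_continuous_image compact_cball) (meson holomorphic_on_imp_continuous_on holomorphic_on_subset)
  then obtain B where B: "\<And>y. y \<in> cball z ?r \<Longrightarrow> norm (A y) \<le> B"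
    by (force dest!: compact_imp_bounded simp: bounded_iff)
  show ?thesis
  proof
    fix t :: real assume t: "t \<ge> 0"
    have "norm (deriv A (z + of_real t)) \<le> 4 * B / ?r"
    proof (rule norm_deriv_le_on_half_ball)
      show "A holomorphic_on ball (z + of_real t) ?r"
      proof (rule holomorphic_on_subset[OF rdecr_holomorphic[OF A]], rule subsetI)
        fix y assume "y \<in> ball (z + of_real t) ?r"
        then have "y - of_real t \<in> ball z ?r" by (auto simp: dist_norm algebra_simps)
        then have "y - of_real t \<in> {z. Re z > 0}" using sub ball_subset_cball by blast
        then show "y \<in> {z. Re z > 0}" using t by simp
      qed
      fix y assume "y \<in> ball (z + of_real t) ?r"
      then have *: "y - of_real t \<in> cball z ?r" by (auto simp: dist_norm algebra_simps intro!: less_imp_le)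
      then have "y - of_real t \<in> {z. Re z > 0}" using sub by blast
      then have "Re (y - of_real t) > 0" by simp
      then have "norm (A (y - of_real t + of_real t)) \<le> norm (A (y - of_real t))"
        using t by (intro rdecr_le[OF A])
      then show "norm (A y) \<le> B" using B[OF *] by simp
    qed (use z in auto)
    then show "norm (rderiv A (z + of_real t)) \<le> 4 * B / ?r"
      using t z by (simp add: rderiv_def)
  qed
qed

lemma has_real_derivative_norm_sq:
  assumes "(f has_field_derivative D) (at z)"
  shows "((\<lambda>t. (norm (f (z + of_real t * v)))\<^sup>2) has_real_derivative 2 * Re (D * v * cnj (f z))) (at 0)"
proof -
  have "((\<lambda>t. f (z + of_real t * v)) has_vector_derivative (1 * v) * D) (at 0)"
  proof (rule field_vector_diff_chain_at[unfolded comp_def, where g = f and f = "\<lambda>t. z + of_real t * v"])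
    show "((\<lambda>t. z + of_real t * v) has_vector_derivative 1 * v) (at 0)"
      by (auto intro!: derivative_eq_intros)
    show "(f has_field_derivative D) (at (z + complex_of_real 0 * v))" using assms by simp
  qed
  then have "((\<lambda>t. f (z + of_real t * v)) has_derivative (\<lambda>t. t *\<^sub>R (v * D))) (at 0)"
    by (simp add: has_vector_derivative_def)
  then have "((\<lambda>t. f (z + of_real t * v) \<bullet> f (z + of_real t * v)) has_derivative
      (\<lambda>t. f (z + of_real 0 * v) \<bullet> (t *\<^sub>R (v * D)) + (t *\<^sub>R (v * D)) \<bullet> f (z + of_real 0 * v))) (at 0)"
    by (intro has_derivative_inner) auto
  also have "(\<lambda>t. f (z + of_real 0 * v) \<bullet> (t *\<^sub>R (v * D)) + (t *\<^sub>R (v * D)) \<bullet> f (z + of_real 0 * v))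
      = (*) (2 * Re (D * v * cnj (f z)))"
    by (auto simp: inner_complex_def algebra_simps)
  finally show ?thesis
    by (simp add: has_field_derivative_def power2_norm_eq_inner)
qed

lemma rdecr_deriv_le:
  assumes A: "rdecr A" and z: "Re z > 0"
  shows "Re (rderiv A z * cnj (A z)) \<le> 0"
proof (rule ccontr)
  assume "\<not> ?thesis"
  then have pos: "0 < 2 * Re (rderiv A z * 1 * cnj (A z))" by simp
  have "((\<lambda>t. (norm (A (z + of_real t * 1)))\<^sup>2) has_real_derivative 2 * Re (rderiv A z * 1 * cnj (A z))) (at 0)"
    by (rule has_real_derivative_norm_sq[OF has_field_derivative_rderiv[OF rdecr_holomorphic[OF A] z]])
  from DERIV_pos_inc_right[OF this pos] obtain d where d: "d > 0"
    "\<And>h. 0 < h \<Longrightarrow> h < d \<Longrightarrow> (norm (A z))\<^sup>2 < (norm (A (z + of_real h)))\<^sup>2"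
    by auto
  have "(norm (A z))\<^sup>2 < (norm (A (z + of_real (d/2))))\<^sup>2" using d by (intro d(2)) auto
  moreover have "norm (A (z + of_real (d/2))) \<le> norm (A z)"
    using d z by (intro rdecr_le[OF A]) auto
  ultimately show False
    by (meson norm_ge_zero not_le power_mono)
qed

text \<open>\<open>2 * Re (A' * cnj A)\<close> is the derivative of the squared modulus along a ray;
  together with \<open>rdecr_deriv_le\<close> this makes monotonicity an infinitesimal
  condition.\<close>

lemma rdecrI:
  assumes meas: "A \<in> borel_measurable borel" and hol: "A holomorphic_on {z. Re z > 0}"
    and le: "\<And>z. Re z > 0 \<Longrightarrow> Re (rderiv A z * cnj (A z)) \<le> 0"
  shows "rdecr A"
  unfolding rdecr_def
proof (intro conjI allI impI meas hol)
  fix z :: complex and t :: real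
  assume z: "Re z > 0" and t: "t \<ge> 0"
  have "(norm (A (z + of_real t)))\<^sup>2 \<le> (norm (A (z + of_real 0)))\<^sup>2"
  proof (rule DERIV_nonpos_imp_nonincreasing[OF t])
    fix x assume x: "0 \<le> x" "x \<le> t"
    have "((\<lambda>s. (norm (A ((z + of_real x) + of_real s * 1)))\<^sup>2) has_real_derivative
        2 * Re (rderiv A (z + of_real x) * 1 * cnj (A (z + of_real x)))) (at 0)"
      using x z by (intro has_real_derivative_norm_sq has_field_derivative_rderiv hol) auto
    then have "((\<lambda>s. (norm (A (z + of_real s)))\<^sup>2) has_real_derivative
        2 * Re (rderiv A (z + of_real x) * cnj (A (z + of_real x)))) (at (0 + x))"
      by (subst DERIV_shift) (simp add: add_ac)
    moreover have "Re (rderiv A (z + of_real x) * cnj (A (z + of_real x))) \<le> 0"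
      using x z by (intro le) auto
    ultimately show "\<exists>y. ((\<lambda>s. (norm (A (z + of_real s)))\<^sup>2) has_real_derivative y) (at x) \<and> y \<le> 0"
      by (intro exI[of _ "2 * Re (rderiv A (z + of_real x) * cnj (A (z + of_real x)))"]) auto
  qed
  then show "norm (A (z + of_real t)) \<le> norm (A z)"
    using power2_le_imp_le by fastforce
qed

text \<open>A zero forces zeros on the whole ray to its right, and the identity theorem does the
  rest. This is what permits division by \<open>A\<close>.\<close>

lemma rdecr_zero_or_nonzero:
  assumes A: "rdecr A"
  shows "(\<forall>z. Re z > 0 \<longrightarrow> A z = 0) \<or> (\<forall>z. Re z > 0 \<longrightarrow> A z \<noteq> 0)"
proof (cases "\<exists>z. Re z > 0 \<and> A z = 0")
  case True
  then obtain a where a: "Re a > 0" "A a = 0" by auto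
  have "A (a + of_real t) = 0" if "t > 0" for t
    using rdecr_le[OF A a(1), of t] a(2) that by simp
  then show ?thesis
    using rhp_zero_on_ray[OF rdecr_holomorphic[OF A], of a] a(1) by auto
qed auto

section \<open>Gamma operators\<close>

lemma gop_measurable [measurable]:
  assumes [measurable]: "A \<in> borel_measurable borel"
  shows "gop w \<gamma> A \<in> borel_measurable borel"
  unfolding gop_def[abs_def] by measurable

lemma gop_integrand_measurable:
  fixes A :: "complex \<Rightarrow> complex"
  assumes [measurable]: "A \<in> borel_measurable borel"
  shows "(\<lambda>t. of_real (pw \<gamma> t) * exp (- w * of_real t) * A (z + of_real t)) \<in> borel_measurable borel"
  by measurable

lemma gop_integrand_bound:
  fixes A :: "complex \<Rightarrow> complex"
  assumes "\<And>t. t > 0 \<Longrightarrow> norm (A (z + of_real t)) \<le> C"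
  shows "norm (of_real (pw \<gamma> t) * exp (- w * of_real t) * A (z + of_real t)) \<le> C * (pw \<gamma> t * exp (- Re w * t))"
  using assms[of t] by (cases "t > 0")
      (auto simp: norm_mult mult.assoc mult.left_commute[of C] mult.commute[of "exp _"] intro!: mult_left_mono mult_right_mono)

lemma
  assumes A: "A \<in> borel_measurable borel" and bd: "\<And>t. t > 0 \<Longrightarrow> norm (A (z + of_real t)) \<le> C"
    and w: "Re w > 0" and g: "\<gamma> > 0"
  shows gop_integrable: "integrable lborel (\<lambda>t. of_real (pw \<gamma> t) * exp (- w * of_real t) * A (z + of_real t))"
    and gop_norm_le: "norm (gop w \<gamma> A z) \<le> C * (Gamma \<gamma> * Re w powr (- \<gamma>))"
proof -
  have i: "integrable lborel (\<lambda>t. C * (pw \<gamma> t * exp (- Re w * t)))"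
    using integrable_pw_exp[OF g w] by simp
  have "C \<ge> 0" using bd[of 1] norm_ge_zero order_trans zero_less_one by blast
  show I: "integrable lborel (\<lambda>t. of_real (pw \<gamma> t) * exp (- w * of_real t) * A (z + of_real t))"
  proof (rule Bochner_Integration.integrable_bound[OF i])
    show "(\<lambda>t. of_real (pw \<gamma> t) * exp (- w * of_real t) * A (z + of_real t)) \<in> borel_measurable lborel"
      using gop_integrand_measurable[OF A] by simp
    show "AE t in lborel. norm (of_real (pw \<gamma> t) * exp (- w * of_real t) * A (z + of_real t))
        \<le> norm (C * (pw \<gamma> t * exp (- Re w * t)))"
      using gop_integrand_bound[of A z C, OF bd] \<open>C \<ge> 0\<close> by (auto intro!: AE_I2 order_trans[OF _ abs_ge_self])
  qed
  have "norm (gop w \<gamma> A z) \<le> (\<integral>t. C * (pw \<gamma> t * exp (- Re w * t)) \<partial>lborel)"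
    unfolding gop_def
    by (rule Bochner_Integration.integral_norm_bound_integral[OF I i]) (rule gop_integrand_bound[of A z C, OF bd])
  also have "\<dots> = C * (Gamma \<gamma> * Re w powr (- \<gamma>))"
    using has_bochner_integral_integral_eq[OF has_bochner_integral_pw_exp[OF g w]] by simp
  finally show "norm (gop w \<gamma> A z) \<le> C * (Gamma \<gamma> * Re w powr (- \<gamma>))" .
qed

text \<open>Monotonicity supplies the domination: a bound for \<open>A\<close> on a small disc holds
  on all its right translates, so a multiple of the gamma kernel dominates locally
  uniformly.\<close>

lemma
  assumes A: "rdecr A" and w: "Re w > 0" and g: "\<gamma> > 0"
  shows gop_holomorphic: "gop w \<gamma> A holomorphic_on {z. Re z > 0}"
    and has_field_derivative_gop: "Re z > 0 \<Longrightarrow> (gop w \<gamma> A has_field_derivative gop w \<gamma> (rderiv A) z) (at z)"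
proof -
  note m [measurable] = rdecr_measurable[OF A]
  let ?f = "\<lambda>z t. complex_of_real (pw \<gamma> t) * exp (- w * of_real t) * A (z + of_real t)"
  have hol: "(\<lambda>z. ?f z t) holomorphic_on {z. Re z > 0}" for t
  proof (cases "t > 0")
    case True
    have "(\<lambda>z. A (z + of_real t)) holomorphic_on {z. Re z > 0}"
      using True
      by (intro holomorphic_on_compose_gen[OF _ rdecr_holomorphic[OF A], unfolded comp_def] holomorphic_intros) auto
    then show ?thesis by (intro holomorphic_intros)
  qed auto
  have dom: "\<exists>r>0. \<exists>g. ball z r \<subseteq> {z. Re z > 0} \<and> integrable lborel g \<and>
                 (\<forall>y\<in>ball z r. \<forall>t\<in>space lborel. norm (?f y t) \<le> g t)" if "z \<in> {z. Re z > 0}" for z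
  proof -
    have z: "Re z > 0" using that by simp
    have sub: "ball z (Re z / 2) \<subseteq> {z. Re z > 0}" using rhp_ball[OF z] z by force
    obtain B where B: "\<And>y. y \<in> cball z (Re z / 4) \<Longrightarrow> norm (A y) \<le> B"
    proof -
      have "cball z (Re z / 4) \<subseteq> ball z (Re z / 2)" using z by auto
      then have "compact (A ` cball z (Re z / 4))"
        using rdecr_holomorphic[OF A] sub
        by (intro compact_continuous_image compact_cball)
           (meson holomorphic_on_imp_continuous_on holomorphic_on_subset)
      then show ?thesis using that by (force dest!: compact_imp_bounded simp: bounded_iff)
    qed
    show ?thesis
    proof (intro exI[of _ "Re z / 4"] exI[of _ "\<lambda>t. B * (pw \<gamma> t * exp (- Re w * t))"] conjI ballI)
      show "integrable lborel (\<lambda>t. B * (pw \<gamma> t * exp (- Re w * t)))"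
        using integrable_pw_exp[OF g w] by simp
      show "ball z (Re z / 4) \<subseteq> {z. Re z > 0}" using sub z by (auto simp: subset_iff)
    next
      fix y t assume y: "y \<in> ball z (Re z / 4)"
      have "Re y > 0" using sub y z by (auto simp: subset_iff)
      then have "norm (A (y + of_real t)) \<le> B" if "t > 0" for t
        using rdecr_le[OF A, of y t] B[of y] y that by auto
      then show "norm (?f y t) \<le> B * (pw \<gamma> t * exp (- Re w * t))"
        by (rule gop_integrand_bound)
    qed (use z in auto)
  qed
  have meas: "?f z \<in> borel_measurable lborel" for z by measurable
  show "gop w \<gamma> A holomorphic_on {z. Re z > 0}"
    unfolding gop_def[abs_def] by (rule holomorphic_lebesgue_integral[OF open_rhp hol meas dom])
  assume z: "Re z > 0"
  have "(gop w \<gamma> A has_field_derivative (\<integral>t. deriv (\<lambda>z. ?f z t) z \<partial>lborel)) (at z)"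
    unfolding gop_def[abs_def] using z
    by (intro has_field_derivative_lebesgue_integral[OF open_rhp hol meas dom]) auto
  also have "(\<lambda>t. deriv (\<lambda>z. ?f z t) z) = (\<lambda>t. of_real (pw \<gamma> t) * exp (- w * of_real t) * rderiv A (z + of_real t))"
  proof
    fix t
    show "deriv (\<lambda>z. ?f z t) z = of_real (pw \<gamma> t) * exp (- w * of_real t) * rderiv A (z + of_real t)"
    proof (cases "t > 0")
      case True
      have "(A has_field_derivative rderiv A (z + of_real t)) (at (z + of_real t))"
        using z True by (intro has_field_derivative_rderiv rdecr_holomorphic[OF A]) auto
      then have "((\<lambda>z. A (z + of_real t)) has_field_derivative rderiv A (z + of_real t)) (at z)"
        by (subst DERIV_shift[symmetric]) simp
      then show ?thesis by (intro DERIV_imp_deriv DERIV_cmult)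
    qed auto
  qed
  finally show "(gop w \<gamma> A has_field_derivative gop w \<gamma> (rderiv A) z) (at z)"
    by (simp add: gop_def[abs_def])
qed

lemma rderiv_gop:
  "rdecr A \<Longrightarrow> Re w > 0 \<Longrightarrow> \<gamma> > 0 \<Longrightarrow> Re z > 0 \<Longrightarrow> rderiv (gop w \<gamma> A) z = gop w \<gamma> (rderiv A) z"
  by (intro rderiv_eqI has_field_derivative_gop)

section \<open>Integration by parts and a maximum principle for shape one\<close>

lemma integral_FTC_half_line:
  fixes F f :: "real \<Rightarrow> complex"
  assumes F: "\<And>t. t > 0 \<Longrightarrow> (F has_vector_derivative f t) (at t)"
    and cont: "\<And>t. t > 0 \<Longrightarrow> isCont f t"
    and integ: "integrable lborel (\<lambda>t. indicator {0<..} t *\<^sub>R f t)"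
    and F0: "(F \<longlongrightarrow> a) (at_right 0)" and Finf: "(F \<longlongrightarrow> b) at_top"
  shows "(\<integral>t. indicator {0<..} t *\<^sub>R f t \<partial>lborel) = b - a"
proof -
  have ei: "einterval 0 \<infinity> = {0::real<..}"
    by (auto simp: einterval_def simp flip: zero_ereal_def)
  have "(LBINT x=0..\<infinity>. f x) = b - a"
  proof (rule interval_integral_FTC_integrable)
    show "set_integrable lborel (einterval 0 \<infinity>) f"
      unfolding ei set_integrable_def by (rule integ)
    show "((F \<circ> real_of_ereal) \<longlongrightarrow> a) (at_right 0)"
      using F0 by (simp add: ereal_tendsto_simps zero_ereal_def)
    show "((F \<circ> real_of_ereal) \<longlongrightarrow> b) (at_left \<infinity>)"
      using Finf by (simp add: ereal_tendsto_simps)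
  qed (use F cont in \<open>auto simp: zero_ereal_def\<close>)
  then show ?thesis
    unfolding interval_lebesgue_integral_def set_lebesgue_integral_def ei by simp
qed

lemma powr_exp_tendsto_0: "\<eta> > 0 \<Longrightarrow> ((\<lambda>t::real. t powr \<gamma> * exp (- \<eta> * t)) \<longlongrightarrow> 0) at_top"
  by real_asymp

text \<open>Integration by parts. For shape 1 the boundary term at \<open>t = 0\<close> survives, so
  \<open>B = gop w 1 A\<close> solves \<open>B' = w B - A\<close>; the maximum principle works with
  this equation.\<close>

lemma gop_one_rderiv:
  assumes A: "rdecr A" and w: "Re w > 0" and z: "Re z > 0"
  shows "gop w 1 (rderiv A) z = w * gop w 1 A z - A z"
proof -
  let ?F = "\<lambda>t. exp (- w * of_real t) * A (z + of_real t)"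
  let ?f = "\<lambda>t. exp (- w * of_real t) * rderiv A (z + of_real t) - w * ?F t"
  obtain B where B: "\<And>t. t \<ge> 0 \<Longrightarrow> norm (rderiv A (z + of_real t)) \<le> B"
    using rderiv_bound[OF A z] by blast
  have i1: "integrable lborel (\<lambda>t. of_real (pw 1 t) * exp (- w * of_real t) * rderiv A (z + of_real t))"
    by (rule gop_integrable[where C = B])
       (use B w rderiv_measurable[OF rdecr_holomorphic[OF A]] in auto)
  have i2: "integrable lborel (\<lambda>t. of_real (pw 1 t) * exp (- w * of_real t) * A (z + of_real t))"
    by (rule gop_integrable[where C = "norm (A z)"]) (use w z rdecr_measurable[OF A] rdecr_le[OF A] in auto)
  have eq: "(\<lambda>t. indicator {0<..} t *\<^sub>R ?f t) = (\<lambda>t. of_real (pw 1 t) * exp (- w * of_real t) * rderiv A (z + of_real t)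
       - w * (of_real (pw 1 t) * exp (- w * of_real t) * A (z + of_real t)))"
    by (auto simp: pw_def indicator_def)
  have dA: "(A has_field_derivative rderiv A (z + of_real t)) (at (z + of_real t))" if "t \<ge> 0" for t
    using z that by (intro has_field_derivative_rderiv rdecr_holomorphic[OF A]) auto
  have cont: "isCont (rderiv A) (z + of_real t)" if "t > 0" for t
  proof -
    have "isCont (deriv A) (z + of_real t)"
      using holomorphic_deriv[OF rdecr_holomorphic[OF A] open_rhp] z that open_rhp
      by (intro continuous_on_interior[of "{z. Re z > 0}"] holomorphic_on_imp_continuous_on)
         (auto simp: interior_open)
    moreover have "eventually (\<lambda>y. rderiv A y = deriv A y) (nhds (z + of_real t))"
      using eventually_nhds_in_open[OF open_rhp, of "z + of_real t"] z that
      by (auto elim!: eventually_mono simp: rderiv_def)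
    ultimately show ?thesis by (simp add: isCont_cong)
  qed
  have "(\<integral>t. indicator {0<..} t *\<^sub>R ?f t \<partial>lborel) = 0 - A z"
  proof (rule integral_FTC_half_line[where F = ?F])
    fix t :: real assume t: "t > 0"
    have "((\<lambda>t. A (z + of_real t)) has_vector_derivative 1 * rderiv A (z + of_real t)) (at t)"
    proof (rule field_vector_diff_chain_at[unfolded comp_def, where g = A and f = "\<lambda>t. z + of_real t"])
      show "((\<lambda>t. z + of_real t) has_vector_derivative 1) (at t)"
        by (auto intro!: derivative_eq_intros)
    qed (use dA t in auto)
    moreover have "((\<lambda>t. exp (- w * of_real t)) has_vector_derivative (- w) * exp (- w * of_real t)) (at t)"
    proof (rule field_vector_diff_chain_at[unfolded comp_def, where g = exp and f = "\<lambda>t. - w * of_real t"])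
      show "((\<lambda>t. - w * of_real t) has_vector_derivative - w) (at t)"
        by (auto intro!: derivative_eq_intros)
    qed (auto intro!: DERIV_exp)
    ultimately have "(?F has_vector_derivative exp (- w * of_real t) * (1 * rderiv A (z + of_real t))
        + (- w) * exp (- w * of_real t) * A (z + of_real t)) (at t)"
      by (intro has_vector_derivative_mult)
    then show "(?F has_vector_derivative ?f t) (at t)" by (simp add: algebra_simps)
    have "isCont (\<lambda>t. A (z + of_real t)) t" "isCont (\<lambda>t. rderiv A (z + of_real t)) t"
      using DERIV_isCont[OF dA[of t]] cont[OF t] t
      by (auto intro!: isCont_o2[where g = A] isCont_o2[where g = "rderiv A"] isCont_add isCont_of_real)
    then show "isCont ?f t" by (intro continuous_intros)
  next
    show "integrable lborel (\<lambda>t. indicator {0<..} t *\<^sub>R ?f t)"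
      unfolding eq using i1 i2 by auto
    have "((\<lambda>t. A (z + of_real t)) \<longlongrightarrow> A (z + of_real 0)) (at_right 0)"
      by (rule isCont_tendsto_compose[OF DERIV_isCont[OF dA[OF order_refl]]])
         (intro tendsto_intros)
    moreover have "((\<lambda>t::real. exp (- w * of_real t)) \<longlongrightarrow> exp (- w * of_real 0)) (at_right 0)"
      by (intro tendsto_intros)
    ultimately have "(?F \<longlongrightarrow> exp (- w * of_real 0) * A (z + of_real 0)) (at_right 0)"
      by (intro tendsto_mult)
    then show "(?F \<longlongrightarrow> A z) (at_right 0)" by simp
    have "((\<lambda>t. norm (A z) * (t powr 0 * exp (- Re w * t))) \<longlongrightarrow> norm (A z) * 0) at_top"
      by (intro tendsto_mult tendsto_const powr_exp_tendsto_0 w)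
    moreover have "eventually (\<lambda>t. norm (?F t) \<le> norm (A z) * (t powr 0 * exp (- Re w * t))) at_top"
      using eventually_gt_at_top[of 0]
      by eventually_elim (use rdecr_le[OF A z] in \<open>auto simp: norm_mult mult.commute intro!: mult_right_mono\<close>)
    ultimately show "(?F \<longlongrightarrow> 0) at_top"
      by (intro Lim_null_comparison[of ?F]) auto
  qed
  then have "gop w 1 (rderiv A) z - w * gop w 1 A z = - A z"
    unfolding eq gop_def using i1 i2 by simp
  then show "gop w 1 (rderiv A) z = w * gop w 1 A z - A z" by (simp add: algebra_simps)
qed

text \<open>From a point of a closed half plane one can move up, down and to the right without
  leaving it. At a maximum the modulus is therefore stationary vertically and does not increase to
  the right.\<close>

lemma max_norm_half_plane_deriv:
  fixes f :: "complex \<Rightarrow> complex"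
  assumes D: "(f has_field_derivative D) (at \<xi>)" and \<xi>: "d \<le> Re \<xi>"
    and max: "\<And>z. d \<le> Re z \<Longrightarrow> norm (f z) \<le> norm (f \<xi>)"
  shows "Re (D * cnj (f \<xi>)) \<le> 0" "Im (D * cnj (f \<xi>)) = 0"
proof -
  show "Re (D * cnj (f \<xi>)) \<le> 0"
  proof (rule ccontr)
    assume "\<not> ?thesis"
    then have pos: "0 < 2 * Re (D * 1 * cnj (f \<xi>))" by simp
    from DERIV_pos_inc_right[OF has_real_derivative_norm_sq[OF D, of 1] this] obtain e where e: "e > 0"
      "\<And>h. 0 < h \<Longrightarrow> h < e \<Longrightarrow> (norm (f \<xi>))\<^sup>2 < (norm (f (\<xi> + of_real h)))\<^sup>2"
      by auto
    have "(norm (f \<xi>))\<^sup>2 < (norm (f (\<xi> + of_real (e/2))))\<^sup>2" using e by (intro e(2)) auto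
    moreover have "norm (f (\<xi> + of_real (e/2))) \<le> norm (f \<xi>)"
      using e \<xi> by (intro max) auto
    ultimately show False by (meson norm_ge_zero not_le power_mono)
  qed
  have "2 * Re (D * \<i> * cnj (f \<xi>)) = 0"
  proof (rule DERIV_local_max[OF has_real_derivative_norm_sq[OF D, of \<i>], of 1])
    show "\<forall>y. \<bar>0 - y\<bar> < 1 \<longrightarrow> (norm (f (\<xi> + of_real y * \<i>)))\<^sup>2 \<le> (norm (f (\<xi> + of_real 0 * \<i>)))\<^sup>2"
      using \<xi> by (auto intro!: power_mono max)
  qed simp
  then show "Im (D * cnj (f \<xi>)) = 0" by (simp add: algebra_simps)
qed

text \<open>
  The barrier \<open>1 + \<epsilon> z\<close> makes the maximum of \<open>|\<mu>|\<close> over a closed half plane attained. At a maximum the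
  logarithmic derivative is real and nonpositive, which is incompatible with the differential
  equation of \<open>\<mu>\<close> unless \<open>|\<mu>| \<le> 1\<close> up to \<open>O(\<epsilon>)\<close>.
\<close>

lemma disc_barrier:
  fixes \<mu> \<mu>' a :: "complex \<Rightarrow> complex"
  assumes d: "d > 0" and eta: "\<eta> > 0" and eps: "\<epsilon> > 0"
    and deriv: "\<And>z. Re z > 0 \<Longrightarrow> (\<mu> has_field_derivative \<mu>' z) (at z)"
    and ode: "\<And>z. Re z > 0 \<Longrightarrow> a z * (\<mu> z + 1) = of_real \<eta> * (\<mu> z - 1) - \<mu>' z"
    and a: "\<And>z. Re z > 0 \<Longrightarrow> Re (a z) \<le> 0"
    and bd: "\<And>z. Re z > 0 \<Longrightarrow> norm (\<mu> z) \<le> 3" and z0: "Re z0 = d"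
  shows "norm (\<mu> z0) \<le> sqrt (1 + 12 * \<epsilon> / \<eta>) * norm (1 + of_real \<epsilon> * z0)"
proof (cases "\<mu> z0 = 0")
  case False
  define k where "k z = 1 + of_real \<epsilon> * z" for z :: complex
  define f where "f z = \<mu> z / k z" for z
  have k1: "norm (k z) \<ge> 1" and kz: "norm (k z) \<ge> \<epsilon> * norm z" and k0: "k z \<noteq> 0" if "Re z > 0" for z
  proof -
    have "1 \<le> Re (k z)" using that eps by (simp add: k_def)
    then show "norm (k z) \<ge> 1" using complex_Re_le_cmod[of "k z"] by linarith
    then show "k z \<noteq> 0" by auto
    have "(\<epsilon> * norm z)\<^sup>2 \<le> (norm (k z))\<^sup>2"
      using that eps by (simp add: k_def cmod_power2 power_mult_distrib)
        (simp add: power2_eq_square algebra_simps)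
    then show "norm (k z) \<ge> \<epsilon> * norm z" by (rule power2_le_imp_le) simp
  qed
  have f0: "f z0 \<noteq> 0" using False k0 z0 d by (auto simp: f_def)
  \<comment> \<open>Outside this radius \<open>|f| \<le> 3 / (\<epsilon> |z|) \<le> |f z0|\<close>,
    so a maximum over the compact part \<open>S\<close>, which contains \<open>z0\<close>, is one
    over the whole half plane.\<close>
  define R where "R = max (norm z0) (3 / (\<epsilon> * norm (f z0)))"
  define S where "S = {z. d \<le> Re z} \<inter> cball 0 R"
  have fd: "(f has_field_derivative (\<mu>' z / k z - of_real \<epsilon> * \<mu> z / (k z)\<^sup>2)) (at z)" if "Re z > 0" for z
  proof -
    have "(k has_field_derivative of_real \<epsilon>) (at z)"
      unfolding k_def[abs_def] by (auto intro!: derivative_eq_intros)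
    from DERIV_divide[OF deriv[OF that] this k0[OF that]] show ?thesis
      unfolding f_def[abs_def] using k0[OF that] by (simp add: field_simps power2_eq_square)
  qed
  have "compact S"
    unfolding S_def by (intro closed_Int_compact compact_cball closed_halfspace_Re_ge)
  moreover have z0S: "z0 \<in> S" using z0 by (auto simp: S_def R_def)
  moreover have "continuous_on S (\<lambda>z. norm (f z))"
  proof (intro continuous_on_norm continuous_at_imp_continuous_on ballI)
    fix z assume "z \<in> S"
    then show "isCont f z" using fd[of z] d by (auto simp: S_def intro: DERIV_isCont)
  qed
  ultimately obtain \<xi> where \<xi>: "\<xi> \<in> S" and maxS: "\<And>z. z \<in> S \<Longrightarrow> norm (f z) \<le> norm (f \<xi>)"
    using continuous_attains_sup[of S "\<lambda>z. norm (f z)"] by auto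
  have max: "norm (f z) \<le> norm (f \<xi>)" if z: "d \<le> Re z" for z
  proof (cases "z \<in> S")
    case False
    then have zR: "norm z > R" using z by (auto simp: S_def)
    have zp: "Re z > 0" using z d by simp
    have "norm (f z) \<le> 3 / norm (k z)"
      unfolding f_def norm_divide using k1[OF zp] bd[OF zp] by (intro divide_right_mono) auto
    also have "\<dots> \<le> 3 / (\<epsilon> * norm z)"
      using kz[OF zp] eps zp k1[OF zp] by (intro divide_left_mono mult_pos_pos) auto
    also have "\<dots> \<le> norm (f z0)"
    proof -
      have "3 / (\<epsilon> * norm (f z0)) \<le> norm z" using zR by (simp add: R_def)
      moreover have "norm z > 0" using zp by auto
      ultimately show ?thesis using eps f0 by (simp add: divide_le_eq mult_ac)
    qed
    also have "\<dots> \<le> norm (f \<xi>)" by (rule maxS[OF z0S])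
    finally show ?thesis .
  qed (use maxS in auto)
  have \<xi>d: "d \<le> Re \<xi>" and \<xi>p: "Re \<xi> > 0" using \<xi> d by (auto simp: S_def)
  define D where "D = \<mu>' \<xi> / k \<xi> - of_real \<epsilon> * \<mu> \<xi> / (k \<xi>)\<^sup>2"
  note fD = fd[OF \<xi>p, folded D_def]
  have le: "Re (D * cnj (f \<xi>)) \<le> 0" and im: "Im (D * cnj (f \<xi>)) = 0"
    using max_norm_half_plane_deriv[OF fD \<xi>d max] by auto
  define u v K where "u = \<mu> \<xi>" and "v = \<mu>' \<xi>" and "K = k \<xi>"
  \<comment> \<open>At the maximum \<open>D * cnj (f \<xi>)\<close> is a nonpositive real number;
    \<open>c\<close> is its negative, rescaled by the barrier so as to refer to
    \<open>u = \<mu> \<xi>\<close> instead of \<open>f \<xi>\<close>.\<close>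
  define c where "c = - Re (D * cnj (f \<xi>)) * (norm K)\<^sup>2"
  have c: "c \<ge> 0" using le by (simp add: c_def mult_nonpos_nonneg)
  have K0: "K \<noteq> 0" and K1: "norm K \<ge> 1" using k0[OF \<xi>p] k1[OF \<xi>p] by (auto simp: K_def)
  have fx: "f \<xi> \<noteq> 0" using max[of z0] z0 f0 by auto
  then have u0: "u \<noteq> 0" by (auto simp: f_def u_def)
  have eq: "v * cnj u = of_real (\<epsilon> * (norm u)\<^sup>2) / K - of_real c"
  proof -
    have "D * cnj (f \<xi>) = of_real (Re (D * cnj (f \<xi>)))"
      using im by (simp add: complex_eq_iff)
    then have 1: "of_real c = - (D * cnj (f \<xi>)) * of_real ((norm K)\<^sup>2)"
      by (simp add: c_def)
    have "D * cnj (f \<xi>) * of_real ((norm K)\<^sup>2) = D * cnj (f \<xi>) * (K * cnj K)"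
      by (simp only: complex_norm_square)
    also have "\<dots> = (D * K) * (cnj (f \<xi> * K))" by simp
    also have "f \<xi> * K = u" using K0 by (simp add: f_def u_def K_def)
    also have "D * K = v - of_real \<epsilon> * u / K"
      using K0 unfolding D_def u_def[symmetric] v_def[symmetric] K_def[symmetric]
      by (simp add: field_simps power2_eq_square)
    also have "(v - of_real \<epsilon> * u / K) * cnj u = v * cnj u - of_real \<epsilon> * (u * cnj u) / K"
      by (simp add: algebra_simps)
    finally show ?thesis using 1 by (simp add: complex_norm_square[symmetric])
  qed
  have nu: "norm u \<le> 3" using bd[OF \<xi>p] by (simp add: u_def)
  have key: "(norm u)\<^sup>2 \<le> 1 + 12 * \<epsilon> / \<eta>"
  proof (cases "norm u \<ge> 1")
    case True
    have invK: "norm (inverse K) \<le> 1" using K1 by (simp add: norm_inverse inverse_le_1_iff)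
    have reK: "Re (inverse K) \<le> 1" using complex_Re_le_cmod[of "inverse K"] invK by linarith
    \<comment> \<open>The differential equation is multiplied by \<open>cnj (u + 1)\<close>: the
      side with \<open>a\<close> gets a nonpositive real part, and the other side produces
      \<open>\<eta> (|u|^2 - 1)\<close>.\<close>
    have "Re (a \<xi> * ((u + 1) * cnj (u + 1))) = Re (a \<xi>) * (norm (u + 1))\<^sup>2"
      unfolding complex_norm_square[symmetric] by (simp del: of_real_power)
    also have "\<dots> \<le> 0" using a[OF \<xi>p] by (simp add: mult_nonpos_nonneg)
    finally have "Re ((of_real \<eta> * (u - 1) - v) * cnj (u + 1)) \<le> 0"
      using ode[OF \<xi>p] unfolding u_def[symmetric] v_def[symmetric] by (metis mult.assoc)
    moreover have "Re ((of_real \<eta> * (u - 1) - v) * cnj (u + 1)) = \<eta> * ((norm u)\<^sup>2 - 1) - Re (v * cnj u) - Re v"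
      unfolding cmod_power2 by (simp add: power2_eq_square algebra_simps)
    ultimately have 1: "\<eta> * ((norm u)\<^sup>2 - 1) \<le> Re (v * cnj u) + Re v" by linarith
    have 2: "Re (v * cnj u) = \<epsilon> * (norm u)\<^sup>2 * Re (inverse K) - c"
      unfolding eq by (simp add: divide_inverse flip: of_real_mult)
    have "v = (v * cnj u) * u / of_real ((norm u)\<^sup>2)"
      using u0 unfolding complex_norm_square by (simp add: field_simps)
    also have "\<dots> = of_real \<epsilon> * u * inverse K - of_real (c / (norm u)\<^sup>2) * u"
      unfolding eq using u0 by (simp add: field_simps)
    finally have 3: "Re v = \<epsilon> * Re (u * inverse K) - c / (norm u)\<^sup>2 * Re u"
      by (simp add: mult.assoc del: of_real_divide)
    have "Re (u * inverse K) \<le> norm u * norm (inverse K)"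
      using complex_Re_le_cmod[of "u * inverse K"] by (simp add: norm_mult)
    also have "\<dots> \<le> norm u * 1" using invK by (intro mult_left_mono) auto
    finally have "Re (u * inverse K) \<le> 3" using nu by simp
    then have 4: "\<epsilon> * Re (u * inverse K) \<le> \<epsilon> * 3" using eps by (intro mult_left_mono) auto
    have "(norm u)\<^sup>2 * Re (inverse K) \<le> (norm u)\<^sup>2 * 1" using reK by (intro mult_left_mono) auto
    also have "\<dots> \<le> 3\<^sup>2 * 1" using nu by (intro mult_right_mono power_mono) auto
    finally have 5: "\<epsilon> * ((norm u)\<^sup>2 * Re (inverse K)) \<le> \<epsilon> * 9" using eps by (intro mult_left_mono) auto
    \<comment> \<open>Here \<open>|u| \<ge> 1\<close> enters: the two contributions of
      \<open>c\<close> add up to \<open>- c (1 + Re u / |u|^2)\<close>, which then has the right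
      sign.\<close>
    have 6: "c + c / (norm u)\<^sup>2 * Re u \<ge> 0"
    proof -
      have "- Re u \<le> norm u" using complex_Re_le_cmod[of "- u"] by simp
      also have "norm u * 1 \<le> norm u * norm u" using True by (intro mult_left_mono) auto
      finally have "0 \<le> (norm u)\<^sup>2 + Re u" by (simp add: power2_eq_square)
      then have "0 \<le> c * ((norm u)\<^sup>2 + Re u) / (norm u)\<^sup>2" using c by simp
      also have "\<dots> = c + c / (norm u)\<^sup>2 * Re u" using u0 by (simp add: field_simps)
      finally show ?thesis .
    qed
    \<comment> \<open>By \<open>|u| \<le> 3\<close> the terms coming from the barrier cost at most
      \<open>9 \<epsilon> + 3 \<epsilon>\<close>.\<close>
    have "\<eta> * ((norm u)\<^sup>2 - 1) \<le> 12 * \<epsilon>"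
      using 1 2 3 4 5 6 by (simp add: mult.assoc)
    then show ?thesis using eta by (simp add: field_simps)
  next
    case False
    then have "(norm u)\<^sup>2 \<le> 1" by (simp add: power_le_one)
    then show ?thesis using eps eta by (smt (verit) divide_nonneg_pos)
  qed
  have "norm (f z0) \<le> norm (f \<xi>)" using max z0 by simp
  also have "\<dots> \<le> norm u" using K1 by (simp add: f_def u_def K_def norm_divide divide_le_eq mult_le_cancel_left1)
  also have "\<dots> \<le> sqrt (1 + 12 * \<epsilon> / \<eta>)" using key by (simp add: real_le_rsqrt)
  finally have "norm (f z0) * norm (k z0) \<le> sqrt (1 + 12 * \<epsilon> / \<eta>) * norm (k z0)"
    by (intro mult_right_mono) auto
  then show ?thesis using k0[of z0] z0 d by (simp add: f_def norm_divide k_def)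
qed (use eps eta in auto)

text \<open>Where \<open>A\<close> does not vanish, the claim puts the quotient of
  \<open>gop w 1 A\<close> by \<open>A\<close> into the disc with diameter from 0 to
  \<open>1 / Re w\<close>; for \<open>A = exp (- \<alpha> z)\<close> with
  \<open>Re \<alpha> \<ge> 0\<close> the quotient is \<open>1 / (w + \<alpha>)\<close>. Mapped to
  the unit disc it satisfies a first-order equation to which \<open>disc_barrier\<close> applies,
  and \<open>\<epsilon>\<close> tends to 0.\<close>

lemma gop_one_disc:
  assumes A: "rdecr A" and w: "Re w > 0" and z: "Re z > 0"
  shows "Re w * (norm (gop w 1 A z))\<^sup>2 \<le> Re (A z * cnj (gop w 1 A z))"
proof (cases "\<forall>z. Re z > 0 \<longrightarrow> A z = 0")
  case True
  have "(\<lambda>t. of_real (pw 1 t) * exp (- w * of_real t) * A (z + of_real t)) = (\<lambda>t. 0)"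
  proof
    fix t show "of_real (pw 1 t) * exp (- w * of_real t) * A (z + of_real t) = 0"
      using True z by (cases "t > 0") auto
  qed
  then have "gop w 1 A z = 0" unfolding gop_def by simp
  then show ?thesis by simp
next
  case False
  then have nz: "\<And>z. Re z > 0 \<Longrightarrow> A z \<noteq> 0" using rdecr_zero_or_nonzero[OF A] by blast
  define \<eta> B where "\<eta> = Re w" and "B = gop w 1 A"
  have eta: "\<eta> > 0" using w by (simp add: \<eta>_def)
  \<comment> \<open>The affine map that takes the disc in question to the unit disc.\<close>
  define \<mu> where "\<mu> z = 2 * of_real \<eta> * (B z / A z) - 1" for z
  define \<mu>' where "\<mu>' z = 2 * of_real \<eta> * (((w * B z - A z) * A z - B z * rderiv A z) / (A z * A z))" for z
  \<comment> \<open>Absorbing \<open>Im w\<close> here leaves the real number \<open>\<eta>\<close>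
    in the equation and does not change \<open>Re a\<close>, whose sign is the monotonicity of
    \<open>A\<close>.\<close>
  define a where "a z = rderiv A z / A z - \<i> * of_real (Im w)" for z
  have Bd: "(B has_field_derivative (w * B z - A z)) (at z)" if "Re z > 0" for z
    using has_field_derivative_gop[OF A w _ that, of 1] gop_one_rderiv[OF A w that] by (simp add: B_def)
  have deriv: "(\<mu> has_field_derivative \<mu>' z) (at z)" if "Re z > 0" for z
    unfolding \<mu>_def[abs_def] \<mu>'_def
    using DERIV_diff[OF DERIV_cmult[OF DERIV_divide[OF Bd[OF that]
          has_field_derivative_rderiv[OF rdecr_holomorphic[OF A] that] nz[OF that]], of "2 * of_real \<eta>"] DERIV_const[of 1]]
    by simp
  have ode: "a z * (\<mu> z + 1) = of_real \<eta> * (\<mu> z - 1) - \<mu>' z" if "Re z > 0" for z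
  proof -
    have *: "(r / x - e) * (2 * h * (b / x) - 1 + 1) =
        h * (2 * h * (b / x) - 1 - 1) - 2 * h * ((((h + e) * b - x) * x - b * r) / (x * x))"
      if "x \<noteq> 0" for x b r h e :: complex
      using that by (simp add: field_simps)
    have "w = of_real \<eta> + \<i> * of_real (Im w)" by (simp add: \<eta>_def complex_eq_iff)
    then show ?thesis
      unfolding a_def \<mu>_def \<mu>'_def
      using *[OF nz[OF that], of "rderiv A z" "\<i> * of_real (Im w)" "of_real \<eta>" "B z"] by simp
  qed
  have ale: "Re (a z) \<le> 0" if "Re z > 0" for z
  proof -
    have "rderiv A z / A z = rderiv A z * cnj (A z) / of_real ((norm (A z))\<^sup>2)"
      using nz[OF that] unfolding complex_norm_square by (simp add: field_simps)
    then have "Re (rderiv A z / A z) = Re (rderiv A z * cnj (A z)) / (norm (A z))\<^sup>2"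
      by (simp only: Re_divide_of_real)
    then show ?thesis using rdecr_deriv_le[OF A that] by (simp add: a_def divide_nonpos_nonneg)
  qed
  \<comment> \<open>The crude estimate \<open>|B| \<le> |A| / \<eta>\<close> gives
    \<open>2 + 1\<close>; the barrier argument improves it to 1.\<close>
  have bd: "norm (\<mu> z) \<le> 3" if z: "Re z > 0" for z
  proof -
    have "norm (B z) \<le> norm (A z) * (Gamma 1 * Re w powr (- 1))"
      unfolding B_def by (rule gop_norm_le) (use A w z in \<open>auto intro: rdecr_le rdecr_measurable\<close>)
    also have "\<dots> = norm (A z) / \<eta>" using eta by (simp add: powr_minus_divide \<eta>_def)
    finally have "\<eta> * norm (B z / A z) \<le> 1"
      using eta nz[OF z] by (simp add: norm_divide field_simps)
    moreover have "norm (\<mu> z) \<le> norm (2 * of_real \<eta> * (B z / A z)) + norm (1 :: complex)"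
      unfolding \<mu>_def by (rule norm_triangle_ineq4)
    moreover have "norm (2 * of_real \<eta> * (B z / A z)) = 2 * (\<eta> * norm (B z / A z))"
      using eta by (simp only: norm_mult norm_of_real) simp
    ultimately show ?thesis by simp
  qed
  have bar: "norm (\<mu> z) \<le> sqrt (1 + 12 * \<epsilon> / \<eta>) * norm (1 + of_real \<epsilon> * z)" if "\<epsilon> > 0" for \<epsilon>
    using disc_barrier[OF z eta that deriv ode ale bd] by simp
  have "((\<lambda>\<epsilon>. sqrt (1 + 12 * \<epsilon> / \<eta>) * norm (1 + of_real \<epsilon> * z)) \<longlongrightarrow>
      sqrt (1 + 12 * 0 / \<eta>) * norm (1 + of_real 0 * z)) (at_right 0)"
    using eta by (intro tendsto_intros) auto
  then have "((\<lambda>\<epsilon>. sqrt (1 + 12 * \<epsilon> / \<eta>) * norm (1 + of_real \<epsilon> * z)) \<longlongrightarrow> 1) (at_right 0)" by simp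
  then have "norm (\<mu> z) \<le> 1"
    by (rule tendsto_lowerbound) (use bar in \<open>auto simp: eventually_at_right_field intro: exI[of _ 1]\<close>)
  then have "(norm (\<mu> z * A z))\<^sup>2 \<le> (norm (A z))\<^sup>2"
    by (intro power_mono) (auto simp: norm_mult mult_left_le_one_le)
  also have "\<mu> z * A z = 2 * of_real \<eta> * B z - A z"
    using nz[OF z] by (simp add: \<mu>_def field_simps)
  finally have "(norm (2 * of_real \<eta> * B z - A z))\<^sup>2 \<le> (norm (A z))\<^sup>2" .
  then have "\<eta> * (\<eta> * (norm (B z))\<^sup>2) \<le> \<eta> * Re (A z * cnj (B z))"
    by (simp add: cmod_power2) (simp add: power2_eq_square algebra_simps)
  then show ?thesis using eta by (simp add: \<eta>_def B_def)
qed

section \<open>Gaussian regularisation of Fourier integrals\<close>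

abbreviation gauss :: "real measure" where "gauss \<equiv> std_normal_distribution"

definition ft :: "(real \<Rightarrow> complex) \<Rightarrow> real \<Rightarrow> complex" where
  "ft f r = (\<integral>t. f t * exp (\<i> * of_real (r * t)) \<partial>lborel)"

lemma norm_exp_i [simp]: "norm (exp (\<i> * complex_of_real x)) = 1"
  by (simp add: norm_exp_eq_Re)

lemma prob_space_gauss: "prob_space gauss"
  by (rule prob_space_normal_density) simp

lemma borel_measurable_cnj [measurable (raw)]:
  "f \<in> borel_measurable M \<Longrightarrow> (\<lambda>x. cnj (f x)) \<in> borel_measurable M"
  by (rule borel_measurable_continuous_on[where f = cnj]) (auto intro: continuous_intros)

lemma norm_mult_le_of_norm_le: "norm e \<le> C \<Longrightarrow> norm (k * e) \<le> C * norm k" for e k :: complex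
  by (simp add: norm_mult mult.commute mult_right_mono)

lemma integrable_mult_bounded:
  fixes k e :: "'a \<Rightarrow> complex"
  assumes k: "integrable M k" and [measurable]: "e \<in> borel_measurable M" and C: "\<And>t. norm (e t) \<le> C"
  shows "integrable M (\<lambda>t. k t * e t)"
proof (rule Bochner_Integration.integrable_bound[where f = "\<lambda>t. C * norm (k t)"])
  show "integrable M (\<lambda>t. C * norm (k t))" using k by auto
  show "(\<lambda>t. k t * e t) \<in> borel_measurable M" using k by measurable
  show "AE t in M. norm (k t * e t) \<le> norm (C * norm (k t))"
    using norm_mult_le_of_norm_le[OF C] by (auto intro!: AE_I2 order_trans[OF _ abs_ge_self])
qed

lemma integrable_gauss_bounded:
  fixes e :: "real \<Rightarrow> complex"
  assumes "e \<in> borel_measurable borel" "\<And>t. norm (e t) \<le> C"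
  shows "integrable gauss e"
proof -
  interpret prob_space gauss by (rule prob_space_gauss)
  show ?thesis by (rule integrable_const_bound[where B = C]) (use assms in auto)
qed

lemma ft_bound: "norm (ft f r) \<le> (\<integral>t. norm (f t) \<partial>lborel)"
  unfolding ft_def by (rule order_trans[OF integral_norm_bound]) (simp add: norm_mult)

lemma ft_measurable [measurable]:
  assumes [measurable]: "f \<in> borel_measurable borel"
  shows "ft f \<in> borel_measurable borel"
  unfolding ft_def[abs_def] by measurable

lemma cnj_ft: "cnj (ft f r) = ft (\<lambda>t. cnj (f (- t))) r"
proof -
  have "cnj (ft f r) = (\<integral>t. cnj (f t * exp (\<i> * of_real (r * t))) \<partial>lborel)"
    unfolding ft_def by (rule Bochner_Integration.integral_cnj[symmetric])
  also have "\<dots> = (\<integral>t. cnj (f (0 + (-1) * t) * exp (\<i> * of_real (r * (0 + (-1) * t)))) \<partial>lborel)"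
    by (subst lborel_integral_real_affine[where c = "-1" and t = 0]) simp_all
  finally show ?thesis by (simp add: ft_def exp_cnj)
qed

lemma integral_Re_add:
  fixes f g :: "'a \<Rightarrow> complex"
  assumes "integrable M f" "integrable M g"
  shows "(\<integral>s. Re (f s) + Re (g s) \<partial>M) = Re (\<integral>s. f s \<partial>M) + Re (\<integral>s. g s \<partial>M)"
  using assms by simp

lemma integral_nonpos_pointwise:
  fixes f :: "'a \<Rightarrow> real"
  shows "(\<And>x. f x \<le> 0) \<Longrightarrow> (\<integral>x. f x \<partial>M) \<le> 0"
  using Bochner_Integration.integral_nonneg[of M "\<lambda>x. - f x"] by simp

lemma fubini_gauss:
  fixes k :: "real \<Rightarrow> complex" and e :: "real \<Rightarrow> real \<Rightarrow> complex"
  assumes k: "integrable lborel k" and e [measurable]: "case_prod e \<in> borel_measurable (borel \<Otimes>\<^sub>M borel)"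
    and C: "\<And>r t. norm (e r t) \<le> C"
  shows "(\<integral>r. (\<integral>t. k t * e r t \<partial>lborel) \<partial>gauss) = (\<integral>t. k t * (\<integral>r. e r t \<partial>gauss) \<partial>lborel)"
proof -
  interpret P: prob_space gauss by (rule prob_space_gauss)
  interpret pair_sigma_finite gauss lborel ..
  have [measurable]: "k \<in> borel_measurable borel" using k by auto
  have er [measurable]: "e r \<in> borel_measurable borel" for r
    using measurable_compose[OF _ e, of "\<lambda>t. (r, t)" borel] by simp
  have et: "(\<lambda>r. e r t) \<in> borel_measurable borel" for t
    using measurable_compose[OF _ e, of "\<lambda>r. (r, t)" borel] by simp
  have "integrable (gauss \<Otimes>\<^sub>M lborel) (\<lambda>(r, t). k t * e r t)"
  proof (rule Fubini_integrable)
    show "(\<lambda>(r, t). k t * e r t) \<in> borel_measurable (gauss \<Otimes>\<^sub>M lborel)" by measurable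
    have i: "integrable lborel (\<lambda>t. k t * e r t)" for r
      by (rule integrable_mult_bounded[OF k]) (use C in auto)
    then show "AE r in gauss. integrable lborel (\<lambda>t. case (r, t) of (r, t) \<Rightarrow> k t * e r t)" by simp
    have "(\<integral>t. norm (k t * e r t) \<partial>lborel) \<le> (\<integral>t. C * norm (k t) \<partial>lborel)" for r
      by (rule integral_mono) (use integrable_norm[OF i[of r]] k norm_mult_le_of_norm_le[OF C] in auto)
    then show "integrable gauss (\<lambda>r. \<integral>t. norm (case (r, t) of (r, t) \<Rightarrow> k t * e r t) \<partial>lborel)"
      by (intro P.integrable_const_bound[where B = "\<integral>t. C * norm (k t) \<partial>lborel"]) auto
  qed
  from Fubini_integral[OF this] show ?thesis by simp
qed

text \<open>Fourier inversion with Gaussian summation: integrating the phase over \<open>r\<close>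
  first gives a Gaussian of width \<open>\<delta>\<close> centred at \<open>\<tau>\<close>. The
  weight makes the outer integral converge without any decay of \<open>ft M\<close>.\<close>

lemma gauss_fourier:
  fixes M :: "real \<Rightarrow> complex"
  assumes M: "integrable lborel M" and d: "\<delta> > 0"
  shows "(\<integral>r. exp (- \<i> * of_real (r / \<delta> * \<tau>)) * ft M (r / \<delta>) \<partial>gauss) =
           of_real (\<delta> * sqrt (2 * pi)) * (\<integral>y. M (\<tau> + \<delta> * y) \<partial>gauss)"
proof -
  have [measurable]: "M \<in> borel_measurable borel" using M by auto
  have eq: "exp (- \<i> * of_real (r / \<delta> * \<tau>)) * ft M (r / \<delta>) = (\<integral>t. M t * exp (\<i> * of_real ((t - \<tau>) / \<delta> * r)) \<partial>lborel)" for r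
  proof -
    have "exp (- \<i> * of_real (r / \<delta> * \<tau>)) * ft M (r / \<delta>) =
        (\<integral>t. exp (- \<i> * of_real (r / \<delta> * \<tau>)) * (M t * exp (\<i> * of_real (r / \<delta> * t))) \<partial>lborel)"
      unfolding ft_def by simp
    also have "\<dots> = (\<integral>t. M t * exp (\<i> * of_real ((t - \<tau>) / \<delta> * r)) \<partial>lborel)"
    proof (rule Bochner_Integration.integral_cong)
      fix t
      have "exp (- \<i> * of_real (r / \<delta> * \<tau>)) * exp (\<i> * of_real (r / \<delta> * t)) = exp (\<i> * complex_of_real ((t - \<tau>) / \<delta> * r))"
        unfolding exp_add[symmetric] using d by (intro arg_cong[where f = exp]) (simp add: field_simps)
      then show "exp (- \<i> * of_real (r / \<delta> * \<tau>)) * (M t * exp (\<i> * of_real (r / \<delta> * t))) =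
          M t * exp (\<i> * of_real ((t - \<tau>) / \<delta> * r))" by (simp add: mult_ac)
    qed simp
    finally show ?thesis .
  qed
  have ch: "(\<integral>r. exp (\<i> * of_real (x * r)) \<partial>gauss) = of_real (exp (- x\<^sup>2 / 2))" for x
    using fun_cong[OF char_std_normal_distribution, of x] by (simp add: char_def)
  have "(\<integral>r. exp (- \<i> * of_real (r / \<delta> * \<tau>)) * ft M (r / \<delta>) \<partial>gauss) =
      (\<integral>t. M t * (\<integral>r. exp (\<i> * of_real ((t - \<tau>) / \<delta> * r)) \<partial>gauss) \<partial>lborel)"
    unfolding eq by (rule fubini_gauss[OF M, where C = 1]) auto
  also have "\<dots> = (\<integral>t. M t * of_real (exp (- ((t - \<tau>) / \<delta>)\<^sup>2 / 2)) \<partial>lborel)"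
    unfolding ch ..
  also have "\<dots> = \<delta> *\<^sub>R (\<integral>y. M (\<tau> + \<delta> * y) * of_real (exp (- y\<^sup>2 / 2)) \<partial>lborel)"
    using d by (subst lborel_integral_real_affine[where c = \<delta> and t = \<tau>]) simp_all
  also have "(\<integral>y. M (\<tau> + \<delta> * y) * of_real (exp (- y\<^sup>2 / 2)) \<partial>lborel)
      = (\<integral>y. of_real (sqrt (2 * pi)) * (std_normal_density y *\<^sub>R M (\<tau> + \<delta> * y)) \<partial>lborel)"
    by (intro Bochner_Integration.integral_cong)
       (simp_all add: std_normal_density_def scaleR_conv_of_real flip: of_real_mult of_real_divide)
  also have "\<dots> = of_real (sqrt (2 * pi)) * (\<integral>y. M (\<tau> + \<delta> * y) \<partial>gauss)"
    by (subst integral_density) (auto simp only: integral_mult_right_zero, auto)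
  finally show ?thesis by (simp add: scaleR_conv_of_real)
qed

lemma gauss_parseval:
  fixes k M :: "real \<Rightarrow> complex"
  assumes k: "integrable lborel k" and M: "integrable lborel M" and d: "\<delta> > 0"
  shows "(\<integral>r. ft k (- (r / \<delta>)) * ft M (r / \<delta>) \<partial>gauss) =
           of_real (\<delta> * sqrt (2 * pi)) * (\<integral>\<tau>. k \<tau> * (\<integral>y. M (\<tau> + \<delta> * y) \<partial>gauss) \<partial>lborel)"
proof -
  have [measurable]: "k \<in> borel_measurable borel" "M \<in> borel_measurable borel" using k M by auto
  have "ft k (- (r / \<delta>)) * ft M (r / \<delta>) = (\<integral>\<tau>. (k \<tau> * exp (\<i> * of_real (- (r / \<delta>) * \<tau>))) * ft M (r / \<delta>) \<partial>lborel)" for r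
    unfolding ft_def[of k] by (rule integral_mult_left_zero[symmetric])
  then have "ft k (- (r / \<delta>)) * ft M (r / \<delta>) = (\<integral>\<tau>. k \<tau> * (exp (- \<i> * of_real (r / \<delta> * \<tau>)) * ft M (r / \<delta>)) \<partial>lborel)" for r
    by (simp add: mult.assoc)
  then have "(\<integral>r. ft k (- (r / \<delta>)) * ft M (r / \<delta>) \<partial>gauss) =
      (\<integral>r. (\<integral>\<tau>. k \<tau> * (exp (- \<i> * of_real (r / \<delta> * \<tau>)) * ft M (r / \<delta>)) \<partial>lborel) \<partial>gauss)" by simp
  also have "\<dots> = (\<integral>\<tau>. k \<tau> * (\<integral>r. exp (- \<i> * of_real (r / \<delta> * \<tau>)) * ft M (r / \<delta>) \<partial>gauss) \<partial>lborel)"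
    by (rule fubini_gauss[OF k, where C = "\<integral>t. norm (M t) \<partial>lborel"])
       (auto simp: norm_mult norm_exp_eq_Re intro!: ft_bound)
  also have "\<dots> = (\<integral>\<tau>. of_real (\<delta> * sqrt (2 * pi)) * (k \<tau> * (\<integral>y. M (\<tau> + \<delta> * y) \<partial>gauss)) \<partial>lborel)"
    unfolding gauss_fourier[OF M d] by (simp add: mult_ac)
  finally show ?thesis by simp
qed

lemma gauss_average_tendsto:
  fixes M :: "real \<Rightarrow> complex"
  assumes [measurable]: "M \<in> borel_measurable borel" and C: "\<And>t. norm (M t) \<le> C"
    and cont: "isCont M x" and d: "\<delta> \<longlonglongrightarrow> 0"
  shows "(\<lambda>n. \<integral>y. M (x + \<delta> n * y) \<partial>gauss) \<longlonglongrightarrow> M x"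
proof -
  interpret prob_space gauss by (rule prob_space_gauss)
  have "(\<lambda>n. \<integral>y. M (x + \<delta> n * y) \<partial>gauss) \<longlonglongrightarrow> (\<integral>y. M x \<partial>gauss)"
  proof (rule integral_dominated_convergence[where w = "\<lambda>_. C"])
    have "(\<lambda>n. x + \<delta> n * y) \<longlonglongrightarrow> x + 0 * y" for y using d by (intro tendsto_intros)
    then have "(\<lambda>n. x + \<delta> n * y) \<longlonglongrightarrow> x" for y by simp
    then have "(\<lambda>n. M (x + \<delta> n * y)) \<longlonglongrightarrow> M x" for y
      by (rule isCont_tendsto_compose[OF cont])
    then show "AE y in gauss. (\<lambda>n. M (x + \<delta> n * y)) \<longlonglongrightarrow> M x" by simp
  qed (use C in auto)
  then show ?thesis by (simp add: prob_space[simplified])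
qed

text \<open>Parseval's identity in the limit, the Gaussian averages being an approximate identity.
  Since \<open>k\<close> lives on \<open>t > 0\<close>, a jump of \<open>M\<close> at 0 does no
  harm.\<close>

lemma gauss_parseval_tendsto:
  fixes k M :: "real \<Rightarrow> complex"
  assumes k: "integrable lborel k" and k0: "\<And>t. t \<le> 0 \<Longrightarrow> k t = 0"
    and M: "integrable lborel M" and C: "\<And>t. norm (M t) \<le> C" and cont: "\<And>t. t > 0 \<Longrightarrow> isCont M t"
    and d: "\<delta> \<longlonglongrightarrow> 0" "\<And>n. \<delta> n > 0"
  shows "(\<lambda>n. (\<integral>r. ft k (- (r / \<delta> n)) * ft M (r / \<delta> n) \<partial>gauss) / of_real (\<delta> n * sqrt (2 * pi)))
     \<longlonglongrightarrow> (\<integral>t. k t * M t \<partial>lborel)"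
proof -
  interpret prob_space gauss by (rule prob_space_gauss)
  have [measurable]: "k \<in> borel_measurable borel" "M \<in> borel_measurable borel" using k M by auto
  have avg: "norm (\<integral>y. M (\<tau> + \<delta> n * y) \<partial>gauss) \<le> C" for \<tau> n
  proof -
    have "norm (\<integral>y. M (\<tau> + \<delta> n * y) \<partial>gauss) \<le> (\<integral>y. C \<partial>gauss)"
      by (rule Bochner_Integration.integral_norm_bound_integral)
         (use C in \<open>auto intro!: integrable_gauss_bounded\<close>)
    then show ?thesis by (simp add: prob_space[simplified])
  qed
  have "(\<lambda>n. \<integral>\<tau>. k \<tau> * (\<integral>y. M (\<tau> + \<delta> n * y) \<partial>gauss) \<partial>lborel) \<longlonglongrightarrow> (\<integral>t. k t * M t \<partial>lborel)"
  proof (rule integral_dominated_convergence[where w = "\<lambda>t. C * norm (k t)"])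
    show "integrable lborel (\<lambda>t. C * norm (k t))" using k by auto
    show "AE \<tau> in lborel. (\<lambda>n. k \<tau> * (\<integral>y. M (\<tau> + \<delta> n * y) \<partial>gauss)) \<longlonglongrightarrow> k \<tau> * M \<tau>"
    proof (rule AE_I2)
      fix \<tau> show "(\<lambda>n. k \<tau> * (\<integral>y. M (\<tau> + \<delta> n * y) \<partial>gauss)) \<longlonglongrightarrow> k \<tau> * M \<tau>"
      proof (cases "\<tau> > 0")
        case True
        then show ?thesis
          by (intro tendsto_intros gauss_average_tendsto[where C = C]) (use C cont d in auto)
      qed (simp add: k0)
    qed
    show "AE \<tau> in lborel. norm (k \<tau> * (\<integral>y. M (\<tau> + \<delta> n * y) \<partial>gauss)) \<le> C * norm (k \<tau>)" for n
      using norm_mult_le_of_norm_le[OF avg] by auto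
  qed measurable
  moreover have "(\<integral>r. ft k (- (r / \<delta> n)) * ft M (r / \<delta> n) \<partial>gauss) / of_real (\<delta> n * sqrt (2 * pi)) =
      (\<integral>\<tau>. k \<tau> * (\<integral>y. M (\<tau> + \<delta> n * y) \<partial>gauss) \<partial>lborel)" for n
    unfolding gauss_parseval[OF k M d(2)] using d(2)[of n] by simp
  ultimately show ?thesis by simp
qed

text \<open>
  The condition \<open>Re (ft M0) \<ge> 0\<close> says that \<open>M0\<close> is one half of a positive definite function; the
  Gaussian weight replaces the spectral measure that Bochner's theorem would provide.
\<close>

lemma positive_definite_pairing:
  fixes k M0 M1 :: "real \<Rightarrow> complex"
  assumes k: "integrable lborel k" and k0: "\<And>t. t \<le> 0 \<Longrightarrow> k t = 0"
    and M0: "integrable lborel M0" "\<And>t. norm (M0 t) \<le> C" "\<And>t. t > 0 \<Longrightarrow> isCont M0 t" "\<And>t. t < 0 \<Longrightarrow> M0 t = 0"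
    and M1: "integrable lborel M1" "\<And>t. norm (M1 t) \<le> C" "\<And>t. t > 0 \<Longrightarrow> isCont M1 t" "\<And>t. t < 0 \<Longrightarrow> M1 t = 0"
    and ft1: "\<And>r. ft M1 r = - of_real a - \<i> * of_real r * ft M0 r"
    and pos: "\<And>r. Re (ft M0 r) \<ge> 0"
    and ksgn: "\<And>r s. (r - s) * Im (ft k (- r) * cnj (ft k (- s))) \<le> 0"
  shows "Re ((\<integral>t. k t * M1 t \<partial>lborel) * cnj (\<integral>t. k t * M0 t \<partial>lborel)) \<le> 0"
proof -
  interpret prob_space gauss by (rule prob_space_gauss)
  have [measurable]: "k \<in> borel_measurable borel" "M0 \<in> borel_measurable borel" "M1 \<in> borel_measurable borel"
    using k M0 M1 by auto
  define \<delta> :: "nat \<Rightarrow> real" where "\<delta> n = 1 / (real n + 1)" for n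
  have d0: "\<delta> \<longlonglongrightarrow> 0" unfolding \<delta>_def by real_asymp
  have dpos: "\<delta> n > 0" for n by (simp add: \<delta>_def)
  \<comment> \<open>\<open>cnj (ft M)\<close> is the transform of the reflected function, which
    lives on the negative axis, where \<open>k\<close> vanishes. It drops out in the limit for every
    \<open>c\<close>, so \<open>ft M\<close> may be replaced by its real part or by
    \<open>\<i>\<close> times its imaginary part at the cost of a factor 2.\<close>
  have lim: "(\<lambda>n. (\<integral>r. ft k (- (r / \<delta> n)) * ((ft M (r / \<delta> n) + c * cnj (ft M (r / \<delta> n))) / 2) \<partial>gauss)
        / of_real (\<delta> n * sqrt (2 * pi))) \<longlonglongrightarrow> (\<integral>t. k t * M t \<partial>lborel) / 2"
    if M: "integrable lborel M" "\<And>t. norm (M t) \<le> C" "\<And>t. t > 0 \<Longrightarrow> isCont M t" "\<And>t. t < 0 \<Longrightarrow> M t = 0"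
    for M and c :: complex
  proof -
    have [measurable]: "M \<in> borel_measurable borel" using M by auto
    let ?M' = "\<lambda>t. cnj (M (- t))"
    have iM': "integrable lborel ?M'"
    proof -
      have "integrable lborel (\<lambda>t. M (0 + (-1) * t))"
        using M(1) by (subst lborel_integrable_real_affine_iff) auto
      then show ?thesis by simp
    qed
    have z: "?M' t = 0" if "t > 0" for t using M(4)[of "- t"] that by simp
    have cont': "isCont ?M' t" if "t > 0" for t
    proof -
      have "eventually (\<lambda>s. ?M' s = 0) (nhds t)"
        using eventually_nhds_in_open[of "{0<..}" t] that z by (auto elim!: eventually_mono)
      then show ?thesis by (simp add: isCont_cong[of _ "\<lambda>_. 0"])
    qed
    have 1: "(\<lambda>n. (\<integral>r. ft k (- (r / \<delta> n)) * ft M (r / \<delta> n) \<partial>gauss) / of_real (\<delta> n * sqrt (2 * pi)))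
       \<longlonglongrightarrow> (\<integral>t. k t * M t \<partial>lborel)"
      by (rule gauss_parseval_tendsto[OF k k0 M(1,2,3) d0 dpos]) auto
    have 2: "(\<lambda>n. (\<integral>r. ft k (- (r / \<delta> n)) * ft ?M' (r / \<delta> n) \<partial>gauss) / of_real (\<delta> n * sqrt (2 * pi)))
       \<longlonglongrightarrow> (\<integral>t. k t * ?M' t \<partial>lborel)"
      by (rule gauss_parseval_tendsto[OF k k0 iM' _ cont' d0 dpos, of C]) (use M(2) in auto)
    have kM0: "k t * ?M' t = 0" for t using z[of t] k0[of t] by (cases "t > 0") auto
    have 3: "(\<integral>t. k t * ?M' t \<partial>lborel) = 0" by (simp only: kM0 Bochner_Integration.integral_zero)
    have int: "integrable gauss (\<lambda>r. ft k (- (r / \<delta> n)) * ft N (r / \<delta> n))"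
      if [measurable]: "N \<in> borel_measurable borel" for N n
      by (rule integrable_gauss_bounded[where C = "(\<integral>t. norm (k t) \<partial>lborel) * (\<integral>t. norm (N t) \<partial>lborel)"])
         (auto simp: norm_mult intro!: mult_mono ft_bound)
    have mM': "?M' \<in> borel_measurable borel" using borel_measurable_integrable[OF iM'] by simp
    have eq: "(\<integral>r. ft k (- (r / \<delta> n)) * ((ft M (r / \<delta> n) + c * cnj (ft M (r / \<delta> n))) / 2) \<partial>gauss)
        = ((\<integral>r. ft k (- (r / \<delta> n)) * ft M (r / \<delta> n) \<partial>gauss)
        + c * (\<integral>r. ft k (- (r / \<delta> n)) * ft ?M' (r / \<delta> n) \<partial>gauss)) / 2" for n
    proof -
      have "(\<integral>r. ft k (- (r / \<delta> n)) * ((ft M (r / \<delta> n) + c * cnj (ft M (r / \<delta> n))) / 2) \<partial>gauss)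
        = (\<integral>r. (ft k (- (r / \<delta> n)) * ft M (r / \<delta> n) + c * (ft k (- (r / \<delta> n)) * ft ?M' (r / \<delta> n))) / 2 \<partial>gauss)"
        unfolding cnj_ft by (simp add: algebra_simps)
      also have "\<dots> = ((\<integral>r. ft k (- (r / \<delta> n)) * ft M (r / \<delta> n) \<partial>gauss)
        + c * (\<integral>r. ft k (- (r / \<delta> n)) * ft ?M' (r / \<delta> n) \<partial>gauss)) / 2"
        using int[of M n] int[OF mM', of n] by simp
      finally show ?thesis .
    qed
    have "(\<lambda>n. ((\<integral>r. ft k (- (r / \<delta> n)) * ft M (r / \<delta> n) \<partial>gauss) / of_real (\<delta> n * sqrt (2 * pi))
        + c * ((\<integral>r. ft k (- (r / \<delta> n)) * ft ?M' (r / \<delta> n) \<partial>gauss) / of_real (\<delta> n * sqrt (2 * pi)))) / 2)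
        \<longlonglongrightarrow> ((\<integral>t. k t * M t \<partial>lborel) + c * (\<integral>t. k t * ?M' t \<partial>lborel)) / 2"
      by (intro tendsto_intros 1 2) auto
    then show ?thesis unfolding eq 3 by (simp add: add_divide_distrib mult_ac)
  qed
  \<comment> \<open>\<open>a0\<close> keeps the real part of \<open>ft M0\<close>, \<open>b0\<close>
    keeps \<open>\<i>\<close> times the imaginary part of \<open>ft M1\<close>. The latter removes
    the real constant in \<open>ft1\<close>, so that \<open>b0\<close> is \<open>a0\<close>
    multiplied by \<open>- \<i> r / \<delta>\<close>.\<close>
  define a0 b0 where "a0 n r = ft k (- (r / \<delta> n)) * ((ft M0 (r / \<delta> n) + 1 * cnj (ft M0 (r / \<delta> n))) / 2)"
    and "b0 n r = ft k (- (r / \<delta> n)) * ((ft M1 (r / \<delta> n) + (- 1) * cnj (ft M1 (r / \<delta> n))) / 2)" for n r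
  have a0_eq: "a0 n r = ft k (- (r / \<delta> n)) * of_real (Re (ft M0 (r / \<delta> n)))" for n r
    by (simp add: a0_def complex_add_cnj)
  have b0_eq: "b0 n r = - \<i> * of_real (r / \<delta> n) * a0 n r" for n r
    unfolding a0_def b0_def ft1 by (simp add: algebra_simps add_divide_distrib diff_divide_distrib)
  have half: "norm ((x + c * cnj x) / 2) \<le> B" if "norm x \<le> B" "norm c = 1" for x c :: complex and B
    using norm_triangle_ineq[of x "c * cnj x"] that by (simp add: norm_mult norm_divide)
  have ia: "integrable gauss (a0 n)" for n
  proof (rule integrable_gauss_bounded)
    show "a0 n \<in> borel_measurable borel" unfolding a0_def[abs_def] by measurable
    show "norm (a0 n r) \<le> (\<integral>t. norm (k t) \<partial>lborel) * (\<integral>t. norm (M0 t) \<partial>lborel)" for r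
      unfolding a0_def norm_mult[of "ft k _"] by (intro mult_mono half ft_bound) auto
  qed
  have ib: "integrable gauss (b0 n)" for n
  proof (rule integrable_gauss_bounded)
    show "b0 n \<in> borel_measurable borel" unfolding b0_def[abs_def] by measurable
    show "norm (b0 n r) \<le> (\<integral>t. norm (k t) \<partial>lborel) * (\<integral>t. norm (M1 t) \<partial>lborel)" for r
      unfolding b0_def norm_mult[of "ft k _"] by (intro mult_mono half ft_bound) auto
  qed
  have neg: "Re ((\<integral>r. b0 n r \<partial>gauss) * cnj (\<integral>r. a0 n r \<partial>gauss)) \<le> 0" for n
  proof -
    define I J where "I = (\<integral>r. a0 n r \<partial>gauss)" and "J = (\<integral>r. b0 n r \<partial>gauss)"
    \<comment> \<open>Symmetrising in \<open>r\<close> and \<open>s\<close> gives a pointwise sign: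
      what remains is the nonnegative weight \<open>x * y\<close> times the expression controlled by
      \<open>ksgn\<close>.\<close>
    have pt: "Re (b0 n r * cnj (a0 n s)) + Re (b0 n s * cnj (a0 n r)) \<le> 0" for r s
    proof -
      define p q x y where "p = ft k (- (r / \<delta> n))" and "q = ft k (- (s / \<delta> n))"
        and "x = Re (ft M0 (r / \<delta> n))" and "y = Re (ft M0 (s / \<delta> n))"
      have xy: "x \<ge> 0" "y \<ge> 0" using pos by (auto simp: x_def y_def)
      have "Re (b0 n r * cnj (a0 n s)) + Re (b0 n s * cnj (a0 n r)) = (x * y) * ((r / \<delta> n - s / \<delta> n) * Im (p * cnj q))"
        unfolding b0_eq a0_eq p_def[symmetric] q_def[symmetric] x_def[symmetric] y_def[symmetric]
        by (simp add: algebra_simps diff_divide_distrib)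
      also have "\<dots> \<le> 0"
        unfolding p_def q_def
        by (rule mult_nonneg_nonpos[OF mult_nonneg_nonneg[OF xy] ksgn[of "r / \<delta> n" "s / \<delta> n"]])
      finally show ?thesis .
    qed
    have i1: "integrable gauss (\<lambda>s. b0 n r * cnj (a0 n s))" for r using ia by simp
    have i2: "integrable gauss (\<lambda>s. b0 n s * cnj (a0 n r))" for r using ib by simp
    \<comment> \<open>The pointwise inequality is integrated over \<open>s\<close> and then over
      \<open>r\<close>; both halves give \<open>Re (J * cnj I)\<close>.\<close>
    have "Re (b0 n r * cnj I) + Re (J * cnj (a0 n r)) \<le> 0" for r
    proof -
      have "Re (b0 n r * cnj I) + Re (J * cnj (a0 n r)) =
          (\<integral>s. Re (b0 n r * cnj (a0 n s)) + Re (b0 n s * cnj (a0 n r)) \<partial>gauss)"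
      proof -
        have "b0 n r * cnj I = (\<integral>s. b0 n r * cnj (a0 n s) \<partial>gauss)" using ia by (simp add: I_def)
        moreover have "J * cnj (a0 n r) = (\<integral>s. b0 n s * cnj (a0 n r) \<partial>gauss)" using ib by (simp add: J_def)
        ultimately show ?thesis
          by (simp only: integral_Re_add[OF i1[of r] i2[of r]])
      qed
      also have "\<dots> \<le> 0"
        by (intro integral_nonpos_pointwise pt)
      finally show ?thesis .
    qed
    then have "(\<integral>r. Re (b0 n r * cnj I) + Re (J * cnj (a0 n r)) \<partial>gauss) \<le> 0"
      by (intro integral_nonpos_pointwise)
    moreover have "(\<integral>r. Re (b0 n r * cnj I) + Re (J * cnj (a0 n r)) \<partial>gauss) = Re (J * cnj I) + Re (J * cnj I)"
    proof -
      have "J * cnj I = (\<integral>r. b0 n r * cnj I \<partial>gauss)" using ib by (simp add: J_def)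
      moreover have "J * cnj I = (\<integral>r. J * cnj (a0 n r) \<partial>gauss)" using ia by (simp add: I_def)
      moreover have "integrable gauss (\<lambda>r. b0 n r * cnj I)" "integrable gauss (\<lambda>r. J * cnj (a0 n r))"
        using ia ib by auto
      ultimately show ?thesis
        by (simp only: integral_Re_add)
    qed
    ultimately have "Re (J * cnj I) \<le> 0" by linarith
    then show ?thesis unfolding I_def J_def .
  qed
  have "(\<lambda>n. Re (((\<integral>r. b0 n r \<partial>gauss) / of_real (\<delta> n * sqrt (2 * pi))) * cnj ((\<integral>r. a0 n r \<partial>gauss) / of_real (\<delta> n * sqrt (2 * pi)))))
      \<longlonglongrightarrow> Re (((\<integral>t. k t * M1 t \<partial>lborel) / 2) * cnj ((\<integral>t. k t * M0 t \<partial>lborel) / 2))"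
    unfolding a0_def b0_def
    by (intro tendsto_intros tendsto_Re tendsto_cnj lim[OF M0] lim[OF M1]) auto
  moreover have "Re (((\<integral>r. b0 n r \<partial>gauss) / of_real (\<delta> n * sqrt (2 * pi))) * cnj ((\<integral>r. a0 n r \<partial>gauss) / of_real (\<delta> n * sqrt (2 * pi)))) \<le> 0" for n
  proof -
    have "((\<integral>r. b0 n r \<partial>gauss) / of_real (\<delta> n * sqrt (2 * pi))) * cnj ((\<integral>r. a0 n r \<partial>gauss) / of_real (\<delta> n * sqrt (2 * pi)))
       = ((\<integral>r. b0 n r \<partial>gauss) * cnj (\<integral>r. a0 n r \<partial>gauss)) / of_real ((\<delta> n * sqrt (2 * pi))\<^sup>2)"
      by (simp add: power2_eq_square)
    then have "Re (((\<integral>r. b0 n r \<partial>gauss) / of_real (\<delta> n * sqrt (2 * pi))) * cnj ((\<integral>r. a0 n r \<partial>gauss) / of_real (\<delta> n * sqrt (2 * pi))))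
       = Re ((\<integral>r. b0 n r \<partial>gauss) * cnj (\<integral>r. a0 n r \<partial>gauss)) / (\<delta> n * sqrt (2 * pi))\<^sup>2"
      by (simp only: Re_divide_of_real)
    then show ?thesis using neg[of n] by (simp add: divide_nonpos_nonneg)
  qed
  ultimately have "Re (((\<integral>t. k t * M1 t \<partial>lborel) / 2) * cnj ((\<integral>t. k t * M0 t \<partial>lborel) / 2)) \<le> 0"
    by (intro LIMSEQ_le_const2) auto
  then show ?thesis by simp
qed

section \<open>Preservation of monotonicity for shapes at most one\<close>

lemma isCont_rderiv:
  assumes "A holomorphic_on {z. Re z > 0}" "Re z > 0"
  shows "isCont (rderiv A) z"
proof -
  have "isCont (deriv A) z"
    using holomorphic_deriv[OF assms(1) open_rhp] assms(2) open_rhp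
    by (intro continuous_on_interior[of "{z. Re z > 0}"] holomorphic_on_imp_continuous_on)
       (auto simp: interior_open)
  moreover have "eventually (\<lambda>y. rderiv A y = deriv A y) (nhds z)"
    using eventually_nhds_in_open[OF open_rhp, of z] assms(2)
    by (auto elim!: eventually_mono simp: rderiv_def)
  ultimately show ?thesis by (simp add: isCont_cong)
qed

lemma Arg_less_iff_Im:
  assumes "Re p > 0" "Re p = Re q"
  shows "Arg p < Arg q \<longleftrightarrow> Im p < Im q"
  using assms arg_conv_arctan[of p] arg_conv_arctan[of q] by (simp add: arctan_less_iff divide_less_cancel)

lemma Arg_bound: "Re p > 0 \<Longrightarrow> \<bar>Arg p\<bar> < pi / 2"
  using arg_conv_arctan[of p] arctan_bounded[of "Im p / Re p"] by (auto simp: abs_less_iff)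

text \<open>On a vertical line in the right half plane the argument increases with the imaginary
  part, and two arguments differ by less than \<open>pi\<close>. For \<open>\<gamma> \<le> 1\<close>
  the angle \<open>\<gamma> * \<theta>\<close> stays within \<open>pi\<close>, so its sine has the
  sign of \<open>\<theta>\<close> or vanishes; this is the source of the restriction on the
  shape.\<close>

lemma powr_neg_pairing_sign:
  assumes p: "Re p > 0" "Re p = Re q" and \<gamma>: "0 < \<gamma>" "\<gamma> \<le> 1"
  shows "(Im p - Im q) * Im (p powr (- of_real \<gamma>) * cnj (q powr (- of_real \<gamma>))) \<le> 0"
proof -
  have pq: "Re q > 0" using p by simp
  define \<theta> where "\<theta> = Arg p - Arg q"
  have \<theta>: "\<bar>\<theta>\<bar> < pi"
    using Arg_bound[of p] Arg_bound[of q] p by (auto simp: \<theta>_def abs_less_iff)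
  have pw: "x powr (- of_real \<gamma>) = of_real (norm x powr - \<gamma>) * cis (- \<gamma> * Arg x)" if "Re x > 0" for x
  proof -
    have "x \<noteq> 0" using that by auto
    then have "x powr (- of_real \<gamma>) = exp (- of_real \<gamma> * (of_real (ln (norm x)) + \<i> * of_real (Arg x)))"
      by (simp add: powr_def Ln_Arg)
    also have "\<dots> = exp (of_real (- \<gamma> * ln (norm x))) * exp (\<i> * of_real (- \<gamma> * Arg x))"
      by (simp add: algebra_simps flip: exp_add)
    also have "exp (complex_of_real (- \<gamma> * ln (norm x))) = of_real (norm x powr - \<gamma>)"
      using \<open>x \<noteq> 0\<close> by (simp only: exp_of_real powr_def) simp
    finally show ?thesis by (simp only: cis_conv_exp)
  qed
  have "p powr (- of_real \<gamma>) * cnj (q powr (- of_real \<gamma>)) =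
      of_real (norm p powr - \<gamma> * norm q powr - \<gamma>) * cis (- \<gamma> * \<theta>)"
    using p by (simp add: pw cis_cnj cis_mult \<theta>_def algebra_simps)
  then have eq: "Im (p powr (- of_real \<gamma>) * cnj (q powr (- of_real \<gamma>))) = - (norm p powr - \<gamma> * norm q powr - \<gamma>) * sin (\<gamma> * \<theta>)"
    by simp
  have "(Im p - Im q) * sin (\<gamma> * \<theta>) \<ge> 0"
  proof (cases "Im p = Im q")
    case False
    have le: "\<gamma> * \<bar>\<theta>\<bar> \<le> pi"
      using \<theta> \<gamma> mult_mono[of \<gamma> 1 "\<bar>\<theta>\<bar>" pi] by simp
    show ?thesis
    proof (cases "Im p > Im q")
      case True
      then have "\<theta> > 0" using iffD2[OF Arg_less_iff_Im[OF pq(1) p(2)[symmetric]]] by (simp add: \<theta>_def)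
      then have "sin (\<gamma> * \<theta>) \<ge> 0" using le \<gamma> by (intro sin_ge_zero) auto
      then show ?thesis using True by simp
    next
      case f: False
      then have "Im p < Im q" using False by simp
      then have "\<theta> < 0" using iffD2[OF Arg_less_iff_Im[OF p]] by (simp add: \<theta>_def)
      then have "sin (\<gamma> * (- \<theta>)) \<ge> 0" using le \<gamma> by (intro sin_ge_zero) (auto simp: mult_nonneg_nonpos)
      then show ?thesis using f by (intro mult_nonpos_nonpos) auto
    qed
  qed simp
  then have "0 \<le> (norm p powr - \<gamma> * norm q powr - \<gamma>) * ((Im p - Im q) * sin (\<gamma> * \<theta>))"
    by (rule mult_nonneg_nonneg[rotated]) simp
  then show ?thesis unfolding eq by (simp add: mult_ac)
qed

text \<open>The function \<open>A (z + t) * cnj (A z)\<close> of \<open>t > 0\<close>, damped by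
  \<open>exp (- \<sigma> t)\<close>, has a transform with nonnegative real part: this is
  \<open>gop_one_disc\<close> at the rates \<open>\<sigma> - \<i> r\<close>. Pairing it and its
  derivative with the rest of the gamma kernel gives the claim up to an error of order
  \<open>\<sigma>\<close>.\<close>

lemma gop_pairing:
  assumes A: "rdecr A" and w: "Re w > 0" and g: "0 < \<gamma>" "\<gamma> \<le> 1" and z: "Re z > 0"
  shows "Re (gop w \<gamma> (rderiv A) z * cnj (gop w \<gamma> A z)) \<le> 0"
proof -
  have mA [measurable]: "A \<in> borel_measurable borel" by (rule rdecr_measurable[OF A])
  have mA' [measurable]: "rderiv A \<in> borel_measurable borel"
    by (rule rderiv_measurable[OF rdecr_holomorphic[OF A]])
  obtain B where B: "\<And>t. t \<ge> 0 \<Longrightarrow> norm (rderiv A (z + of_real t)) \<le> B"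
    using rderiv_bound[OF A z] by blast
  have B0: "B \<ge> 0" using B[of 0] norm_ge_zero order_trans by blast
  have Ab: "norm (A (z + of_real t)) \<le> norm (A z)" if "t \<ge> 0" for t
    using rdecr_le[OF A z that] .
  define I J where "I = gop w \<gamma> A z" and "J = gop w \<gamma> (rderiv A) z"
  \<comment> \<open>Both sides carry \<open>|A z|^2\<close> because \<open>cnj (A z)\<close> is a
    factor of \<open>M0\<close> and of \<open>M1\<close>; it is cancelled at the end.\<close>
  have main: "(norm (A z))\<^sup>2 * Re (J * cnj I) \<le> \<sigma> * ((norm (A z))\<^sup>2 * (norm I)\<^sup>2)" if \<sigma>: "0 < \<sigma>" "\<sigma> < Re w" for \<sigma>
  proof -
    define c where "c = cnj (A z)"
    \<comment> \<open>A part \<open>\<sigma>\<close> of the rate is moved from the kernel to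
      \<open>A\<close> to make \<open>M0\<close> integrable.\<close>
    define v where "v = w - of_real \<sigma>"
    have v: "Re v > 0" using \<sigma> by (simp add: v_def)
    define k where "k t = of_real (pw \<gamma> t) * exp (- v * of_real t)" for t
    define M0 where "M0 t = of_real (pw 1 t) * exp (- of_real \<sigma> * of_real t) * (A (z + of_real t) * c)" for t
    \<comment> \<open>The derivative of \<open>M0\<close> on \<open>t > 0\<close>.\<close>
    define M1 where "M1 t = of_real (pw 1 t) * exp (- of_real \<sigma> * of_real t) * ((rderiv A (z + of_real t) - of_real \<sigma> * A (z + of_real t)) * c)" for t
    define C where "C = norm (A z) * norm c + (B + \<sigma> * norm (A z)) * norm c"
    have C1: "norm (A (z + of_real t) * c) \<le> C" and
      C2: "norm ((rderiv A (z + of_real t) - of_real \<sigma> * A (z + of_real t)) * c) \<le> C" if "t \<ge> 0" for t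
    proof -
      have "norm (A (z + of_real t) * c) \<le> norm (A z) * norm c"
        unfolding norm_mult using Ab[OF that] by (intro mult_right_mono) auto
      also have "\<dots> \<le> C" using B0 \<sigma> by (simp add: C_def)
      finally show "norm (A (z + of_real t) * c) \<le> C" .
      have "norm (rderiv A (z + of_real t) - of_real \<sigma> * A (z + of_real t)) \<le> B + \<sigma> * norm (A z)"
      proof (rule order_trans[OF norm_triangle_ineq4 add_mono])
        show "norm (of_real \<sigma> * A (z + of_real t)) \<le> \<sigma> * norm (A z)"
          using Ab[OF that] \<sigma> by (simp add: norm_mult)
      qed (use B that in auto)
      then have "norm ((rderiv A (z + of_real t) - of_real \<sigma> * A (z + of_real t)) * c) \<le> (B + \<sigma> * norm (A z)) * norm c"
        unfolding norm_mult by (intro mult_right_mono) auto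
      also have "\<dots> \<le> C" by (simp add: C_def)
      finally show "norm ((rderiv A (z + of_real t) - of_real \<sigma> * A (z + of_real t)) * c) \<le> C" .
    qed
    have C0: "C \<ge> 0" using C1[of 0] norm_ge_zero order_trans by blast
    have e1: "norm (of_real (pw 1 t) * exp (- complex_of_real \<sigma> * of_real t) * x) \<le> norm x" for t x
    proof (cases "t > 0")
      case True
      have "norm x * exp (- (\<sigma> * t)) \<le> norm x * 1" using \<sigma> True by (intro mult_left_mono) auto
      then show ?thesis using True by (simp add: norm_mult pw_def mult.commute)
    qed auto
    have k: "integrable lborel k"
      unfolding k_def[abs_def]
      using gop_integrable[of "\<lambda>_. 1" z 1 v \<gamma>] v g by simp
    have bd: "norm (M0 t) \<le> C" "norm (M1 t) \<le> C" for t
    proof -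
      show "norm (M0 t) \<le> C"
      proof (cases "t > 0")
        case True
        then show ?thesis
          unfolding M0_def using C1[of t] e1[of t "A (z + of_real t) * c"] by linarith
      qed (use C0 in \<open>simp add: M0_def\<close>)
      show "norm (M1 t) \<le> C"
      proof (cases "t > 0")
        case True
        then show ?thesis
          unfolding M1_def using C2[of t]
            e1[of t "(rderiv A (z + of_real t) - of_real \<sigma> * A (z + of_real t)) * c"] by linarith
      qed (use C0 in \<open>simp add: M1_def\<close>)
    qed
    have iA: "integrable lborel (\<lambda>t. of_real (pw \<beta> t) * exp (- u * of_real t) * A (z + of_real t))"
      and iA': "integrable lborel (\<lambda>t. of_real (pw \<beta> t) * exp (- u * of_real t) * rderiv A (z + of_real t))"
      if "Re u > 0" "\<beta> > 0" for u \<beta>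
      by (rule gop_integrable[of _ _ "norm (A z)"]; use that Ab in simp)
         (rule gop_integrable[of _ _ B]; use that B in simp)
    have iM0: "integrable lborel M0"
    proof -
      have "integrable lborel (\<lambda>t. (of_real (pw 1 t) * exp (- of_real \<sigma> * of_real t) * A (z + of_real t)) * c)"
        using iA[of "of_real \<sigma>" 1] \<sigma> by (intro integrable_mult_left) simp_all
      then show ?thesis by (simp add: M0_def[abs_def] mult.assoc)
    qed
    have M1_eq: "M1 t = ((of_real (pw 1 t) * exp (- of_real \<sigma> * of_real t) * rderiv A (z + of_real t))
        - of_real \<sigma> * (of_real (pw 1 t) * exp (- of_real \<sigma> * of_real t) * A (z + of_real t))) * c" for t
      by (simp add: M1_def algebra_simps)
    have iM1: "integrable lborel M1"
      unfolding M1_eq[abs_def] using iA[of "of_real \<sigma>" 1] iA'[of "of_real \<sigma>" 1] \<sigma>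
      by (intro integrable_mult_left Bochner_Integration.integrable_diff integrable_mult_right) simp_all
    have cA: "isCont (\<lambda>t. A (z + of_real t)) t" and cA': "isCont (\<lambda>t. rderiv A (z + of_real t)) t" if t: "t > 0" for t
    proof -
      have "isCont A (z + of_real t)"
        using z t by (intro DERIV_isCont[OF has_field_derivative_rderiv[OF rdecr_holomorphic[OF A]]]) auto
      then show "isCont (\<lambda>t. A (z + of_real t)) t"
        by (auto intro!: isCont_o2[where g = A] isCont_add isCont_of_real)
      have "isCont (rderiv A) (z + of_real t)"
        using z t by (intro isCont_rderiv rdecr_holomorphic[OF A]) auto
      then show "isCont (\<lambda>t. rderiv A (z + of_real t)) t"
        by (auto intro!: isCont_o2[where g = "rderiv A"] isCont_add isCont_of_real)
    qed
    have cp: "isCont (\<lambda>t. complex_of_real (pw 1 t)) t" if t: "t > 0" for t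
    proof -
      have "eventually (\<lambda>s. complex_of_real (pw 1 s) = 1) (nhds t)"
        using eventually_nhds_in_open[of "{0<..}" t] t by (auto elim!: eventually_mono simp: pw_def)
      then show ?thesis by (simp add: isCont_cong[of _ "\<lambda>_. 1"])
    qed
    have cM0: "isCont M0 t" and cM1: "isCont M1 t" if "t > 0" for t
      unfolding M0_def[abs_def] M1_def[abs_def]
      using cA[OF that] cA'[OF that] cp[OF that] by (auto intro!: continuous_intros)
    have ftM0: "ft M0 r = gop (of_real \<sigma> - \<i> * of_real r) 1 A z * c" for r
    proof -
      have "M0 t * exp (\<i> * of_real (r * t)) =
         (of_real (pw 1 t) * exp (- (of_real \<sigma> - \<i> * of_real r) * of_real t) * A (z + of_real t)) * c" for t
        by (simp add: M0_def algebra_simps flip: exp_add)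
      then show ?thesis unfolding ft_def gop_def by (simp only: integral_mult_left_zero)
    qed
    have ftM1: "ft M1 r = (gop (of_real \<sigma> - \<i> * of_real r) 1 (rderiv A) z - of_real \<sigma> * gop (of_real \<sigma> - \<i> * of_real r) 1 A z) * c" for r
    proof -
      let ?u = "of_real \<sigma> - \<i> * of_real r"
      have "M1 t * exp (\<i> * of_real (r * t)) =
         ((of_real (pw 1 t) * exp (- ?u * of_real t) * rderiv A (z + of_real t)) -
          of_real \<sigma> * (of_real (pw 1 t) * exp (- ?u * of_real t) * A (z + of_real t))) * c" for t
        by (simp add: M1_def algebra_simps flip: exp_add)
      then show ?thesis unfolding ft_def gop_def
        using iA[of ?u 1] iA'[of ?u 1] \<sigma> by (simp only: integral_mult_left_zero) simp
    qed
    have neg: "Re ((\<integral>t. k t * M1 t \<partial>lborel) * cnj (\<integral>t. k t * M0 t \<partial>lborel)) \<le> 0"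
    proof (rule positive_definite_pairing[OF k _ iM0 bd(1) cM0 _ iM1 bd(2) cM1])
      \<comment> \<open>The constant is minus the boundary value \<open>A z * cnj (A z)\<close> of
        \<open>M0\<close>; the factor \<open>cnj (A z)\<close> was inserted to make it real.\<close>
      show "ft M1 r = - of_real ((norm (A z))\<^sup>2) - \<i> * of_real r * ft M0 r" for r
      proof -
        have eq: "gop (of_real \<sigma> - \<i> * of_real r) 1 (rderiv A) z =
            (of_real \<sigma> - \<i> * of_real r) * gop (of_real \<sigma> - \<i> * of_real r) 1 A z - A z"
          by (rule gop_one_rderiv[OF A _ z]) (use \<sigma> in simp)
        show ?thesis
          unfolding ftM0 ftM1 eq complex_norm_square by (simp add: c_def algebra_simps)
      qed
      show "0 \<le> Re (ft M0 r)" for r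
      proof -
        let ?u = "of_real \<sigma> - \<i> * of_real r"
        have "0 \<le> Re ?u * (norm (gop ?u 1 A z))\<^sup>2" using \<sigma> by simp
        also have "\<dots> \<le> Re (A z * cnj (gop ?u 1 A z))"
          by (rule gop_one_disc[OF A _ z]) (use \<sigma> in simp)
        finally show ?thesis unfolding ftM0 c_def by (simp add: mult.commute)
      qed
      show "(r - s) * Im (ft k (- r) * cnj (ft k (- s))) \<le> 0" for r s
      proof -
        have ftk: "ft k (- r) = of_real (Gamma \<gamma>) * (v + \<i> * of_real r) powr (- of_real \<gamma>)" for r
        proof -
          have "k t * exp (\<i> * of_real (- r * t)) = of_real (pw \<gamma> t) * exp (- (v + \<i> * of_real r) * of_real t)" for t
            by (simp add: k_def algebra_simps flip: exp_add)
          then show ?thesis unfolding ft_def using complex_gamma_integral[OF g(1), of "v + \<i> * of_real r"] v by simp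
        qed
        let ?p = "v + \<i> * of_real r" and ?q = "v + \<i> * of_real s"
        have "ft k (- r) * cnj (ft k (- s)) = of_real ((Gamma \<gamma>)\<^sup>2) * (?p powr (- of_real \<gamma>) * cnj (?q powr (- of_real \<gamma>)))"
          by (simp add: ftk power2_eq_square)
        then have "(r - s) * Im (ft k (- r) * cnj (ft k (- s))) =
            (Gamma \<gamma>)\<^sup>2 * ((Im ?p - Im ?q) * Im (?p powr (- of_real \<gamma>) * cnj (?q powr (- of_real \<gamma>))))"
          by simp
        also have "\<dots> \<le> 0"
          by (rule mult_nonneg_nonpos[OF zero_le_power2 powr_neg_pairing_sign]) (use v g in auto)
        finally show ?thesis .
      qed
    qed (auto simp: k_def M0_def M1_def)
    have kexp: "k t * (of_real (pw 1 t) * exp (- of_real \<sigma> * of_real t) * x) =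
        of_real (pw \<gamma> t) * exp (- w * of_real t) * x" for t x
    proof (cases "t > 0")
      case True
      have "exp (- v * of_real t) * exp (- of_real \<sigma> * of_real t) = exp (- w * of_real t)"
        unfolding exp_add[symmetric] by (intro arg_cong[where f = exp]) (simp add: v_def algebra_simps)
      moreover have "pw 1 t = 1" using True by (simp add: pw_def)
      ultimately show ?thesis by (simp add: k_def mult.assoc[symmetric])
    qed (simp add: k_def)
    have "(\<integral>t. k t * M0 t \<partial>lborel) = I * c"
    proof -
      have "k t * M0 t = (of_real (pw \<gamma> t) * exp (- w * of_real t) * A (z + of_real t)) * c" for t
        unfolding M0_def kexp by simp
      then show ?thesis unfolding I_def gop_def by (simp only: integral_mult_left_zero)
    qed
    moreover have "(\<integral>t. k t * M1 t \<partial>lborel) = (J - of_real \<sigma> * I) * c"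
    proof -
      have "k t * M1 t = ((of_real (pw \<gamma> t) * exp (- w * of_real t) * rderiv A (z + of_real t))
         - of_real \<sigma> * (of_real (pw \<gamma> t) * exp (- w * of_real t) * A (z + of_real t))) * c" for t
        unfolding M1_def kexp by (simp add: algebra_simps)
      then show ?thesis unfolding I_def J_def gop_def
        using iA[of w \<gamma>] iA'[of w \<gamma>] w g by (simp only: integral_mult_left_zero) simp
    qed
    ultimately have "Re (((J - of_real \<sigma> * I) * c) * cnj (I * c)) \<le> 0" using neg by (simp only:)
    also have "((J - of_real \<sigma> * I) * c) * cnj (I * c) = (c * cnj c) * (J * cnj I) - of_real \<sigma> * ((c * cnj c) * (I * cnj I))"
      by (simp add: algebra_simps)
    also have "\<dots> = of_real ((norm c)\<^sup>2) * (J * cnj I) - of_real (\<sigma> * ((norm c)\<^sup>2 * (norm I)\<^sup>2))"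
      unfolding complex_norm_square[symmetric] by simp
    finally show ?thesis by (simp add: c_def)
  qed
  show ?thesis
  proof (cases "A z = 0")
    case True
    have "A (z + of_real t) = 0" if "t \<ge> 0" for t using Ab[OF that] True by simp
    then have "of_real (pw \<gamma> t) * exp (- w * of_real t) * A (z + of_real t) = 0" for t by (cases "t > 0") auto
    then have "I = 0" unfolding I_def gop_def by (simp only: Bochner_Integration.integral_zero)
    then show ?thesis by (simp add: I_def)
  next
    case False
    have le: "Re (J * cnj I) \<le> \<sigma> * (norm I)\<^sup>2" if "0 < \<sigma>" "\<sigma> < Re w" for \<sigma>
    proof -
      have "(norm (A z))\<^sup>2 * Re (J * cnj I) \<le> (norm (A z))\<^sup>2 * (\<sigma> * (norm I)\<^sup>2)"
        using main[OF that] by (simp only: mult.left_commute)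
      then show ?thesis using False by (simp only: mult_le_cancel_left) auto
    qed
    have "((\<lambda>\<sigma>. \<sigma> * (norm I)\<^sup>2) \<longlongrightarrow> 0 * (norm I)\<^sup>2) (at_right 0)" by (intro tendsto_intros)
    then have "((\<lambda>\<sigma>. \<sigma> * (norm I)\<^sup>2) \<longlongrightarrow> 0) (at_right 0)" by simp
    then have "Re (J * cnj I) \<le> 0"
      by (rule tendsto_lowerbound) (use le w in \<open>auto simp: eventually_at_right_field intro!: exI[of _ "Re w"]\<close>)
    then show ?thesis by (simp add: I_def J_def)
  qed
qed

lemma rdecr_gop_le_one:
  assumes A: "rdecr A" and w: "Re w > 0" and g: "0 < \<gamma>" "\<gamma> \<le> 1"
  shows "rdecr (gop w \<gamma> A)"
proof (rule rdecrI)
  fix z :: complex assume "Re z > 0"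
  then show "Re (rderiv (gop w \<gamma> A) z * cnj (gop w \<gamma> A z)) \<le> 0"
    using gop_pairing[OF A w g] rderiv_gop[OF A w g(1)] by (simp only:)
qed (intro gop_holomorphic gop_measurable rdecr_measurable assms)+

section \<open>Composition of gamma operators and arbitrary shapes\<close>

lemma has_bochner_integral_pw_convolution:
  assumes a: "a > 0" and b: "b > 0"
  shows "has_bochner_integral lborel (\<lambda>s. pw a s * pw b (u - s)) (Beta a b * pw (a + b) u)"
proof (cases "u > 0")
  case True
  have 1: "pw a v * pw b (1 - v) = indicator {0..1} v *\<^sub>R (v powr (a - 1) * (1 - v) powr (b - 1))" for v
    by (cases "v = 0"; cases "v = 1") (auto simp: pw_def indicator_def)
  have i: "integrable lborel (\<lambda>v. pw a v * pw b (1 - v))"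
    using integrable_Beta[OF a b] unfolding 1 set_integrable_def .
  have "(\<integral>v. pw a v * pw b (1 - v) \<partial>lborel) = Beta a b"
    using set_borel_integral_eq_integral(2)[OF integrable_Beta[OF a b]] has_integral_Beta_real[OF a b]
    unfolding 1 set_lebesgue_integral_def by (simp add: integral_unique)
  then have hb: "has_bochner_integral lborel (\<lambda>v. pw a v * pw b (1 - v)) (Beta a b)"
    using i by (simp add: has_bochner_integral_iff)
  have eq: "pw a (0 + u * v) * pw b (u - (0 + u * v)) = u powr (a + b - 2) * (pw a v * pw b (1 - v))" for v
  proof -
    have "u - u * v > 0 \<longleftrightarrow> v < 1" "u * v > 0 \<longleftrightarrow> v > 0" using True by (auto simp: zero_less_mult_iff)
    moreover have "(u - u * v) = u * (1 - v)" by (simp add: algebra_simps)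
    moreover have "u powr (a + b - 2) = u powr (a - 1) * u powr (b - 1)"
      by (simp flip: powr_add)
    ultimately show ?thesis using True by (auto simp: pw_def powr_mult)
  qed
  have hb': "has_bochner_integral lborel (\<lambda>v. pw a (0 + u * v) * pw b (u - (0 + u * v))) (u powr (a + b - 2) * Beta a b)"
    unfolding eq by (rule has_bochner_integral_mult_right[OF hb])
  have "u powr (a + b - 2) * Beta a b = (Beta a b * pw (a + b) u) /\<^sub>R \<bar>u\<bar>"
    using True powr_mult_base[of u "a + b - 2"] by (simp add: pw_def field_simps)
  then have "has_bochner_integral lborel (\<lambda>v. pw a (0 + u * v) * pw b (u - (0 + u * v))) ((Beta a b * pw (a + b) u) /\<^sub>R \<bar>u\<bar>)"
    using hb' by (simp only:)
  then show ?thesis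
    using True by (subst lborel_has_bochner_integral_real_affine_iff[of u _ _ 0]) simp_all
next
  case False
  have z: "pw a s * pw b (u - s) = 0" for s using False by (cases "s > 0") auto
  show ?thesis unfolding z using False by (simp add: has_bochner_integral_zero)
qed

lemma gop_cong: "(\<And>t. t > 0 \<Longrightarrow> A (z + of_real t) = B (z + of_real t)) \<Longrightarrow> gop w \<gamma> A z = gop w \<gamma> B z"
  unfolding gop_def
proof (intro Bochner_Integration.integral_cong refl)
  fix t
  assume "\<And>t. t > 0 \<Longrightarrow> A (z + of_real t) = B (z + of_real t)"
  then show "of_real (pw \<gamma> t) * exp (- w * of_real t) * A (z + of_real t) = of_real (pw \<gamma> t) * exp (- w * of_real t) * B (z + of_real t)"
    by (cases "t > 0") auto
qed

text \<open>Powers convolve by the Beta integral and exponentials of equal rate multiply, which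
  gives a semigroup law in the shape up to a constant. For real rates it is the addition of
  independent gamma variables.\<close>

lemma gop_compose:
  assumes A [measurable]: "A \<in> borel_measurable borel"
    and bd: "\<And>t. t > 0 \<Longrightarrow> norm (A (z + of_real t)) \<le> C"
    and w: "Re w > 0" and a: "a > 0" and b: "b > 0"
  shows "gop w a (gop w b A) z = of_real (Beta a b) * gop w (a + b) A z"
proof -
  let ?f = "\<lambda>s u. complex_of_real (pw a s * pw b (u - s)) * (exp (- w * of_real u) * A (z + of_real u))"
  have C: "C \<ge> 0" using bd[of 1] norm_ge_zero order_trans zero_less_one by blast
  note conv = has_bochner_integral_pw_convolution[OF a b]
  have inner: "(\<integral>s. ?f s u \<partial>lborel) = of_real (Beta a b) * (of_real (pw (a + b) u) * exp (- w * of_real u) * A (z + of_real u))" for u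
  proof -
    have "(\<integral>s. ?f s u \<partial>lborel) = (\<integral>s. complex_of_real (pw a s * pw b (u - s)) \<partial>lborel) * (exp (- w * of_real u) * A (z + of_real u))"
      by (rule integral_mult_left_zero)
    then show ?thesis
      using has_bochner_integral_integral_eq[OF conv, of u] by (simp only: integral_complex_of_real) simp
  qed
  have "integrable (lborel \<Otimes>\<^sub>M lborel) (\<lambda>(u, s). ?f s u)"
  proof (rule lborel_pair.Fubini_integrable)
    show "(\<lambda>(u, s). ?f s u) \<in> borel_measurable (lborel \<Otimes>\<^sub>M lborel)" by measurable
    have 1: "integrable lborel (\<lambda>s. ?f s u)" for u
      using conv[of u] by (intro integrable_mult_left) (simp add: has_bochner_integral_iff del: of_real_mult)
    then show "AE u in lborel. integrable lborel (\<lambda>s. case (u, s) of (u, s) \<Rightarrow> ?f s u)" by simp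
    have "(\<integral>s. norm (?f s u) \<partial>lborel) = Beta a b * norm (of_real (pw (a + b) u) * exp (- w * of_real u) * A (z + of_real u))" for u
    proof -
      have "norm (?f s u) = (pw a s * pw b (u - s)) * norm (exp (- w * of_real u) * A (z + of_real u))" for s
        by (simp add: norm_mult)
      then show ?thesis
        using has_bochner_integral_integral_eq[OF conv, of u] by (simp add: norm_mult)
    qed
    then show "integrable lborel (\<lambda>u. \<integral>s. norm (case (u, s) of (u, s) \<Rightarrow> ?f s u) \<partial>lborel)"
      using gop_integrable[OF A bd w, of "a + b"] a b by (simp del: norm_mult)
  qed
  from lborel_pair.Fubini_integral[OF this]
  have "(\<integral>s. (\<integral>u. ?f s u \<partial>lborel) \<partial>lborel) = (\<integral>u. (\<integral>s. ?f s u \<partial>lborel) \<partial>lborel)" by simp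
  also have "\<dots> = of_real (Beta a b) * gop w (a + b) A z"
    unfolding inner gop_def by simp
  also have "(\<integral>s. (\<integral>u. ?f s u \<partial>lborel) \<partial>lborel) = gop w a (gop w b A) z"
    unfolding gop_def[of w a]
  proof (intro Bochner_Integration.integral_cong refl)
    fix s
    have "(\<integral>u. ?f s u \<partial>lborel) = (\<integral>t. ?f s (s + 1 * t) \<partial>lborel)"
      by (subst lborel_integral_real_affine[where c = 1 and t = s]) simp_all
    also have "\<dots> = (\<integral>t. (complex_of_real (pw a s) * exp (- w * of_real s)) *
        (of_real (pw b t) * exp (- w * of_real t) * A (z + of_real s + of_real t)) \<partial>lborel)"
    proof (intro Bochner_Integration.integral_cong refl)
      fix t
      have "exp (- w * of_real (s + 1 * t)) = exp (- w * of_real s) * exp (- w * of_real t)"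
        unfolding exp_add[symmetric] by (simp add: algebra_simps)
      then show "?f s (s + 1 * t) = (complex_of_real (pw a s) * exp (- w * of_real s)) *
        (of_real (pw b t) * exp (- w * of_real t) * A (z + of_real s + of_real t))"
        by (simp only: of_real_mult of_real_add) (simp add: mult_ac add_ac)
    qed
    also have "\<dots> = complex_of_real (pw a s) * exp (- w * of_real s) * gop w b A (z + of_real s)"
      unfolding gop_def by simp
    finally show "(\<integral>u. ?f s u \<partial>lborel) = complex_of_real (pw a s) * exp (- w * of_real s) * gop w b A (z + of_real s)" .
  qed
  finally show ?thesis .
qed

text \<open>Both orders integrate \<open>A (z + s + t)\<close> against the product of the two
  kernels, and the bound along the ray justifies Fubini.\<close>

lemma gop_commute:
  assumes A [measurable]: "A \<in> borel_measurable borel"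
    and bd: "\<And>t. t > 0 \<Longrightarrow> norm (A (z + of_real t)) \<le> C"
    and w: "Re w > 0" "Re v > 0" and a: "a > 0" and b: "b > 0"
  shows "gop w a (gop v b A) z = gop v b (gop w a A) z"
proof -
  let ?p = "\<lambda>s. complex_of_real (pw a s) * exp (- w * of_real s)"
  let ?q = "\<lambda>t. complex_of_real (pw b t) * exp (- v * of_real t)"
  let ?f = "\<lambda>s t. ?p s * (?q t * A (z + of_real s + of_real t))"
  have C: "C \<ge> 0" using bd[of 1] norm_ge_zero order_trans zero_less_one by blast
  have bd': "norm (A (z + of_real s + of_real t)) \<le> C" if "s > 0" "t > 0" for s t
    using bd[of "s + t"] that by (simp add: add.assoc)
  have nq: "norm (?q t) = pw b t * exp (- Re v * t)" and np: "norm (?p t) = pw a t * exp (- Re w * t)" for t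
    by (simp_all add: norm_mult)
  have fb: "norm (?f s t) \<le> C * (norm (?p s) * norm (?q t))" for s t
  proof (cases "s > 0 \<and> t > 0")
    case True
    then have "norm (?p s) * norm (?q t) * norm (A (z + of_real s + of_real t)) \<le> norm (?p s) * norm (?q t) * C"
      using bd'[of s t] by (intro mult_left_mono) auto
    then show ?thesis by (simp only: norm_mult mult_ac)
  qed auto
  have iq: "integrable lborel (\<lambda>t. norm (?q t))" and ip: "integrable lborel (\<lambda>t. norm (?p t))"
    unfolding nq np using integrable_pw_exp[OF b w(2)] integrable_pw_exp[OF a w(1)] by auto
  have i1: "integrable lborel (\<lambda>t. ?f s t)" for s
    by (rule Bochner_Integration.integrable_bound[where f = "\<lambda>t. C * (norm (?p s) * norm (?q t))"])
       (use iq fb C in \<open>auto intro!: AE_I2 simp del: norm_mult intro: order_trans[OF fb]\<close>)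
  have "integrable (lborel \<Otimes>\<^sub>M lborel) (\<lambda>(s, t). ?f s t)"
  proof (rule lborel_pair.Fubini_integrable)
    show "(\<lambda>(s, t). ?f s t) \<in> borel_measurable (lborel \<Otimes>\<^sub>M lborel)" by measurable
    show "AE s in lborel. integrable lborel (\<lambda>t. case (s, t) of (s, t) \<Rightarrow> ?f s t)" using i1 by simp
    show "integrable lborel (\<lambda>s. \<integral>t. norm (case (s, t) of (s, t) \<Rightarrow> ?f s t) \<partial>lborel)"
    proof (rule Bochner_Integration.integrable_bound[where f = "\<lambda>s. (C * (\<integral>t. norm (?q t) \<partial>lborel)) * norm (?p s)"])
      show "integrable lborel (\<lambda>s. (C * (\<integral>t. norm (?q t) \<partial>lborel)) * norm (?p s))" using ip by (intro integrable_mult_right)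
      have "(\<integral>t. norm (?f s t) \<partial>lborel) \<le> (\<integral>t. C * (norm (?p s) * norm (?q t)) \<partial>lborel)" for s
        by (rule integral_mono) (use i1 iq fb in \<open>auto simp del: norm_mult\<close>)
      also have "\<And>s. (\<integral>t. C * (norm (?p s) * norm (?q t)) \<partial>lborel) = (C * (\<integral>t. norm (?q t) \<partial>lborel)) * norm (?p s)"
        by (simp only: integral_mult_right_zero mult_ac)
      finally show "AE s in lborel. norm (\<integral>t. norm (case (s, t) of (s, t) \<Rightarrow> ?f s t) \<partial>lborel) \<le>
          norm ((C * (\<integral>t. norm (?q t) \<partial>lborel)) * norm (?p s))"
        by (auto intro!: AE_I2 simp del: norm_mult intro: order_trans[OF _ abs_ge_self])
    qed measurable
  qed
  from lborel_pair.Fubini_integral[OF this]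
  have sw: "(\<integral>t. (\<integral>s. ?f s t \<partial>lborel) \<partial>lborel) = (\<integral>s. (\<integral>t. ?f s t \<partial>lborel) \<partial>lborel)" by simp
  have "(\<integral>t. ?f s t \<partial>lborel) = ?p s * gop v b A (z + of_real s)" for s
    unfolding gop_def by (rule integral_mult_right_zero)
  moreover have "(\<integral>s. ?f s t \<partial>lborel) = ?q t * gop w a A (z + of_real t)" for t
  proof -
    have "?f s t = ?q t * (?p s * A (z + of_real t + of_real s))" for s by (simp add: mult_ac add_ac)
    then show ?thesis unfolding gop_def by (simp only: integral_mult_right_zero)
  qed
  ultimately show ?thesis using sw unfolding gop_def[of w a "gop v b A"] gop_def[of v b "gop w a A"] by (simp only:)
qed

lemma rdecr_cmult:
  assumes B: "rdecr B" and A: "A \<in> borel_measurable borel" and eq: "\<And>z. Re z > 0 \<Longrightarrow> A z = c * B z"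
  shows "rdecr A"
  unfolding rdecr_def
proof (intro conjI allI impI A)
  have "(\<lambda>z. c * B z) holomorphic_on {z. Re z > 0}"
    by (intro holomorphic_intros rdecr_holomorphic[OF B])
  then show "A holomorphic_on {z. Re z > 0}" by (rule holomorphic_transform) (use eq in auto)
  fix z :: complex and t :: real assume "Re z > 0" "t \<ge> 0"
  then show "norm (A (z + of_real t)) \<le> norm (A z)"
    using rdecr_le[OF B, of z t] eq[of z] eq[of "z + of_real t"] by (simp add: norm_mult mult_left_mono)
qed

text \<open>The operator of shape \<open>\<gamma>\<close> is a multiple of the square of the one of
  shape \<open>\<gamma> / 2\<close>, so the shape can be halved until it is at most 1.\<close>

theorem rdecr_gop:
  assumes A: "rdecr A" and w: "Re w > 0" and g: "\<gamma> > 0"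
  shows "rdecr (gop w \<gamma> A)"
proof -
  have *: "rdecr (gop w \<gamma> A)" if "rdecr A" "0 < \<gamma>" "\<gamma> \<le> 2 ^ n" for n \<gamma> A
    using that
  proof (induction n arbitrary: \<gamma> A)
    case 0
    then show ?case using rdecr_gop_le_one[OF _ w] by simp
  next
    case (Suc n)
    define h where "h = \<gamma> / 2"
    have h: "0 < h" "h \<le> 2 ^ n" "h + h = \<gamma>" using Suc.prems by (auto simp: h_def)
    have B: "Beta h h > 0" using h(1) by (simp add: Beta_def Gamma_real_pos)
    show ?case
    proof (rule rdecr_cmult[of "gop w h (gop w h A)" _ "of_real (1 / Beta h h)"])
      show "rdecr (gop w h (gop w h A))" using Suc.IH Suc.prems(1) h by blast
      show "gop w \<gamma> A \<in> borel_measurable borel" by (intro gop_measurable rdecr_measurable Suc.prems(1))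
      fix z :: complex assume z: "Re z > 0"
      have "gop w h (gop w h A) z = of_real (Beta h h) * gop w \<gamma> A z"
        using gop_compose[OF rdecr_measurable[OF Suc.prems(1)] rdecr_le[OF Suc.prems(1) z] w h(1) h(1)] h(3) by simp
      then show "gop w \<gamma> A z = of_real (1 / Beta h h) * gop w h (gop w h A) z" using B by simp
    qed
  qed
  obtain n :: nat where "\<gamma> < 2 ^ n" using real_arch_pow[of 2 \<gamma>] by auto
  then show ?thesis using *[OF A g, of n] by simp
qed

text \<open>For shape \<open>\<gamma> + 1\<close> the factor \<open>t powr \<gamma>\<close> kills
  the boundary term at 0. Only the values at \<open>z + t\<close> with \<open>t > 0\<close> enter,
  so \<open>z\<close> may lie on the imaginary axis; \<open>z = 0\<close> is the point at which
  expectations are read off.\<close>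

lemma gop_by_parts:
  assumes A: "A \<in> borel_measurable borel" "A holomorphic_on {z. Re z > 0}" and z: "Re z \<ge> 0"
    and bd: "\<And>t. t > 0 \<Longrightarrow> norm (A (z + of_real t)) \<le> C"
    and bd': "\<And>t. t > 0 \<Longrightarrow> norm (rderiv A (z + of_real t)) \<le> C"
    and w: "Re w > 0" and g: "\<gamma> > 0"
  shows "gop w (\<gamma> + 1) (rderiv A) z = w * gop w (\<gamma> + 1) A z - of_real \<gamma> * gop w \<gamma> A z"
proof -
  let ?e = "\<lambda>t. exp (- w * of_real t) * A (z + of_real t)"
  let ?F = "\<lambda>t. of_real (t powr \<gamma>) * ?e t"
  let ?f = "\<lambda>t. of_real (t powr \<gamma>) * (exp (- w * of_real t) * rderiv A (z + of_real t) - w * ?e t)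
      + of_real (\<gamma> * t powr (\<gamma> - 1)) * ?e t"
  have i1: "integrable lborel (\<lambda>t. of_real (pw (\<gamma> + 1) t) * exp (- w * of_real t) * rderiv A (z + of_real t))"
    by (rule gop_integrable[OF rderiv_measurable[OF A(2)] bd' w]) (use g in auto)
  have i2: "integrable lborel (\<lambda>t. of_real (pw (\<gamma> + 1) t) * exp (- w * of_real t) * A (z + of_real t))"
    by (rule gop_integrable[OF A(1) bd w]) (use g in auto)
  have i3: "integrable lborel (\<lambda>t. of_real (pw \<gamma> t) * exp (- w * of_real t) * A (z + of_real t))"
    by (rule gop_integrable[OF A(1) bd w g])
  have eq: "(\<lambda>t. indicator {0<..} t *\<^sub>R ?f t) = (\<lambda>t. of_real (pw (\<gamma> + 1) t) * exp (- w * of_real t) * rderiv A (z + of_real t)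
       - w * (of_real (pw (\<gamma> + 1) t) * exp (- w * of_real t) * A (z + of_real t))
       + of_real \<gamma> * (of_real (pw \<gamma> t) * exp (- w * of_real t) * A (z + of_real t)))"
    by (auto simp: pw_def indicator_def algebra_simps)
  have dA: "(A has_field_derivative rderiv A (z + of_real t)) (at (z + of_real t))" if "t > 0" for t
    using z that by (intro has_field_derivative_rderiv A) auto
  have C: "C \<ge> 0" using bd[of 1] norm_ge_zero order_trans zero_less_one by blast
  have ne: "norm (?e t) \<le> C * exp (- Re w * t)" if "t > 0" for t
    using bd[OF that] by (simp add: norm_mult mult.commute mult_right_mono)
  have "(\<integral>t. indicator {0<..} t *\<^sub>R ?f t \<partial>lborel) = 0 - 0"
  proof (rule integral_FTC_half_line[where F = ?F])
    fix t :: real assume t: "t > 0"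
    have "((\<lambda>t. A (z + of_real t)) has_vector_derivative 1 * rderiv A (z + of_real t)) (at t)"
    proof (rule field_vector_diff_chain_at[unfolded comp_def, where g = A and f = "\<lambda>t. z + of_real t"])
      show "((\<lambda>t. z + of_real t) has_vector_derivative 1) (at t)"
        by (auto intro!: derivative_eq_intros)
    qed (use dA t in auto)
    moreover have "((\<lambda>t. exp (- w * of_real t)) has_vector_derivative (- w) * exp (- w * of_real t)) (at t)"
    proof (rule field_vector_diff_chain_at[unfolded comp_def, where g = exp and f = "\<lambda>t. - w * of_real t"])
      show "((\<lambda>t. - w * of_real t) has_vector_derivative - w) (at t)"
        by (auto intro!: derivative_eq_intros)
    qed (auto intro!: DERIV_exp)
    ultimately have e: "(?e has_vector_derivative exp (- w * of_real t) * (1 * rderiv A (z + of_real t))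
        + (- w) * exp (- w * of_real t) * A (z + of_real t)) (at t)"
      by (intro has_vector_derivative_mult)
    have "((\<lambda>t. t powr \<gamma>) has_real_derivative \<gamma> * t powr (\<gamma> - 1)) (at t)"
      using t by (auto intro!: derivative_eq_intros simp: powr_diff)
    then have p: "((\<lambda>t. complex_of_real (t powr \<gamma>)) has_vector_derivative of_real (\<gamma> * t powr (\<gamma> - 1))) (at t)"
      by (rule has_vector_derivative_of_real)
    show "(?F has_vector_derivative ?f t) (at t)"
      using has_vector_derivative_mult[OF p e] by (simp add: algebra_simps)
    have "isCont (\<lambda>t. A (z + of_real t)) t" "isCont (\<lambda>t. rderiv A (z + of_real t)) t"
      using DERIV_isCont[OF dA[of t]] isCont_rderiv[OF A(2), of "z + of_real t"] t z
      by (auto intro!: isCont_o2[where g = A] isCont_o2[where g = "rderiv A"] isCont_add isCont_of_real)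
    moreover have "isCont (\<lambda>t. complex_of_real (t powr \<gamma>)) t"
      "isCont (\<lambda>t. complex_of_real (\<gamma> * t powr (\<gamma> - 1))) t"
      using t by (auto intro!: isCont_of_real continuous_intros)
    moreover have "isCont (\<lambda>t::real. exp (- w * of_real t)) t"
      by (intro continuous_intros)
    ultimately show "isCont ?f t" by (intro isCont_add isCont_mult isCont_diff continuous_const)
  next
    show "integrable lborel (\<lambda>t. indicator {0<..} t *\<^sub>R ?f t)"
      unfolding eq by (intro Bochner_Integration.integrable_add Bochner_Integration.integrable_diff integrable_mult_right i1 i2 i3)
    have nF: "norm (?F t) \<le> C * (t powr \<gamma> * exp (- Re w * t))" if "t > 0" for t
    proof -
      have "norm (?F t) = t powr \<gamma> * norm (?e t)" by (simp only: norm_mult norm_of_real) simp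
      also have "\<dots> \<le> t powr \<gamma> * (C * exp (- Re w * t))" using ne[OF that] by (intro mult_left_mono) auto
      finally show ?thesis by (simp add: mult_ac)
    qed
    have "((\<lambda>t. C * (t powr \<gamma> * exp (- Re w * t))) \<longlongrightarrow> C * (0 * exp (- Re w * 0))) (at_right 0)"
    proof (intro tendsto_intros)
      show "((\<lambda>t::real. t powr \<gamma>) \<longlongrightarrow> 0) (at_right 0)" using g by real_asymp
    qed
    then have "((\<lambda>t. C * (t powr \<gamma> * exp (- Re w * t))) \<longlongrightarrow> 0) (at_right 0)" by simp
    then show "(?F \<longlongrightarrow> 0) (at_right 0)"
      by (rule Lim_null_comparison[rotated]) (use nF in \<open>auto simp: eventually_at_right_field intro!: exI[of _ 1]\<close>)
    have "((\<lambda>t. C * (t powr \<gamma> * exp (- Re w * t))) \<longlongrightarrow> C * 0) at_top"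
      by (intro tendsto_mult tendsto_const powr_exp_tendsto_0 w)
    then have "((\<lambda>t. C * (t powr \<gamma> * exp (- Re w * t))) \<longlongrightarrow> 0) at_top" by simp
    then show "(?F \<longlongrightarrow> 0) at_top"
    proof (rule Lim_null_comparison[rotated])
      show "eventually (\<lambda>t. norm (?F t) \<le> C * (t powr \<gamma> * exp (- Re w * t))) at_top"
        using eventually_gt_at_top[of 0] by eventually_elim (rule nF)
    qed
  qed
  then have "gop w (\<gamma> + 1) (rderiv A) z - w * gop w (\<gamma> + 1) A z + of_real \<gamma> * gop w \<gamma> A z = 0"
    unfolding eq gop_def using i1 i2 i3 by simp
  then show ?thesis by (simp add: algebra_simps)
qed

section \<open>Iterated gamma operators\<close>

fun gops :: "(complex \<times> real) list \<Rightarrow> (complex \<Rightarrow> complex) \<Rightarrow> complex \<Rightarrow> complex" where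
  "gops [] A = A"
| "gops ((w, \<gamma>) # L) A = gop w \<gamma> (gops L A)"

definition admissible :: "(complex \<times> real) list \<Rightarrow> bool" where
  "admissible L \<longleftrightarrow> (\<forall>(w, \<gamma>) \<in> set L. Re w > 0 \<and> \<gamma> > 0)"

lemma admissible_simps [simp]:
  "admissible []" "admissible ((w, \<gamma>) # L) \<longleftrightarrow> Re w > 0 \<and> \<gamma> > 0 \<and> admissible L"
  by (auto simp: admissible_def)

lemma rdecr_gops: "admissible L \<Longrightarrow> rdecr A \<Longrightarrow> rdecr (gops L A)"
  by (induction L A rule: gops.induct) (auto intro: rdecr_gop)

lemma gops_measurable: "A \<in> borel_measurable borel \<Longrightarrow> gops L A \<in> borel_measurable borel"
  by (induction L A rule: gops.induct) (auto intro: gop_measurable)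

text \<open>The product of the total masses of the kernels in absolute value, which bounds the
  iterated operator on bounded functions.\<close>

definition gops_const :: "(complex \<times> real) list \<Rightarrow> real" where
  "gops_const L = (\<Prod>(w, \<gamma>)\<leftarrow>L. Gamma \<gamma> * Re w powr (- \<gamma>))"

lemma gops_const_simps [simp]:
  "gops_const [] = 1" "gops_const ((w, \<gamma>) # L) = Gamma \<gamma> * Re w powr (- \<gamma>) * gops_const L"
  by (auto simp: gops_const_def)

lemma gops_norm_le:
  assumes "admissible L" "A \<in> borel_measurable borel" "\<And>t. t > 0 \<Longrightarrow> norm (A (z + of_real t)) \<le> C"
  shows "t > 0 \<Longrightarrow> norm (gops L A (z + of_real t)) \<le> C * gops_const L"
  using assms
proof (induction L A arbitrary: t rule: gops.induct)
  case (2 w \<gamma> L A)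
  have "norm (gop w \<gamma> (gops L A) (z + of_real t)) \<le> (C * gops_const L) * (Gamma \<gamma> * Re w powr (- \<gamma>))"
  proof (rule gop_norm_le[OF gops_measurable[OF 2(4)]])
    show "norm (gops L A (z + of_real t + of_real s)) \<le> C * gops_const L" if "s > 0" for s
      using 2(1)[of "t + s"] 2(2-) that by (simp add: add.assoc)
  qed (use 2 in auto)
  then show ?case by (simp add: mult_ac)
qed auto

section \<open>Bounds along rays and commutation with the Euler field\<close>

lemma gop_bounds_ray:
  assumes A: "rdecr A" and w: "Re w > 0" and g: "\<gamma> > 0" and z: "Re z \<ge> 0"
    and bd: "\<And>t. t > 0 \<Longrightarrow> norm (A (z + of_real t)) \<le> C"
    and bd': "\<And>t. t > 0 \<Longrightarrow> norm (rderiv A (z + of_real t)) \<le> C"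
    and t: "t > 0"
  shows "norm (gop w \<gamma> A (z + of_real t)) \<le> C * (Gamma \<gamma> * Re w powr (- \<gamma>))"
    and "norm (rderiv (gop w \<gamma> A) (z + of_real t)) \<le> C * (Gamma \<gamma> * Re w powr (- \<gamma>))"
proof -
  have *: "z + of_real t + of_real s = z + of_real (t + s)" for s by simp
  show "norm (gop w \<gamma> A (z + of_real t)) \<le> C * (Gamma \<gamma> * Re w powr (- \<gamma>))"
    by (rule gop_norm_le[OF rdecr_measurable[OF A] _ w g]) (use bd t in \<open>simp only: * add_pos_pos\<close>)
  have "rderiv (gop w \<gamma> A) (z + of_real t) = gop w \<gamma> (rderiv A) (z + of_real t)"
    using z t by (intro rderiv_gop A w g) auto
  then show "norm (rderiv (gop w \<gamma> A) (z + of_real t)) \<le> C * (Gamma \<gamma> * Re w powr (- \<gamma>))"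
    using gop_norm_le[OF rderiv_measurable[OF rdecr_holomorphic[OF A]] _ w g, of "z + of_real t" C] bd' t
    by (simp only: * add_pos_pos)
qed

text \<open>Under the integral the factor \<open>z + t\<close> splits. The part \<open>z\<close>
  gives the derivative of the image; the part \<open>t\<close> raises the shape by one, and
  integration by parts turns it into the difference between adding one more exponential variable and
  not adding it.\<close>

lemma gop_euler:
  assumes A: "rdecr A" and w: "Re w > 0" and g: "\<gamma> > 0" and z: "Re z > 0 \<or> z = 0"
    and bd: "\<And>t. t > 0 \<Longrightarrow> norm (A (z + of_real t)) \<le> C"
    and bd': "\<And>t. t > 0 \<Longrightarrow> norm (rderiv A (z + of_real t)) \<le> C"
  shows "gop w \<gamma> (\<lambda>z. z * rderiv A z) z =
     z * rderiv (gop w \<gamma> A) z + of_real \<gamma> * (w * gop w 1 (gop w \<gamma> A) z - gop w \<gamma> A z)"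
    and "integrable lborel (\<lambda>t. of_real (pw \<gamma> t) * exp (- w * of_real t) * ((z + of_real t) * rderiv A (z + of_real t)))"
proof -
  have z0: "Re z \<ge> 0" using z by auto
  have i1: "integrable lborel (\<lambda>t. of_real (pw \<gamma> t) * exp (- w * of_real t) * rderiv A (z + of_real t))"
    by (rule gop_integrable[OF rderiv_measurable[OF rdecr_holomorphic[OF A]] bd' w g])
  have i2: "integrable lborel (\<lambda>t. of_real (pw (\<gamma> + 1) t) * exp (- w * of_real t) * rderiv A (z + of_real t))"
    by (rule gop_integrable[OF rderiv_measurable[OF rdecr_holomorphic[OF A]] bd' w]) (use g in auto)
  have pw1: "pw \<gamma> t * t = pw (\<gamma> + 1) t" for t
    using powr_mult_base[of t "\<gamma> - 1"] by (auto simp: pw_def mult.commute)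
  have eq: "of_real (pw \<gamma> t) * exp (- w * of_real t) * ((z + of_real t) * rderiv A (z + of_real t)) =
     z * (of_real (pw \<gamma> t) * exp (- w * of_real t) * rderiv A (z + of_real t)) +
     of_real (pw (\<gamma> + 1) t) * exp (- w * of_real t) * rderiv A (z + of_real t)" for t
    unfolding pw1[symmetric] by (simp add: algebra_simps)
  show "integrable lborel (\<lambda>t. of_real (pw \<gamma> t) * exp (- w * of_real t) * ((z + of_real t) * rderiv A (z + of_real t)))"
    unfolding eq using i1 i2 by (intro Bochner_Integration.integrable_add integrable_mult_right)
  have "gop w \<gamma> (\<lambda>z. z * rderiv A z) z = z * gop w \<gamma> (rderiv A) z + gop w (\<gamma> + 1) (rderiv A) z"
    unfolding gop_def eq using i1 i2 by simp
  also have "gop w (\<gamma> + 1) (rderiv A) z = w * gop w (\<gamma> + 1) A z - of_real \<gamma> * gop w \<gamma> A z"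
    by (rule gop_by_parts[OF rdecr_measurable[OF A] rdecr_holomorphic[OF A] z0 bd bd' w g])
  also have "gop w (\<gamma> + 1) A z = of_real \<gamma> * gop w 1 (gop w \<gamma> A) z"
  proof -
    have "gop w 1 (gop w \<gamma> A) z = of_real (Beta 1 \<gamma>) * gop w (1 + \<gamma>) A z"
      by (rule gop_compose[OF rdecr_measurable[OF A] bd w _ g]) auto
    moreover have "Beta 1 \<gamma> = 1 / \<gamma>"
    proof -
      have "\<gamma> \<notin> \<int>\<^sub>\<le>\<^sub>0" using g by (auto elim!: nonpos_Ints_cases)
      from Gamma_plus1[OF this] show ?thesis
        using Gamma_real_pos[OF g, THEN less_imp_neq] g by (simp add: Beta_def add.commute)
    qed
    ultimately show ?thesis using g by (simp add: add.commute)
  qed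
  \<comment> \<open>At \<open>z = 0\<close> the prefactor hides the cut-off value of
    \<open>rderiv\<close>.\<close>
  also have "z * gop w \<gamma> (rderiv A) z = z * rderiv (gop w \<gamma> A) z"
    using z rderiv_gop[OF A w g, of z] by auto
  finally show "gop w \<gamma> (\<lambda>z. z * rderiv A z) z =
     z * rderiv (gop w \<gamma> A) z + of_real \<gamma> * (w * gop w 1 (gop w \<gamma> A) z - gop w \<gamma> A z)"
    by (simp add: algebra_simps)
qed

text \<open>
  The Euler field \<open>z d/dz\<close> generates dilations. This is the analytic form of the Stein identity
  \<open>E[X F'(X)] = \<Sum>\<gamma> E[F(X + Y) - F(X)]\<close>, \<open>Y\<close> exponential, for a sum \<open>X\<close> of gamma variables.
\<close>

definition gop_integr :: "complex \<Rightarrow> real \<Rightarrow> (complex \<Rightarrow> complex) \<Rightarrow> complex \<Rightarrow> bool" where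
  "gop_integr w \<gamma> A z \<longleftrightarrow>
     integrable lborel (\<lambda>t. of_real (pw \<gamma> t) * exp (- w * of_real t) * A (z + of_real t))"

lemma gop_linear:
  assumes "gop_integr w \<gamma> A z" "gop_integr w \<gamma> B z"
  shows "gop w \<gamma> (\<lambda>z. A z + c * B z) z = gop w \<gamma> A z + c * gop w \<gamma> B z"
    and "gop_integr w \<gamma> (\<lambda>z. A z + c * B z) z"
proof -
  have eq: "of_real (pw \<gamma> t) * exp (- w * of_real t) * (A (z + of_real t) + c * B (z + of_real t)) =
     of_real (pw \<gamma> t) * exp (- w * of_real t) * A (z + of_real t) +
     c * (of_real (pw \<gamma> t) * exp (- w * of_real t) * B (z + of_real t))" for t
    by (simp add: algebra_simps)
  show "gop w \<gamma> (\<lambda>z. A z + c * B z) z = gop w \<gamma> A z + c * gop w \<gamma> B z"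
    using assms unfolding gop_def eq gop_integr_def by simp
  show "gop_integr w \<gamma> (\<lambda>z. A z + c * B z) z"
    using assms unfolding eq gop_integr_def
    by (intro Bochner_Integration.integrable_add integrable_mult_right)
qed

text \<open>\<open>P\<close> is left general so that the induction can absorb the summands into it
  one at a time.\<close>

lemma gop_sum_list:
  assumes P: "gop_integr w \<gamma> P z" and H: "gop_integr w \<gamma> H z"
    and Q: "\<And>u \<beta>. (u, \<beta>) \<in> set M \<Longrightarrow> gop_integr w \<gamma> (Q u) z"
  shows "gop w \<gamma> (\<lambda>z. P z + (\<Sum>(u, \<beta>)\<leftarrow>M. of_real \<beta> * (u * Q u z - H z))) z =
      gop w \<gamma> P z + (\<Sum>(u, \<beta>)\<leftarrow>M. of_real \<beta> * (u * gop w \<gamma> (Q u) z - gop w \<gamma> H z))"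
  using P Q
proof (induction M arbitrary: P)
  case (Cons a M)
  obtain u \<beta> where a: "a = (u, \<beta>)" by (cases a)
  have eq: "P z + (\<Sum>(u, \<beta>)\<leftarrow>a # M. of_real \<beta> * (u * Q u z - H z)) =
     ((P z + (of_real \<beta> * u) * Q u z) + (- of_real \<beta>) * H z) + (\<Sum>(u, \<beta>)\<leftarrow>M. of_real \<beta> * (u * Q u z - H z))" for z
    by (simp add: a algebra_simps)
  have Qu: "gop_integr w \<gamma> (Q u) z" using Cons.prems a by auto
  note 1 = gop_linear[OF Cons.prems(1) Qu, of "of_real \<beta> * u"]
  note 2 = gop_linear[OF 1(2) H, of "- of_real \<beta>"]
  show ?case
    unfolding eq by (subst Cons.IH[OF 2(2)]) (use Cons.prems(2) 1(1) 2(1) a in \<open>auto simp: algebra_simps\<close>)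
qed simp

lemma gops_bounds:
  assumes "admissible L" and A: "rdecr A"
    and bd: "\<And>t::real. t > 0 \<Longrightarrow> norm (A (of_real t)) \<le> C"
    and bd': "\<And>t::real. t > 0 \<Longrightarrow> norm (rderiv A (of_real t)) \<le> C"
  shows "t > 0 \<Longrightarrow> norm (gops L A (of_real t)) \<le> C * gops_const L"
    and "t > 0 \<Longrightarrow> norm (rderiv (gops L A) (of_real t)) \<le> C * gops_const L"
proof -
  have "(\<forall>t>0. norm (gops L A (of_real t)) \<le> C * gops_const L) \<and>
        (\<forall>t>0. norm (rderiv (gops L A) (of_real t)) \<le> C * gops_const L)"
    using assms(1)
  proof (induction L)
    case (Cons a L)
    obtain w \<gamma> where a: "a = (w, \<gamma>)" by (cases a)
    then show ?case
      using gop_bounds_ray[OF rdecr_gops[OF _ A], of L w \<gamma> 0 "C * gops_const L"] Cons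
      by (auto simp: mult_ac)
  qed (use bd bd' in auto)
  then show "t > 0 \<Longrightarrow> norm (gops L A (of_real t)) \<le> C * gops_const L"
    and "t > 0 \<Longrightarrow> norm (rderiv (gops L A) (of_real t)) \<le> C * gops_const L" by auto
qed

text \<open>Each operator contributes its own commutator with the Euler field; those of the inner
  operators are carried outward by \<open>gop_commute\<close>, so that all of them act on the full
  iterate. The induction covers all \<open>x \<ge> 0\<close> because the outer integral evaluates
  the inner identity at \<open>x + t\<close>.\<close>

lemma gops_euler:
  assumes "admissible L" and A: "rdecr A"
    and bd: "\<And>t::real. t > 0 \<Longrightarrow> norm (A (of_real t)) \<le> C"
    and bd': "\<And>t::real. t > 0 \<Longrightarrow> norm (rderiv A (of_real t)) \<le> C"
    and x: "x \<ge> 0"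
  shows "gops L (\<lambda>z. z * rderiv A z) (of_real x) = of_real x * rderiv (gops L A) (of_real x) +
      (\<Sum>(w, \<gamma>)\<leftarrow>L. of_real \<gamma> * (w * gop w 1 (gops L A) (of_real x) - gops L A (of_real x)))"
  using assms(1) x
proof (induction L arbitrary: x)
  case (Cons a L)
  obtain w \<gamma> where a: "a = (w, \<gamma>)" by (cases a)
  have w: "Re w > 0" and g: "\<gamma> > 0" and L: "admissible L" using Cons.prems by (auto simp: a)
  define H where "H = gops L A"
  define D where "D = C * gops_const L"
  have rH: "rdecr H" unfolding H_def by (rule rdecr_gops[OF L A])
  have H: "norm (H (of_real x + of_real t)) \<le> D" and H': "norm (rderiv H (of_real x + of_real t)) \<le> D"
    if "t > 0" for t
    using gops_bounds[OF L A bd bd', of "x + t"] that Cons.prems by (simp_all add: H_def D_def)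
  have xz: "Re (of_real x :: complex) > 0 \<or> (of_real x :: complex) = 0" using Cons.prems by auto
  note eul = gop_euler[OF rH w g xz H H']
  have iH: "gop_integr w \<gamma> H (of_real x)"
    unfolding gop_integr_def by (rule gop_integrable[OF rdecr_measurable[OF rH] H w g])
  have uQ: "Re u > 0" if "(u, \<beta>) \<in> set L" for u \<beta> using L that by (auto simp: admissible_def)
  have iQ: "gop_integr w \<gamma> (gop u 1 H) (of_real x)" if "(u, \<beta>) \<in> set L" for u \<beta>
    unfolding gop_integr_def
  proof (rule gop_integrable[OF gop_measurable[OF rdecr_measurable[OF rH]] _ w g])
    show "norm (gop u 1 H (of_real x + of_real t)) \<le> D * (Gamma 1 * Re u powr (- 1))" if "t > 0" for t
      by (rule gop_bounds_ray(1)[OF rH uQ[OF \<open>(u, \<beta>) \<in> set L\<close>] _ _ H H' that]) (use Cons.prems in auto)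
  qed
  have "gops (a # L) (\<lambda>z. z * rderiv A z) (of_real x) = gop w \<gamma> (gops L (\<lambda>z. z * rderiv A z)) (of_real x)"
    by (simp add: a)
  also have "\<dots> = gop w \<gamma> (\<lambda>z. z * rderiv H z + (\<Sum>(u, \<beta>)\<leftarrow>L. of_real \<beta> * (u * gop u 1 H z - H z))) (of_real x)"
  proof (rule gop_cong)
    fix t :: real assume "t > 0"
    then show "gops L (\<lambda>z. z * rderiv A z) (of_real x + of_real t) = (of_real x + of_real t) * rderiv H (of_real x + of_real t) +
       (\<Sum>(u, \<beta>)\<leftarrow>L. of_real \<beta> * (u * gop u 1 H (of_real x + of_real t) - H (of_real x + of_real t)))"
      using Cons.IH[OF L, of "x + t"] Cons.prems by (simp add: H_def)
  qed
  also have "\<dots> = gop w \<gamma> (\<lambda>z. z * rderiv H z) (of_real x) +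
      (\<Sum>(u, \<beta>)\<leftarrow>L. of_real \<beta> * (u * gop w \<gamma> (gop u 1 H) (of_real x) - gop w \<gamma> H (of_real x)))"
    by (rule gop_sum_list[OF _ iH iQ]) (use eul(2) in \<open>simp_all add: gop_integr_def\<close>)
  also have "(\<Sum>(u, \<beta>)\<leftarrow>L. of_real \<beta> * (u * gop w \<gamma> (gop u 1 H) (of_real x) - gop w \<gamma> H (of_real x))) =
      (\<Sum>(u, \<beta>)\<leftarrow>L. of_real \<beta> * (u * gop u 1 (gop w \<gamma> H) (of_real x) - gop w \<gamma> H (of_real x)))"
  proof (intro arg_cong[where f = sum_list] map_cong refl, clarify)
    fix u \<beta> assume "(u, \<beta>) \<in> set L"
    from gop_commute[OF rdecr_measurable[OF rH] H w uQ[OF this] g, of 1]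
    show "of_real \<beta> * (u * gop w \<gamma> (gop u 1 H) (of_real x) - gop w \<gamma> H (of_real x)) =
      of_real \<beta> * (u * gop u 1 (gop w \<gamma> H) (of_real x) - gop w \<gamma> H (of_real x))" by simp
  qed
  also note eul(1)
  finally show ?case by (simp add: a H_def)
qed simp

section \<open>Exponentials of powers\<close>

definition expo :: "real \<Rightarrow> complex \<Rightarrow> complex \<Rightarrow> complex" where
  "expo q c z = (if Re z > 0 then exp (- c * z powr (of_real q)) else 0)"

lemma powr_polar:
  assumes "z \<noteq> 0"
  shows "z powr (of_real a) = of_real (norm z powr a) * cis (a * Arg z)"
proof -
  have "z powr (of_real a) = exp (of_real a * (of_real (ln (norm z)) + \<i> * of_real (Arg z)))"
    using assms by (simp add: powr_def Ln_Arg)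
  also have "\<dots> = exp (of_real (a * ln (norm z))) * exp (\<i> * of_real (a * Arg z))"
    by (simp add: algebra_simps flip: exp_add)
  also have "exp (complex_of_real (a * ln (norm z))) = of_real (norm z powr a)"
    using assms by (simp only: exp_of_real powr_def) simp
  finally show ?thesis by (simp only: cis_conv_exp)
qed

text \<open>The argument of the product is at most \<open>(a + b) * pi / 2\<close> in absolute
  value. The case of interest is \<open>a = 2 - q\<close> and \<open>b = q - 1\<close>, whose sum is
  exactly 1.\<close>

lemma Re_powr_mult_powr:
  assumes "Re x > 0" "Re y > 0" "a \<ge> 0" "b \<ge> 0" "a + b \<le> 1"
  shows "Re (x powr (of_real a) * y powr (of_real b)) \<ge> 0"
proof -
  have nz: "x \<noteq> 0" "y \<noteq> 0" using assms by auto
  have "\<bar>a * Arg x + b * Arg y\<bar> \<le> a * \<bar>Arg x\<bar> + b * \<bar>Arg y\<bar>"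
    using abs_triangle_ineq[of "a * Arg x" "b * Arg y"] assms by (simp add: abs_mult)
  also have "\<dots> \<le> a * (pi / 2) + b * (pi / 2)"
    using Arg_bound[of x] Arg_bound[of y] assms by (intro add_mono mult_left_mono) auto
  also have "\<dots> = (a + b) * (pi / 2)" by (simp add: algebra_simps)
  also have "\<dots> \<le> pi / 2" using assms by (simp add: mult_left_le_one_le)
  finally have "- (pi / 2) \<le> a * Arg x + b * Arg y" "a * Arg x + b * Arg y \<le> pi / 2" by linarith+
  then have "cos (a * Arg x + b * Arg y) \<ge> 0" by (rule cos_ge_zero)
  moreover have "x powr (of_real a) * y powr (of_real b) =
      of_real (norm x powr a * norm y powr b) * cis (a * Arg x + b * Arg y)"
    using nz by (simp add: powr_polar cis_mult[symmetric])
  ultimately show ?thesis by simp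
qed

lemma Re_powr_pos:
  assumes "Re x > 0" "0 \<le> a" "a \<le> 1"
  shows "Re (x powr (of_real a)) > 0"
proof -
  have nz: "x \<noteq> 0" using assms by auto
  have "\<bar>a * Arg x\<bar> \<le> \<bar>Arg x\<bar>" using assms by (simp add: abs_mult mult_left_le_one_le)
  also have "\<dots> < pi / 2" by (rule Arg_bound[OF assms(1)])
  finally have "cos (a * Arg x) > 0" by (intro cos_gt_zero_pi) (auto simp: abs_less_iff)
  then show ?thesis using nz by (simp add: powr_polar)
qed

lemma expo_has_field_derivative:
  assumes z: "Re z > 0"
  shows "(expo q c has_field_derivative - c * of_real q * z powr (of_real (q - 1)) * expo q c z) (at z)"
proof -
  have "((\<lambda>z. exp (- c * z powr (of_real q))) has_field_derivative
      - c * of_real q * z powr (of_real (q - 1)) * exp (- c * z powr (of_real q))) (at z)"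
    using z rhp_not_nonpos[OF z] by (auto intro!: derivative_eq_intros)
  moreover have "eventually (\<lambda>y. expo q c y = exp (- c * y powr (of_real q))) (nhds z)"
    using eventually_nhds_in_open[OF open_rhp, of z] z by (auto elim!: eventually_mono simp: expo_def)
  ultimately show ?thesis using z by (subst DERIV_cong_ev[OF refl _ refl]) (auto simp: expo_def)
qed

lemma expo_holomorphic: "expo q c holomorphic_on {z. Re z > 0}"
  using expo_has_field_derivative open_rhp by (auto simp: holomorphic_on_open)

lemma expo_measurable: "expo q c \<in> borel_measurable borel"
  unfolding expo_def[abs_def]
  by (intro borel_measurable_continuous_on_rhp holomorphic_on_imp_continuous_on holomorphic_intros)
     (auto dest: rhp_not_nonpos)

lemma rderiv_expo:
  "Re z > 0 \<Longrightarrow> rderiv (expo q c) z = - c * of_real q * z powr (of_real (q - 1)) * expo q c z"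
  by (intro rderiv_eqI expo_has_field_derivative)

text \<open>The logarithmic derivative is \<open>- c * q * z powr (q - 1)\<close>, and monotonicity
  in modulus is the sign of its real part.\<close>

lemma rdecr_expo:
  assumes q: "q > 0" and pos: "\<And>z. Re z > 0 \<Longrightarrow> Re (c * z powr (of_real (q - 1))) \<ge> 0"
  shows "rdecr (expo q c)"
proof (rule rdecrI[OF expo_measurable expo_holomorphic])
  fix z :: complex assume z: "Re z > 0"
  have "rderiv (expo q c) z * cnj (expo q c z) =
      - of_real q * (c * z powr (of_real (q - 1))) * (expo q c z * cnj (expo q c z))"
    by (simp add: rderiv_expo[OF z])
  also have "\<dots> = of_real (- q * (norm (expo q c z))\<^sup>2) * (c * z powr (of_real (q - 1)))"
    unfolding complex_norm_square[symmetric] by simp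
  finally have "Re (rderiv (expo q c) z * cnj (expo q c z)) = (- q * (norm (expo q c z))\<^sup>2) * Re (c * z powr (of_real (q - 1)))"
    by simp
  also have "\<dots> \<le> 0" by (rule mult_nonpos_nonneg) (use q pos[OF z] in auto)
  finally show "Re (rderiv (expo q c) z * cnj (expo q c z)) \<le> 0" .
qed

lemma expo_of_real: "t > 0 \<Longrightarrow> expo q c (of_real t) = exp (- c * of_real (t powr q))"
  by (simp add: expo_def powr_of_real)

lemma norm_expo_of_real: "t > 0 \<Longrightarrow> norm (expo q c (of_real t)) = exp (- Re c * t powr q)"
  by (simp add: expo_of_real)

lemma norm_expo_le_1: "Re c \<ge> 0 \<Longrightarrow> t > 0 \<Longrightarrow> norm (expo q c (of_real t)) \<le> 1"
  by (simp add: norm_expo_of_real)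

lemma expo_bounds:
  assumes c: "Re c > 0" and q: "q > 1"
  obtains C where "\<And>t::real. t > 0 \<Longrightarrow> norm (expo q c (of_real t)) \<le> C"
    and "\<And>t::real. t > 0 \<Longrightarrow> norm (rderiv (expo q c) (of_real t)) \<le> C"
proof
  define C where "C = 1 + norm c * q * (1 + 1 / Re c)"
  fix t :: real assume t: "t > 0"
  have "norm (expo q c (of_real t)) \<le> 1" by (rule norm_expo_le_1) (use c t in auto)
  also have "\<dots> \<le> C" using c q by (simp add: C_def)
  finally show "norm (expo q c (of_real t)) \<le> C" .
  \<comment> \<open>This trades the power in the derivative for \<open>t powr q\<close>, which the
    exponential controls.\<close>
  have "t powr (q - 1) \<le> 1 + t powr q"
  proof (cases "t \<le> 1")
    case True
    then have "t powr (q - 1) \<le> 1 powr (q - 1)" using t q by (intro powr_mono2) auto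
    then show ?thesis by simp (smt (verit) powr_ge_zero)
  next
    case False
    then have "t powr (q - 1) \<le> t powr q" by (intro powr_mono) auto
    then show ?thesis by simp
  qed
  then have "t powr (q - 1) * exp (- Re c * t powr q) \<le> (1 + t powr q) * exp (- Re c * t powr q)"
    by (intro mult_right_mono) auto
  also have "\<dots> \<le> 1 + 1 / Re c"
  proof -
    have "Re c * t powr q \<le> exp (Re c * t powr q)"
      using exp_ge_add_one_self[of "Re c * t powr q"] by linarith
    then have "t powr q * exp (- Re c * t powr q) \<le> 1 / Re c"
      using c by (simp add: exp_minus field_simps)
    moreover have "exp (- Re c * t powr q) \<le> 1" using c by simp
    moreover have "(1 + t powr q) * exp (- Re c * t powr q) =
        exp (- Re c * t powr q) + t powr q * exp (- Re c * t powr q)" by (simp add: algebra_simps)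
    ultimately show ?thesis by linarith
  qed
  finally have 1: "t powr (q - 1) * exp (- Re c * t powr q) \<le> 1 + 1 / Re c" .
  have "norm (rderiv (expo q c) (of_real t)) = norm c * q * (t powr (q - 1) * exp (- Re c * t powr q))"
    using t q by (subst rderiv_expo) (auto simp: norm_mult norm_expo_of_real norm_powr_real_powr')
  also have "\<dots> \<le> norm c * q * (1 + 1 / Re c)" using 1 q by (intro mult_left_mono) auto
  also have "\<dots> \<le> C" by (simp add: C_def)
  finally show "norm (rderiv (expo q c) (of_real t)) \<le> C" .
qed

section \<open>The transform along the half angle\<close>

text \<open>
  With \<open>\<zeta> = sqrt s\<close>, the substitution \<open>x = u / \<zeta>\<close> turns \<open>exp (- s x\<^sup>q)\<close> into
  \<open>exp (- \<zeta>\<^sup>2\<^sup>-\<^sup>q u\<^sup>q)\<close> and the rates \<open>b\<close> into \<open>b / \<zeta>\<close>, so that everything converges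
  for all \<open>s\<close> in the plane cut along the negative axis.
\<close>

definition shape_sum :: "(real \<times> real) list \<Rightarrow> real" where
  "shape_sum L = (\<Sum>(b, \<beta>)\<leftarrow>L. \<beta>)"

definition rate_const :: "(real \<times> real) list \<Rightarrow> real" where
  "rate_const L = (\<Prod>(b, \<beta>)\<leftarrow>L. b powr \<beta> / Gamma \<beta>)"

definition positive_pairs :: "(real \<times> real) list \<Rightarrow> bool" where
  "positive_pairs L \<longleftrightarrow> (\<forall>(b, \<beta>) \<in> set L. b > 0 \<and> \<beta> > 0)"

definition scale_pairs :: "complex \<Rightarrow> (real \<times> real) list \<Rightarrow> (complex \<times> real) list" where
  "scale_pairs \<zeta> L = map (\<lambda>(b, \<beta>). (of_real b / \<zeta>, \<beta>)) L"

lemma pairs_simps [simp]: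
  "shape_sum [] = 0" "shape_sum ((b, \<beta>) # L) = \<beta> + shape_sum L"
  "rate_const [] = 1" "rate_const ((b, \<beta>) # L) = b powr \<beta> / Gamma \<beta> * rate_const L"
  "positive_pairs []" "positive_pairs ((b, \<beta>) # L) \<longleftrightarrow> b > 0 \<and> \<beta> > 0 \<and> positive_pairs L"
  "scale_pairs \<zeta> [] = []" "scale_pairs \<zeta> ((b, \<beta>) # L) = (of_real b / \<zeta>, \<beta>) # scale_pairs \<zeta> L"
  by (auto simp: shape_sum_def rate_const_def positive_pairs_def scale_pairs_def)

lemma Re_of_real_divide: "Re (of_real b / \<zeta>) = b * Re (1 / \<zeta>)"
  by (simp add: Re_divide)

lemma Re_inverse_pos: "Re \<zeta> > 0 \<Longrightarrow> Re (1 / \<zeta>) > 0"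
  by (simp add: Re_divide add_pos_nonneg)

lemma admissible_scale_pairs:
  assumes "positive_pairs L" "Re \<zeta> > 0"
  shows "admissible (scale_pairs \<zeta> L)"
  using assms(1)
proof (induction L)
  case (Cons a L)
  then show ?case using Re_inverse_pos[OF assms(2)] by (cases a) (auto simp: Re_of_real_divide)
qed simp

text \<open>The base point \<open>x\<close> is a parameter so that pairs can be peeled off the list
  by induction; expectations correspond to \<open>x = 0\<close>.\<close>

definition pre_psi :: "real \<Rightarrow> (real \<times> real) list \<Rightarrow> complex \<Rightarrow> real \<Rightarrow> complex" where
  "pre_psi q L \<zeta> x = gops (scale_pairs \<zeta> L) (expo q (\<zeta> powr (of_real (2 - q)))) (of_real x)"

text \<open>Through the substitution, each integration with rate \<open>b / \<zeta>\<close>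
  contributes a factor \<open>\<zeta> powr \<beta>\<close>. The negative power of
  \<open>\<zeta>\<close> undoes this, so that on the positive axis the Laplace transform at
  \<open>\<zeta>^2\<close> comes out.\<close>

definition Psi :: "real \<Rightarrow> (real \<times> real) list \<Rightarrow> complex \<Rightarrow> complex" where
  "Psi q L \<zeta> = of_real (rate_const L) * \<zeta> powr (- of_real (shape_sum L)) * pre_psi q L \<zeta> 0"

lemma pre_psi_Cons:
  "pre_psi q ((b, \<beta>) # L) \<zeta> x =
    (\<integral>t. of_real (pw \<beta> t) * exp (- (of_real b / \<zeta>) * of_real t) * pre_psi q L \<zeta> (x + t) \<partial>lborel)"
  by (simp add: pre_psi_def gop_def)

lemma gops_const_scale_mono:
  assumes "positive_pairs L" "e > 0" "Re (1 / y) \<ge> e"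
  shows "0 \<le> gops_const (scale_pairs y L)"
    and "gops_const (scale_pairs y L) \<le> (\<Prod>(b, \<beta>)\<leftarrow>L. Gamma \<beta> * (b * e) powr (- \<beta>))"
proof -
  have "0 \<le> gops_const (scale_pairs y L) \<and>
    gops_const (scale_pairs y L) \<le> (\<Prod>(b, \<beta>)\<leftarrow>L. Gamma \<beta> * (b * e) powr (- \<beta>))"
    using assms(1)
  proof (induction L)
    case (Cons a L)
    obtain b \<beta> where a: "a = (b, \<beta>)" by (cases a)
    have b: "b > 0" "\<beta> > 0" using Cons.prems by (auto simp: a)
    have G: "Gamma \<beta> > 0" using b by (simp add: Gamma_real_pos)
    have "(Re (of_real b / y)) powr (- \<beta>) \<le> (b * e) powr (- \<beta>)"
      using assms b by (intro powr_mono2') (auto simp: Re_of_real_divide)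
    then show ?case using Cons G by (auto simp: a intro!: mult_mono mult_nonneg_nonneg)
  qed simp
  then show "0 \<le> gops_const (scale_pairs y L)"
    and "gops_const (scale_pairs y L) \<le> (\<Prod>(b, \<beta>)\<leftarrow>L. Gamma \<beta> * (b * e) powr (- \<beta>))" by auto
qed

lemma pre_psi_norm_le:
  assumes q: "1 < q" "q < 2" and L: "positive_pairs L" and z: "Re \<zeta> > 0" and t: "t > 0"
  shows "norm (pre_psi q L \<zeta> t) \<le> gops_const (scale_pairs \<zeta> L)"
proof -
  have "norm (gops (scale_pairs \<zeta> L) (expo q (\<zeta> powr (of_real (2 - q)))) (0 + of_real t)) \<le> 1 * gops_const (scale_pairs \<zeta> L)"
  proof (rule gops_norm_le[OF admissible_scale_pairs[OF L z] expo_measurable _ t])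
    show "norm (expo q (\<zeta> powr (of_real (2 - q))) (0 + of_real t)) \<le> 1" if "t > 0" for t
      using norm_expo_le_1[of "\<zeta> powr (of_real (2 - q))" t q] Re_powr_pos[OF z, of "2 - q"] q that by simp
  qed
  then show ?thesis by (simp add: pre_psi_def)
qed

text \<open>It gives a common exponential decay to the kernels of rate \<open>b / y\<close> for all
  \<open>y\<close> near \<open>z\<close>, hence a dominating function. The constant is a lower bound
  of \<open>Re y / |y|^2\<close> on the disc of radius \<open>Re z / 2\<close>.\<close>

lemma local_Re_inverse_bound:
  assumes z: "Re z > 0"
  obtains r e where "r > 0" "e > 0" "ball z r \<subseteq> {z. Re z > 0}" "\<And>y. y \<in> ball z r \<Longrightarrow> Re (1 / y) \<ge> e"
proof
  let ?e = "(Re z / 2) / (norm z + Re z / 2)\<^sup>2"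
  show "Re z / 2 > 0" using z by simp
  have nz: "norm z + Re z / 2 > 0" using z by (simp add: add_nonneg_pos)
  show "?e > 0" using z nz by (intro divide_pos_pos zero_less_power) auto
  show "ball z (Re z / 2) \<subseteq> {z. Re z > 0}" using rhp_ball[OF z] z by force
  fix y assume y: "y \<in> ball z (Re z / 2)"
  have Rey: "Re y > Re z / 2" by (rule rhp_ball[OF z y])
  have "norm y \<le> norm z + Re z / 2"
    using y norm_triangle_ineq4[of z "z - y"] by (simp add: dist_norm)
  then have "(norm y)\<^sup>2 \<le> (norm z + Re z / 2)\<^sup>2" by (intro power_mono) auto
  moreover have "(norm y)\<^sup>2 > 0" using Rey z by auto
  moreover have "Re (1 / y) = Re y / (norm y)\<^sup>2" by (simp add: Re_divide cmod_power2)
  ultimately show "Re (1 / y) \<ge> ?e" using Rey z by (simp only:) (intro frac_le, auto)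
qed

text \<open>The induction treats all base points at once, because the outer integral evaluates the
  inner function at \<open>x + t\<close>.\<close>

lemma pre_psi_holomorphic:
  assumes q: "1 < q" "q < 2" and L: "positive_pairs L" and x: "x > 0 \<or> (x = 0 \<and> L \<noteq> [])"
  shows "(\<lambda>\<zeta>. pre_psi q L \<zeta> x) holomorphic_on {z. Re z > 0}"
  using L x
proof (induction L arbitrary: x)
  case Nil
  then have "(\<lambda>\<zeta>. exp (- (\<zeta> powr (of_real (2 - q))) * of_real (x powr q))) holomorphic_on {z. Re z > 0}"
    by (intro holomorphic_intros) (auto dest: rhp_not_nonpos)
  then show ?case using Nil by (simp add: pre_psi_def expo_of_real)
next
  case (Cons a L)
  obtain b \<beta> where a: "a = (b, \<beta>)" by (cases a)
  have b: "b > 0" "\<beta> > 0" and L: "positive_pairs L" using Cons.prems by (auto simp: a)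
  have x: "x \<ge> 0" using Cons.prems by auto
  have IH: "(\<lambda>\<zeta>. pre_psi q L \<zeta> (x + t)) holomorphic_on {z. Re z > 0}" if "t > 0" for t
    using Cons.IH[OF L, of "x + t"] that x by simp
  let ?f = "\<lambda>\<zeta> t. complex_of_real (pw \<beta> t) * exp (- (of_real b / \<zeta>) * of_real t) * pre_psi q L \<zeta> (x + t)"
  show ?case unfolding a pre_psi_Cons
  proof (rule holomorphic_lebesgue_integral[OF open_rhp])
    show "(\<lambda>\<zeta>. ?f \<zeta> t) holomorphic_on {z. Re z > 0}" for t
    proof (cases "t > 0")
      case True
      then show ?thesis by (intro holomorphic_intros IH) auto
    qed auto
    show "?f \<zeta> \<in> borel_measurable lborel" for \<zeta>
      using gop_integrand_measurable[OF gops_measurable[OF expo_measurable], of \<beta> "of_real b / \<zeta>" "scale_pairs \<zeta> L" q "\<zeta> powr (of_real (2 - q))" "of_real x"]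
      by (simp add: pre_psi_def)
    fix z :: complex assume "z \<in> {z. Re z > 0}"
    then have z: "Re z > 0" by simp
    obtain r e where r: "r > 0" and e: "e > 0" and sub: "ball z r \<subseteq> {z. Re z > 0}"
      and ge: "\<And>y. y \<in> ball z r \<Longrightarrow> Re (1 / y) \<ge> e"
      using local_Re_inverse_bound[OF z] by metis
    define K where "K = (\<Prod>(b, \<beta>)\<leftarrow>L. Gamma \<beta> * (b * e) powr (- \<beta>))"
    show "\<exists>r>0. \<exists>g. ball z r \<subseteq> {z. Re z > 0} \<and> integrable lborel g \<and>
      (\<forall>y\<in>ball z r. \<forall>t\<in>space lborel. norm (?f y t) \<le> g t)"
    proof (intro exI[of _ r] exI[of _ "\<lambda>t. K * (pw \<beta> t * exp (- (b * e) * t))"] conjI ballI r sub)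
      show "integrable lborel (\<lambda>t. K * (pw \<beta> t * exp (- (b * e) * t)))"
        using b e by (intro integrable_mult_right integrable_pw_exp) auto
    next
      fix y t assume y: "y \<in> ball z r"
      have yp: "Re y > 0" using sub y by auto
      show "norm (?f y t) \<le> K * (pw \<beta> t * exp (- (b * e) * t))"
      proof (cases "t > 0")
        case True
        have "norm (pre_psi q L y (x + t)) \<le> gops_const (scale_pairs y L)"
          using pre_psi_norm_le[OF q L yp] True x by simp
        also have "\<dots> \<le> K" unfolding K_def by (rule gops_const_scale_mono[OF L e ge[OF y]])
        finally have 1: "norm (pre_psi q L y (x + t)) \<le> K" .
        have "b * e * t \<le> Re (of_real b / y) * t"
          using b True ge[OF y] by (simp only: Re_of_real_divide) simp
        moreover have "norm (exp (- u * of_real t)) = exp (- (Re u * t))" for u by simp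
        ultimately have 2: "norm (exp (- (of_real b / y) * of_real t)) \<le> exp (- (b * e) * t)" by (simp only:) simp
        have "norm (?f y t) \<le> (pw \<beta> t * exp (- (b * e) * t)) * K"
          unfolding norm_mult by (intro mult_mono 1 2) auto
        then show ?thesis by (simp add: mult.commute)
      qed simp
    qed
  qed
qed

lemma Psi_holomorphic:
  assumes "1 < q" "q < 2" "positive_pairs L" "L \<noteq> []"
  shows "Psi q L holomorphic_on {z. Re z > 0}"
  unfolding Psi_def[abs_def] using assms
  by (intro holomorphic_intros pre_psi_holomorphic) (auto dest: rhp_not_nonpos)

section \<open>The Laplace transform in \<open>s\<close> and its Stein identity\<close>

lemma gops_cmult: "gops L (\<lambda>z. c * B z) = (\<lambda>z. c * gops L B z)"
proof (induction L)
  case (Cons a L)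
  obtain w \<gamma> where a: "a = (w, \<gamma>)" by (cases a)
  have "gop w \<gamma> (\<lambda>z. c * gops L B z) z = c * gop w \<gamma> (gops L B) z" for z
    unfolding gop_def mult.left_commute[of _ c] by (rule integral_mult_right_zero)
  then show ?case using Cons by (simp add: a)
qed simp

lemma gops_cong_rhp:
  assumes "\<And>z. Re z > 0 \<Longrightarrow> A z = B z"
  shows "Re z > 0 \<or> (Re z \<ge> 0 \<and> L \<noteq> []) \<Longrightarrow> gops L A z = gops L B z"
proof (induction L arbitrary: z)
  case (Cons a L)
  obtain w \<gamma> where a: "a = (w, \<gamma>)" by (cases a)
  have "gops L A (z + of_real t) = gops L B (z + of_real t)" if "t > 0" for t
    using Cons.prems that by (intro Cons.IH) auto
  then have "gop w \<gamma> (gops L A) z = gop w \<gamma> (gops L B) z" by (rule gop_cong)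
  then show ?case by (simp only: a gops.simps)
next
  case Nil
  then show ?case using assms by simp
qed

text \<open>For a gamma sum \<open>X\<close> this is the Laplace transform of
  \<open>X powr q\<close> at \<open>s\<close>, see \<open>psi_eq_integral\<close>. The rates are
  real and nothing is rescaled.\<close>

definition psi :: "real \<Rightarrow> (real \<times> real) list \<Rightarrow> complex \<Rightarrow> complex" where
  "psi q L s = of_real (rate_const L) * gops (scale_pairs 1 L) (expo q s) 0"

text \<open>A real dilation by \<open>r\<close> in every integral; in the exponent
  \<open>r powr (2 - q)\<close> and \<open>r powr q\<close> combine to \<open>r^2\<close>.\<close>

lemma pre_psi_scale:
  assumes r: "r > 0" and L: "positive_pairs L" and x: "x \<ge> 0"
  shows "pre_psi q L (of_real r) (r * x) =
     of_real (r powr shape_sum L) * gops (scale_pairs 1 L) (expo q (of_real (r\<^sup>2))) (of_real x)"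
  using L x
proof (induction L arbitrary: x)
  case Nil
  show ?case
  proof (cases "x > 0")
    case True
    have "r powr (2 - q) * (r * x) powr q = r\<^sup>2 * x powr q"
    proof -
      have "r powr (2 - q) * r powr q = r\<^sup>2" using r by (simp flip: powr_add powr_numeral)
      then show ?thesis using r True by (simp add: powr_mult)
    qed
    then have "complex_of_real (r powr (2 - q)) * of_real ((r * x) powr q) = of_real (r\<^sup>2) * of_real (x powr q)"
      by (metis of_real_mult)
    moreover have "complex_of_real r powr (of_real (2 - q)) = of_real (r powr (2 - q))"
      using r powr_of_real[of r "2 - q"] by simp
    ultimately show ?thesis using True r by (simp only: pre_psi_def pairs_simps gops.simps expo_of_real mult_pos_pos) (simp add: powr_zero_eq_one)
  \<comment> \<open>At \<open>x = 0\<close> both sides are the cut-off value 0 of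
    \<open>expo\<close>.\<close>
  qed (use Nil in \<open>simp add: pre_psi_def expo_def\<close>)
next
  case (Cons a L)
  obtain b \<beta> where a: "a = (b, \<beta>)" by (cases a)
  have b: "b > 0" "\<beta> > 0" and L: "positive_pairs L" using Cons.prems by (auto simp: a)
  let ?H = "gops (scale_pairs 1 L) (expo q (of_real (r\<^sup>2)))"
  have "pre_psi q (a # L) (of_real r) (r * x) =
      r *\<^sub>R (\<integral>u. of_real (pw \<beta> (0 + r * u)) * exp (- (of_real b / of_real r) * of_real (0 + r * u)) * pre_psi q L (of_real r) (r * x + (0 + r * u)) \<partial>lborel)"
    unfolding a pre_psi_Cons using r by (subst lborel_integral_real_affine[where c = r and t = 0]) auto
  also have "\<dots> = r *\<^sub>R (\<integral>u. of_real (r powr (\<beta> - 1) * r powr shape_sum L) *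
       (of_real (pw \<beta> u) * exp (- (of_real b / 1) * of_real u) * ?H (of_real x + of_real u)) \<partial>lborel)"
  proof (intro arg_cong[where f = "\<lambda>x. r *\<^sub>R x"] Bochner_Integration.integral_cong refl)
    fix u
    show "of_real (pw \<beta> (0 + r * u)) * exp (- (of_real b / of_real r) * of_real (0 + r * u)) * pre_psi q L (of_real r) (r * x + (0 + r * u)) =
      of_real (r powr (\<beta> - 1) * r powr shape_sum L) * (of_real (pw \<beta> u) * exp (- (of_real b / 1) * of_real u) * ?H (of_real x + of_real u))"
    proof (cases "u > 0")
      case True
      have "pw \<beta> (r * u) = r powr (\<beta> - 1) * pw \<beta> u" using True r by (simp add: pw_def powr_mult)
      moreover have "pre_psi q L (of_real r) (r * (x + u)) = of_real (r powr shape_sum L) * ?H (of_real (x + u))"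
        using Cons.IH[OF L, of "x + u"] True Cons.prems by simp
      moreover have "r * x + (0 + r * u) = r * (x + u)" by (simp add: algebra_simps)
      moreover have "- (complex_of_real b / of_real r) * of_real (0 + r * u) = - (of_real b / 1) * of_real u"
        using r by simp
      ultimately show ?thesis by (simp only: of_real_mult) (simp add: mult_ac)
    next
      case False
      then have "r * u \<le> 0" using r by (simp add: mult_le_0_iff)
      then show ?thesis using False by simp
    qed
  qed
  also have "\<dots> = of_real (r * (r powr (\<beta> - 1) * r powr shape_sum L)) *
      (\<integral>u. of_real (pw \<beta> u) * exp (- (of_real b / 1) * of_real u) * ?H (of_real x + of_real u) \<partial>lborel)"
    unfolding integral_mult_right_zero by (simp add: scaleR_conv_of_real mult.assoc)
  also have "r * (r powr (\<beta> - 1) * r powr shape_sum L) = r powr shape_sum (a # L)"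
    using r powr_mult_base[of r "\<beta> - 1"] by (simp add: a powr_add mult.assoc[symmetric])
  finally show ?case by (simp add: a gop_def)
qed

lemma Psi_of_real:
  assumes r: "r > 0" and L: "positive_pairs L"
  shows "Psi q L (of_real r) = psi q L (of_real (r\<^sup>2))"
proof -
  have "complex_of_real r powr (- of_real (shape_sum L)) = of_real (r powr (- shape_sum L))"
    using r powr_of_real[of r "- shape_sum L"] by simp
  moreover have "r powr (- shape_sum L) * r powr shape_sum L = 1"
    using r by (simp flip: powr_add)
  then have "complex_of_real (r powr (- shape_sum L)) * of_real (r powr shape_sum L) = 1"
    by (metis of_real_1 of_real_mult)
  ultimately show ?thesis
    using pre_psi_scale[OF r L, of 0 q] by (simp add: Psi_def psi_def del: of_real_power)
qed

text \<open>On the positive ray \<open>|expo q s| \<le> 1\<close> for \<open>Re s \<ge> 0\<close>,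
  so the gamma kernels dominate and the derivative passes through one integral after the
  other.\<close>

lemma has_field_derivative_gops_expo:
  assumes q: "1 < q" and L: "positive_pairs L" and x: "x > 0 \<or> (x = 0 \<and> L \<noteq> [])" and s: "Re s > 0"
  shows "((\<lambda>s. gops (scale_pairs 1 L) (expo q s) (of_real x)) has_field_derivative
      gops (scale_pairs 1 L) (\<lambda>z. - (z powr (of_real q)) * expo q s z) (of_real x)) (at s)"
  using L x s
proof (induction L arbitrary: x s)
  case Nil
  have "((\<lambda>s. exp (- s * of_real (x powr q))) has_field_derivative - of_real (x powr q) * exp (- s * of_real (x powr q))) (at s)"
    by (auto intro!: derivative_eq_intros)
  then show ?case using Nil by (simp add: expo_of_real powr_of_real)
next
  case (Cons a L)
  obtain b \<beta> where a: "a = (b, \<beta>)" by (cases a)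
  have b: "b > 0" "\<beta> > 0" and L: "positive_pairs L" using Cons.prems by (auto simp: a)
  have x: "x \<ge> 0" using Cons.prems by auto
  let ?g = "\<lambda>s t. gops (scale_pairs 1 L) (expo q s) (of_real x + of_real t)"
  let ?f = "\<lambda>s t. complex_of_real (pw \<beta> t) * exp (- of_real b * of_real t) * ?g s t"
  have IH: "((\<lambda>s. ?g s t) has_field_derivative
      gops (scale_pairs 1 L) (\<lambda>z. - (z powr (of_real q)) * expo q s z) (of_real x + of_real t)) (at s)"
    if "t > 0" "Re s > 0" for t s
    using Cons.IH[OF L, of "x + t" s] that x by simp
  have adm: "admissible (scale_pairs 1 L)" by (rule admissible_scale_pairs[OF L]) simp
  have "((\<lambda>s. \<integral>t. ?f s t \<partial>lborel) has_field_derivative (\<integral>t. deriv (\<lambda>s. ?f s t) s \<partial>lborel)) (at s)"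
  proof (rule has_field_derivative_lebesgue_integral[OF open_rhp])
    show "(\<lambda>s. ?f s t) holomorphic_on {z. Re z > 0}" for t
    proof (cases "t > 0")
      case True
      then have "(\<lambda>s. ?g s t) holomorphic_on {z. Re z > 0}"
        using IH[OF True] open_rhp by (auto simp: holomorphic_on_open)
      then show ?thesis by (intro holomorphic_intros)
    qed auto
    show "?f s \<in> borel_measurable lborel" for s
      using gop_integrand_measurable[OF gops_measurable[OF expo_measurable], of \<beta> "of_real b" "scale_pairs 1 L" q s "of_real x"]
      by simp
    fix z :: complex assume "z \<in> {z. Re z > 0}"
    then have z: "Re z > 0" by simp
    show "\<exists>r>0. \<exists>g. ball z r \<subseteq> {z. Re z > 0} \<and> integrable lborel g \<and>
      (\<forall>y\<in>ball z r. \<forall>t\<in>space lborel. norm (?f y t) \<le> g t)"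
    proof (intro exI[of _ "Re z / 2"] exI[of _ "\<lambda>t. gops_const (scale_pairs 1 L) * (pw \<beta> t * exp (- b * t))"] conjI ballI)
      show "integrable lborel (\<lambda>t. gops_const (scale_pairs 1 L) * (pw \<beta> t * exp (- b * t)))"
        using b by (intro integrable_mult_right integrable_pw_exp) auto
      show "ball z (Re z / 2) \<subseteq> {z. Re z > 0}" using rhp_ball[OF z] z by force
    next
      fix y t assume y: "y \<in> ball z (Re z / 2)"
      have yp: "Re y \<ge> 0" using rhp_ball[OF z y] z by simp
      have "norm (expo q y (0 + of_real t)) \<le> 1" if "t > 0" for t
        using norm_expo_le_1[OF yp that] by simp
      from gops_norm_le[OF adm expo_measurable this]
      have "norm (gops (scale_pairs 1 L) (expo q y) (of_real t)) \<le> gops_const (scale_pairs 1 L)" if "t > 0" for t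
        using that by simp
      then have "norm (?g y t) \<le> gops_const (scale_pairs 1 L)" if "t > 0" for t
        using that x by (metis add_nonneg_pos of_real_add)
      from gop_integrand_bound[of "gops (scale_pairs 1 L) (expo q y)" "of_real x" "gops_const (scale_pairs 1 L)" \<beta> t "of_real b", OF this]
      show "norm (?f y t) \<le> gops_const (scale_pairs 1 L) * (pw \<beta> t * exp (- b * t))" by simp
    qed (use z in auto)
  qed (use Cons.prems in auto)
  also have "(\<lambda>t. deriv (\<lambda>s. ?f s t) s) = (\<lambda>t. complex_of_real (pw \<beta> t) * exp (- of_real b * of_real t) *
      gops (scale_pairs 1 L) (\<lambda>z. - (z powr (of_real q)) * expo q s z) (of_real x + of_real t))"
  proof
    fix t
    show "deriv (\<lambda>s. ?f s t) s = complex_of_real (pw \<beta> t) * exp (- of_real b * of_real t) *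
      gops (scale_pairs 1 L) (\<lambda>z. - (z powr (of_real q)) * expo q s z) (of_real x + of_real t)"
    proof (cases "t > 0")
      case True
      then show ?thesis using Cons.prems by (intro DERIV_imp_deriv DERIV_cmult IH) auto
    qed simp
  qed
  finally show ?case by (simp add: a gop_def[abs_def])
qed

lemma psi_holomorphic:
  assumes q: "1 < q" and L: "positive_pairs L" "L \<noteq> []"
  shows "psi q L holomorphic_on {z. Re z > 0}"
proof -
  have "(\<lambda>s. gops (scale_pairs 1 L) (expo q s) 0) holomorphic_on {z. Re z > 0}"
    using has_field_derivative_gops_expo[OF q L(1), of 0] L(2) open_rhp by (auto simp: holomorphic_on_open)
  then show ?thesis unfolding psi_def[abs_def] by (intro holomorphic_intros)
qed

text \<open>On \<open>exp (- s * z powr q)\<close> the operator \<open>s d/ds\<close> acts as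
  \<open>1 / q\<close> times the Euler field, so \<open>gops_euler\<close> at 0 computes the
  derivative. The pair \<open>(b, 1)\<close> in front of the list is the additional exponential
  variable.\<close>

lemma psi_stein:
  assumes q: "1 < q" "q < 2" and L: "positive_pairs L" "L \<noteq> []" and s: "s > 0"
  shows "of_real s * deriv (psi q L) (of_real s) =
     of_real (1 / q) * (\<Sum>(b, \<beta>)\<leftarrow>L. of_real \<beta> * (psi q ((b, 1) # L) (of_real s) - psi q L (of_real s)))"
proof -
  let ?S = "scale_pairs 1 L" and ?E = "expo q (of_real s)"
  have adm: "admissible ?S" by (rule admissible_scale_pairs[OF L(1)]) simp
  have rE: "rdecr ?E"
  proof (rule rdecr_expo)
    fix z :: complex assume "Re z > 0"
    then have "Re (z powr (of_real (q - 1))) > 0" using q by (intro Re_powr_pos) auto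
    then show "Re (of_real s * z powr (of_real (q - 1))) \<ge> 0" using s by simp
  qed (use q in auto)
  obtain C where C: "\<And>t::real. t > 0 \<Longrightarrow> norm (?E (of_real t)) \<le> C"
    "\<And>t::real. t > 0 \<Longrightarrow> norm (rderiv ?E (of_real t)) \<le> C"
    using expo_bounds[of "of_real s" q] s q by auto
  have D: "((\<lambda>s. gops ?S (expo q s) 0) has_field_derivative gops ?S (\<lambda>z. - (z powr (of_real q)) * ?E z) 0) (at (of_real s))"
    using has_field_derivative_gops_expo[OF q(1) L(1), of 0 "of_real s"] L(2) s by simp
  then have D': "deriv (psi q L) (of_real s) = of_real (rate_const L) * gops ?S (\<lambda>z. - (z powr (of_real q)) * ?E z) 0"
    unfolding psi_def[abs_def] by (intro DERIV_imp_deriv DERIV_cmult)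
  have "of_real (s * q) * gops ?S (\<lambda>z. - (z powr (of_real q)) * ?E z) 0 =
      gops ?S (\<lambda>z. of_real (s * q) * (- (z powr (of_real q)) * ?E z)) 0"
    unfolding gops_cmult ..
  also have "\<dots> = gops ?S (\<lambda>z. z * rderiv ?E z) 0"
  proof (rule gops_cong_rhp)
    fix z :: complex assume z: "Re z > 0"
    then have "z \<noteq> 0" by auto
    then have "z powr (of_real q) = z * z powr (of_real (q - 1))"
      by (simp add: powr_diff)
    then show "of_real (s * q) * (- (z powr (of_real q)) * ?E z) = z * rderiv ?E z"
      by (simp add: rderiv_expo[OF z])
  qed (use L in \<open>auto simp: scale_pairs_def\<close>)
  also have "\<dots> = (\<Sum>(w, \<gamma>)\<leftarrow>?S. of_real \<gamma> * (w * gop w 1 (gops ?S ?E) 0 - gops ?S ?E 0))"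
    using gops_euler[OF adm rE C, of 0] by simp
  finally have 1: "of_real (s * q) * gops ?S (\<lambda>z. - (z powr (of_real q)) * ?E z) 0 =
      (\<Sum>(w, \<gamma>)\<leftarrow>?S. of_real \<gamma> * (w * gop w 1 (gops ?S ?E) 0 - gops ?S ?E 0))" .
  have "of_real q * (of_real s * deriv (psi q L) (of_real s)) =
      of_real (rate_const L) * (\<Sum>(w, \<gamma>)\<leftarrow>?S. of_real \<gamma> * (w * gop w 1 (gops ?S ?E) 0 - gops ?S ?E 0))"
    unfolding D' 1[symmetric] by simp
  also have "\<dots> = (\<Sum>(b, \<beta>)\<leftarrow>L. of_real \<beta> * (psi q ((b, 1) # L) (of_real s) - psi q L (of_real s)))"
  proof -
    have "of_real (rate_const L) * (\<Sum>(w, \<gamma>)\<leftarrow>?S. of_real \<gamma> * (w * gop w 1 (gops ?S ?E) 0 - gops ?S ?E 0)) =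
       (\<Sum>(b, \<beta>)\<leftarrow>L. of_real (rate_const L) * (of_real \<beta> * (of_real b * gop (of_real b) 1 (gops ?S ?E) 0 - gops ?S ?E 0)))"
      unfolding sum_list_const_mult[symmetric] by (simp add: scale_pairs_def comp_def case_prod_unfold)
    also have "\<dots> = (\<Sum>(b, \<beta>)\<leftarrow>L. of_real \<beta> * (psi q ((b, 1) # L) (of_real s) - psi q L (of_real s)))"
    proof (intro arg_cong[where f = sum_list] map_cong refl, clarify)
      fix b \<beta> assume "(b, \<beta>) \<in> set L"
      then have "b > 0" using L by (auto simp: positive_pairs_def)
      then show "of_real (rate_const L) * (of_real \<beta> * (of_real b * gop (of_real b) 1 (gops ?S ?E) 0 - gops ?S ?E 0)) =
          of_real \<beta> * (psi q ((b, 1) # L) (of_real s) - psi q L (of_real s))"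
        by (simp add: psi_def algebra_simps)
    qed
    finally show ?thesis .
  qed
  finally show ?thesis using q by (simp add: field_simps)
qed

text \<open>On the positive axis this is \<open>psi_stein\<close> at \<open>s = \<zeta>^2\<close>,
  with the factor 2 from the chain rule; both sides continue holomorphically.\<close>

lemma Psi_stein:
  assumes q: "1 < q" "q < 2" and L: "positive_pairs L" "L \<noteq> []" and z: "Re \<zeta> > 0"
  shows "\<zeta> * deriv (Psi q L) \<zeta> = of_real (2 / q) * (\<Sum>(b, \<beta>)\<leftarrow>L. of_real \<beta> * (Psi q ((b, 1) # L) \<zeta> - Psi q L \<zeta>))"
proof (rule rhp_identity[OF _ _ _ z, of "\<lambda>\<zeta>. \<zeta> * deriv (Psi q L) \<zeta>"])
  show "(\<lambda>\<zeta>. \<zeta> * deriv (Psi q L) \<zeta>) holomorphic_on {z. Re z > 0}"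
    by (intro holomorphic_intros holomorphic_deriv Psi_holomorphic open_rhp q L)
  have "(\<lambda>\<zeta>. \<Sum>(b, \<beta>)\<leftarrow>M. of_real \<beta> * (Psi q ((b, 1) # L) \<zeta> - Psi q L \<zeta>)) holomorphic_on {z. Re z > 0}"
    if "set M \<subseteq> set L" for M
    using that
  proof (induction M)
    case (Cons a M)
    obtain b \<beta> where a: "a = (b, \<beta>)" by (cases a)
    have "positive_pairs ((b, 1) # L)" using Cons.prems L by (auto simp: a positive_pairs_def)
    then have "Psi q ((b, 1) # L) holomorphic_on {z. Re z > 0}" by (intro Psi_holomorphic q) auto
    then show ?case using Cons Psi_holomorphic[OF q L] by (auto simp: a intro!: holomorphic_intros)
  qed auto
  then show "(\<lambda>\<zeta>. of_real (2 / q) * (\<Sum>(b, \<beta>)\<leftarrow>L. of_real \<beta> * (Psi q ((b, 1) # L) \<zeta> - Psi q L \<zeta>))) holomorphic_on {z. Re z > 0}"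
    by (intro holomorphic_intros) auto
  fix r :: real assume r: "r > 0"
  have r2: "r\<^sup>2 > 0" using r by simp
  have 1: "((\<lambda>t. Psi q L (of_real t)) has_vector_derivative 1 * deriv (Psi q L) (of_real r)) (at r)"
  proof (rule field_vector_diff_chain_at[unfolded comp_def, where g = "Psi q L" and f = of_real])
    show "(complex_of_real has_vector_derivative 1) (at r)" by (auto intro!: derivative_eq_intros)
    show "(Psi q L has_field_derivative deriv (Psi q L) (of_real r)) (at (of_real r))"
      using r by (intro holomorphic_derivI[OF Psi_holomorphic[OF q L] open_rhp]) auto
  qed
  have 2: "((\<lambda>t. psi q L (of_real (t\<^sup>2))) has_vector_derivative of_real (2 * r) * deriv (psi q L) (of_real (r\<^sup>2))) (at r)"
  proof (rule field_vector_diff_chain_at[unfolded comp_def, where g = "psi q L" and f = "\<lambda>t. of_real (t\<^sup>2)"])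
    show "((\<lambda>t. complex_of_real (t\<^sup>2)) has_vector_derivative of_real (2 * r)) (at r)"
      by (rule has_vector_derivative_of_real) (auto intro!: derivative_eq_intros)
    show "(psi q L has_field_derivative deriv (psi q L) (of_real (r\<^sup>2))) (at (of_real (r\<^sup>2)))"
      using r2 by (intro holomorphic_derivI[OF psi_holomorphic[OF q(1) L] open_rhp]) auto
  qed
  have "((\<lambda>t. Psi q L (of_real t)) has_vector_derivative of_real (2 * r) * deriv (psi q L) (of_real (r\<^sup>2))) (at r)"
    using 2 by (rule has_vector_derivative_transform_within_open[where S = "{0<..}"])
       (use r Psi_of_real[OF _ L(1)] in auto)
  with 1 have "deriv (Psi q L) (of_real r) = of_real (2 * r) * deriv (psi q L) (of_real (r\<^sup>2))"
    using vector_derivative_unique_at by fastforce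
  then have "of_real r * deriv (Psi q L) (of_real r) = 2 * (of_real (r\<^sup>2) * deriv (psi q L) (of_real (r\<^sup>2)))"
    by (simp add: power2_eq_square)
  also have "\<dots> = of_real (2 / q) * (\<Sum>(b, \<beta>)\<leftarrow>L. of_real \<beta> * (psi q ((b, 1) # L) (of_real (r\<^sup>2)) - psi q L (of_real (r\<^sup>2))))"
    unfolding psi_stein[OF q L r2] by simp
  also have "(\<Sum>(b, \<beta>)\<leftarrow>L. of_real \<beta> * (psi q ((b, 1) # L) (of_real (r\<^sup>2)) - psi q L (of_real (r\<^sup>2)))) =
      (\<Sum>(b, \<beta>)\<leftarrow>L. of_real \<beta> * (Psi q ((b, 1) # L) (of_real r) - Psi q L (of_real r)))"
  proof (intro arg_cong[where f = sum_list] map_cong refl, clarify)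
    fix b \<beta> assume "(b, \<beta>) \<in> set L"
    then have "positive_pairs ((b, 1) # L)" using L by (auto simp: positive_pairs_def)
    then show "of_real \<beta> * (psi q ((b, 1) # L) (of_real (r\<^sup>2)) - psi q L (of_real (r\<^sup>2))) =
      of_real \<beta> * (Psi q ((b, 1) # L) (of_real r) - Psi q L (of_real r))"
      using Psi_of_real[OF r] L(1) by simp
  qed
  finally show "of_real r * deriv (Psi q L) (of_real r) =
    of_real (2 / q) * (\<Sum>(b, \<beta>)\<leftarrow>L. of_real \<beta> * (Psi q ((b, 1) # L) (of_real r) - Psi q L (of_real r)))" .
qed

section \<open>Monotonicity of the transform in modulus\<close>

lemma Re_of_real_mult: "Re (of_real r * u) = r * Re u"
  by simp

text \<open>The disc inequality is available in the open half plane but needed at the boundary point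
  0, where the expectation is taken.\<close>

lemma gop_tendsto_0:
  assumes A: "A \<in> borel_measurable borel" "A holomorphic_on {z. Re z > 0}"
    and bd: "\<And>t::real. t > 0 \<Longrightarrow> norm (A (of_real t)) \<le> C" and w: "Re w > 0" and g: "\<gamma> > 0"
  shows "(\<lambda>n. gop w \<gamma> A (of_real (1 / real (Suc n)))) \<longlonglongrightarrow> gop w \<gamma> A 0"
  unfolding gop_def
proof (rule integral_dominated_convergence[where w = "\<lambda>t. C * (pw \<gamma> t * exp (- Re w * t))"])
  show "(\<lambda>t. of_real (pw \<gamma> t) * exp (- w * of_real t) * A (z + of_real t)) \<in> borel_measurable lborel" for z
    using gop_integrand_measurable[OF A(1)] by simp
  then show "(\<lambda>t. of_real (pw \<gamma> t) * exp (- w * of_real t) * A (z n + of_real t)) \<in> borel_measurable lborel" for z :: "nat \<Rightarrow> complex" and n .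
  show "integrable lborel (\<lambda>t. C * (pw \<gamma> t * exp (- Re w * t)))"
    using integrable_pw_exp[OF g w] by simp
  show "AE t in lborel. (\<lambda>n. of_real (pw \<gamma> t) * exp (- w * of_real t) * A (of_real (1 / real (Suc n)) + of_real t))
      \<longlonglongrightarrow> of_real (pw \<gamma> t) * exp (- w * of_real t) * A (0 + of_real t)"
  proof (rule AE_I2)
    fix t :: real
    show "(\<lambda>n. of_real (pw \<gamma> t) * exp (- w * of_real t) * A (of_real (1 / real (Suc n)) + of_real t))
      \<longlonglongrightarrow> of_real (pw \<gamma> t) * exp (- w * of_real t) * A (0 + of_real t)"
    proof (cases "t > 0")
      case True
      have "(\<lambda>n. 1 / real (Suc n)) \<longlonglongrightarrow> 0" by real_asymp
      then have "(\<lambda>n. complex_of_real (1 / real (Suc n)) + of_real t) \<longlonglongrightarrow> of_real 0 + of_real t"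
        by (intro tendsto_intros)
      then have "(\<lambda>n. complex_of_real (1 / real (Suc n)) + of_real t) \<longlonglongrightarrow> 0 + of_real t" by simp
      moreover have "isCont A (0 + of_real t)"
        using True by (intro DERIV_isCont[OF has_field_derivative_rderiv[OF A(2)]]) auto
      ultimately show ?thesis by (intro tendsto_mult tendsto_const isCont_tendsto_compose[of _ A])
    qed simp
  qed
  show "AE t in lborel. norm (of_real (pw \<gamma> t) * exp (- w * of_real t) * A (of_real (1 / real (Suc n)) + of_real t))
      \<le> C * (pw \<gamma> t * exp (- Re w * t))" for n
  proof (intro AE_I2 gop_integrand_bound)
    fix t :: real assume "t > 0"
    then show "norm (A (of_real (1 / real (Suc n)) + of_real t)) \<le> C"
      using bd[of "1 / real (Suc n) + t"] by (simp add: add_pos_pos)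
  qed
qed

text \<open>With \<open>D = x - w * y\<close> the hypothesis reads
  \<open>Re (D * cnj y) \<ge> 0\<close>. Because \<open>w\<close> has exactly the phase of
  \<open>1 / \<zeta>\<close>, the number \<open>cnj w / \<zeta> = b / |\<zeta>|^2\<close> is
  positive, and \<open>D * cnj x / \<zeta>\<close> is \<open>|D|^2 / \<zeta>\<close> plus a positive
  multiple of \<open>D * cnj y\<close>.\<close>

lemma half_angle_inequality:
  fixes \<zeta> x y w :: complex
  assumes z: "Re \<zeta> > 0" and b: "b > 0" and w: "w = of_real b / \<zeta>"
    and le: "Re w * (norm y)\<^sup>2 \<le> Re (x * cnj y)"
  shows "Re ((w * y - x) * cnj x / \<zeta>) \<le> 0"
proof -
  define D where "D = x - w * y"
  have z0: "\<zeta> \<noteq> 0" using z by auto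
  have "D * cnj y = x * cnj y - w * (y * cnj y)" by (simp add: D_def algebra_simps)
  also have "\<dots> = x * cnj y - w * of_real ((norm y)\<^sup>2)" by (simp only: complex_norm_square)
  finally have Dy: "Re (D * cnj y) \<ge> 0" using le by simp
  have "w * y - x = - D" "x = D + w * y" by (simp_all add: D_def)
  then have 1: "(w * y - x) * cnj x / \<zeta> = - (D * cnj (D + w * y) / \<zeta>)" by (metis minus_divide_left mult_minus_left)
  have cw: "cnj w = of_real b / cnj \<zeta>" by (simp add: w)
  have "D * cnj (D + w * y) / \<zeta> = (D * cnj D) / \<zeta> + (D * cnj y) * of_real b / (\<zeta> * cnj \<zeta>)"
    by (simp add: cw distrib_left add_divide_distrib mult_ac)
  also have "\<dots> = of_real ((norm D)\<^sup>2) * (1 / \<zeta>) + (D * cnj y) * of_real (b / (norm \<zeta>)\<^sup>2)"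
    unfolding complex_norm_square[symmetric] by simp
  finally have 2: "D * cnj (D + w * y) / \<zeta> = of_real ((norm D)\<^sup>2) * (1 / \<zeta>) + (D * cnj y) * of_real (b / (norm \<zeta>)\<^sup>2)" .
  have 3: "Re (- (of_real r * u + v * of_real t)) = - (r * Re u + Re v * t)" for r t u v by simp
  have "0 \<le> (norm D)\<^sup>2 * Re (1 / \<zeta>) + Re (D * cnj y) * (b / (norm \<zeta>)\<^sup>2)"
    using Dy b Re_inverse_pos[OF z]
    by (intro add_nonneg_nonneg mult_nonneg_nonneg divide_nonneg_nonneg zero_le_power2) (auto simp del: one_divide_eq_0_iff simp: less_imp_le)
  then show ?thesis unfolding 1 2 3 by linarith
qed

text \<open>\<open>Psi_stein\<close> writes \<open>\<zeta>\<close> times the derivative as a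
  combination of differences with positive coefficients. To each of them
  \<open>half_angle_inequality\<close> applies, with \<open>x = H 0\<close> and \<open>y\<close> the
  image of \<open>H\<close> under an operator of shape 1.\<close>

lemma Re_deriv_Psi:
  assumes q: "1 < q" "q < 2" and L: "positive_pairs L" "L \<noteq> []" and z: "Re \<zeta> > 0"
  shows "Re (deriv (Psi q L) \<zeta> * cnj (Psi q L \<zeta>)) \<le> 0"
proof -
  have z0: "\<zeta> \<noteq> 0" using z by auto
  \<comment> \<open>Splitting off one pair exhibits \<open>H\<close> as an image under
    \<open>gop\<close>, so that \<open>H 0\<close> is a limit from the right.\<close>
  obtain b0 \<beta>0 L' where Lc: "L = (b0, \<beta>0) # L'" using L(2) by (cases L) auto
  define c where "c = \<zeta> powr (of_real (2 - q))"
  define A where "A = gops (scale_pairs \<zeta> L') (expo q c)"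
  define H where "H = gop (of_real b0 / \<zeta>) \<beta>0 A"
  have H_eq: "H = gops (scale_pairs \<zeta> L) (expo q c)" by (simp add: H_def A_def Lc)
  have rE: "rdecr (expo q c)"
  proof (rule rdecr_expo)
    show "Re (c * y powr (of_real (q - 1))) \<ge> 0" if "Re y > 0" for y
      unfolding c_def by (rule Re_powr_mult_powr) (use z that q in auto)
  qed (use q in auto)
  have Re_c: "Re c \<ge> 0" unfolding c_def using Re_powr_pos[OF z, of "2 - q"] q by simp
  have L': "positive_pairs L'" "b0 > 0" "\<beta>0 > 0" using L(1) by (simp_all add: Lc)
  have adm: "admissible (scale_pairs \<zeta> L)" "admissible (scale_pairs \<zeta> L')"
    by (rule admissible_scale_pairs[OF L(1) z], rule admissible_scale_pairs[OF L'(1) z])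
  have rA: "rdecr A" unfolding A_def by (rule rdecr_gops[OF adm(2) rE])
  have rH: "rdecr H" unfolding H_eq by (rule rdecr_gops[OF adm(1) rE])
  have E1: "norm (expo q c (0 + of_real t)) \<le> 1" if "t > 0" for t
    using norm_expo_le_1[OF Re_c that] by simp
  have bA: "norm (A (of_real t)) \<le> gops_const (scale_pairs \<zeta> L')" if "t > 0" for t
    using gops_norm_le[OF adm(2) expo_measurable E1 that] by (simp add: A_def)
  have bH: "norm (H (of_real t)) \<le> gops_const (scale_pairs \<zeta> L)" if "t > 0" for t
    using gops_norm_le[OF adm(1) expo_measurable E1 that] by (simp add: H_eq)
  have w: "Re (of_real b / \<zeta>) > 0" if "b > 0" for b
    unfolding Re_of_real_divide using that Re_inverse_pos[OF z] by simp
  note b0 = L'(2,3)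
  have H0: "(\<lambda>n. H (of_real (1 / real (Suc n)))) \<longlonglongrightarrow> H 0"
    unfolding H_def by (rule gop_tendsto_0[OF rdecr_measurable[OF rA] rdecr_holomorphic[OF rA] bA w[OF b0(1)] b0(2)])
  have key: "Re ((of_real b / \<zeta> * gop (of_real b / \<zeta>) 1 H 0 - H 0) * cnj (H 0) / \<zeta>) \<le> 0" if b: "b > 0" for b
  proof (rule half_angle_inequality[OF z b refl])
    let ?w = "of_real b / \<zeta>"
    have K0: "(\<lambda>n. gop ?w 1 H (of_real (1 / real (Suc n)))) \<longlonglongrightarrow> gop ?w 1 H 0"
      by (rule gop_tendsto_0[OF rdecr_measurable[OF rH] rdecr_holomorphic[OF rH] bH w[OF b]]) auto
    have "(\<lambda>n. Re ?w * (norm (gop ?w 1 H (of_real (1 / real (Suc n)))))\<^sup>2) \<longlonglongrightarrow> Re ?w * (norm (gop ?w 1 H 0))\<^sup>2"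
      by (intro tendsto_intros K0)
    moreover have "(\<lambda>n. Re (H (of_real (1 / real (Suc n))) * cnj (gop ?w 1 H (of_real (1 / real (Suc n))))))
        \<longlonglongrightarrow> Re (H 0 * cnj (gop ?w 1 H 0))"
      by (intro tendsto_Re tendsto_mult tendsto_cnj K0 H0)
    ultimately show "Re ?w * (norm (gop ?w 1 H 0))\<^sup>2 \<le> Re (H 0 * cnj (gop ?w 1 H 0))"
    proof (rule LIMSEQ_le)
      show "\<exists>N. \<forall>n\<ge>N. Re ?w * (norm (gop ?w 1 H (of_real (1 / real (Suc n)))))\<^sup>2
          \<le> Re (H (of_real (1 / real (Suc n))) * cnj (gop ?w 1 H (of_real (1 / real (Suc n)))))"
        using gop_one_disc[OF rH w[OF b]] by simp
    qed
  qed
  define k where "k = of_real (rate_const L) * \<zeta> powr (- of_real (shape_sum L))"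
  have P: "Psi q L \<zeta> = k * H 0" by (simp add: Psi_def pre_psi_def k_def H_eq c_def)
  \<comment> \<open>The additional variable has shape 1 and brings one more factor
    \<open>1 / \<zeta>\<close>, which turns its normalising constant \<open>b\<close> into its rate
    \<open>b / \<zeta>\<close>.\<close>
  have Pj: "Psi q ((b, 1) # L) \<zeta> = k * (of_real b / \<zeta> * gop (of_real b / \<zeta>) 1 H 0)" if "b > 0" for b
  proof -
    have "- complex_of_real (1 + shape_sum L) = - of_real (shape_sum L) - 1" by simp
    then have "\<zeta> powr (- of_real (1 + shape_sum L)) = \<zeta> powr (- of_real (shape_sum L)) / \<zeta>"
      using powr_diff[of \<zeta> "- of_real (shape_sum L)" 1] z0 by (simp only: powr_one_eq_one powr_to_1 if_False)
    then show ?thesis using that by (simp add: Psi_def pre_psi_def k_def H_eq c_def)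
  qed
  have "deriv (Psi q L) \<zeta> * cnj (Psi q L \<zeta>) = (\<zeta> * deriv (Psi q L) \<zeta>) * cnj (Psi q L \<zeta>) / \<zeta>"
    using z0 by simp
  also have "\<dots> = of_real (2 / q) * ((\<Sum>(b, \<beta>)\<leftarrow>L. of_real \<beta> * (Psi q ((b, 1) # L) \<zeta> - Psi q L \<zeta>)) * (cnj (Psi q L \<zeta>) / \<zeta>))"
    unfolding Psi_stein[OF q L z] by simp
  also have "(\<Sum>(b, \<beta>)\<leftarrow>L. of_real \<beta> * (Psi q ((b, 1) # L) \<zeta> - Psi q L \<zeta>)) * (cnj (Psi q L \<zeta>) / \<zeta>) =
      (\<Sum>(b, \<beta>)\<leftarrow>L. of_real (\<beta> * (norm k)\<^sup>2) * ((of_real b / \<zeta> * gop (of_real b / \<zeta>) 1 H 0 - H 0) * cnj (H 0) / \<zeta>))"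
    unfolding sum_list_mult_const[symmetric]
  proof (intro arg_cong[where f = sum_list] map_cong refl, clarify)
    fix b \<beta> assume "(b, \<beta>) \<in> set L"
    then have "b > 0" using L by (auto simp: positive_pairs_def)
    have alg: "r * (k * x - k * h) * (cnj (k * h) / \<zeta>) = r * (k * cnj k) * ((x - h) * cnj h / \<zeta>)" for r x h
      unfolding right_diff_distrib[symmetric] by (simp add: mult_ac)
    have "of_real \<beta> * (Psi q ((b, 1) # L) \<zeta> - Psi q L \<zeta>) * (cnj (Psi q L \<zeta>) / \<zeta>) =
      of_real \<beta> * (k * cnj k) * ((of_real b / \<zeta> * gop (of_real b / \<zeta>) 1 H 0 - H 0) * cnj (H 0) / \<zeta>)"
      unfolding P Pj[OF \<open>b > 0\<close>] by (rule alg)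
    then show "of_real \<beta> * (Psi q ((b, 1) # L) \<zeta> - Psi q L \<zeta>) * (cnj (Psi q L \<zeta>) / \<zeta>) =
      of_real (\<beta> * (norm k)\<^sup>2) * ((of_real b / \<zeta> * gop (of_real b / \<zeta>) 1 H 0 - H 0) * cnj (H 0) / \<zeta>)"
      unfolding complex_norm_square[symmetric] by (simp only: of_real_mult)
  qed
  finally have eq: "deriv (Psi q L) \<zeta> * cnj (Psi q L \<zeta>) = of_real (2 / q) *
     (\<Sum>(b, \<beta>)\<leftarrow>L. of_real (\<beta> * (norm k)\<^sup>2) * ((of_real b / \<zeta> * gop (of_real b / \<zeta>) 1 H 0 - H 0) * cnj (H 0) / \<zeta>))" .
  define F where "F = (\<lambda>(b, \<beta>). of_real (\<beta> * (norm k)\<^sup>2) * ((of_real b / \<zeta> * gop (of_real b / \<zeta>) 1 H 0 - H 0) * cnj (H 0) / \<zeta>))"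
  have F: "Re (F p) \<le> 0" if "p \<in> set L" for p
  proof -
    obtain b \<beta> where p: "p = (b, \<beta>)" by (cases p)
    then have "b > 0" "\<beta> > 0" using that L(1) by (auto simp: positive_pairs_def)
    then show ?thesis
      unfolding p F_def case_prod_conv Re_of_real_mult
      by (intro mult_nonneg_nonpos key mult_nonneg_nonneg zero_le_power2) simp_all
  qed
  then have le: "Re (sum_list (map F L)) \<le> 0"
  proof (induction L)
    case (Cons p M)
    then have "Re (F p) \<le> 0" "Re (sum_list (map F M)) \<le> 0" by simp_all
    then show ?case by (simp only: list.map sum_list.Cons plus_complex.sel)
  qed simp
  show ?thesis
    unfolding eq F_def[symmetric] Re_of_real_mult using q by (intro mult_nonneg_nonpos le) simp_all
qed

section \<open>Functions with positive real part on the half plane\<close>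

text \<open>Uniform continuity on the compact product makes the error independent of
  \<open>x\<close>. Midpoints are symmetric under reflection of the interval and avoid its ends,
  where the kernel used below degenerates to \<open>z\<close>.\<close>

lemma midpoint_riemann_uniform:
  fixes g :: "real \<Rightarrow> 'b::metric_space \<Rightarrow> complex"
  assumes cont: "continuous_on ({a..b} \<times> K) (\<lambda>(t, x). g t x)" and K: "compact K" and e: "e > 0" and ab: "a < b"
  obtains N :: nat where "N > 0"
    "\<And>x. x \<in> K \<Longrightarrow> norm (integral {a..b} (\<lambda>t. g t x)
        - of_real ((b - a) / N) * (\<Sum>k<N. g (a + (real k + 1/2) * ((b - a) / N)) x)) \<le> e"
proof -
  have "uniformly_continuous_on ({a..b} \<times> K) (\<lambda>(t, x). g t x)"
    using cont K by (intro compact_uniformly_continuous compact_Times) auto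
  then obtain d where d: "d > 0" and ud: "\<And>p p'. p \<in> {a..b} \<times> K \<Longrightarrow> p' \<in> {a..b} \<times> K \<Longrightarrow> dist p' p < d \<Longrightarrow>
      dist ((\<lambda>(t, x). g t x) p') ((\<lambda>(t, x). g t x) p) < e / (b - a)"
    unfolding uniformly_continuous_on_def using e ab by (metis diff_gt_0_iff_gt divide_pos_pos)
  obtain N :: nat where N: "real N > (b - a) / d" using reals_Archimedean2 by blast
  have N0: "N > 0" using N d ab by (cases N) (auto simp: divide_less_0_iff)
  define h where "h = (b - a) / N"
  have h: "h > 0" "h < d" using N N0 d ab by (auto simp: h_def field_simps)
  have hN: "a + real N * h = b" using N0 by (simp add: h_def)
  have le_b: "a + real k * h \<le> b" if "k \<le> N" for k
  proof -
    have "real k * h \<le> real N * h" using that h by (intro mult_right_mono) auto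
    then show ?thesis using hN by linarith
  qed
  have main: "norm (integral {a..a + real n * h} (\<lambda>t. g t x)
      - of_real h * (\<Sum>k<n. g (a + (real k + 1/2) * h) x)) \<le> real n * (h * (e / (b - a)))"
    if x: "x \<in> K" and "n \<le> N" for x n
    using \<open>n \<le> N\<close>
  proof (induction n)
    case (Suc n)
    let ?l = "a + real n * h" and ?u = "a + real (Suc n) * h" and ?m = "a + (real n + 1/2) * h"
    have l: "a \<le> ?l" "?l \<le> ?u" "?u \<le> b" using h le_b[OF Suc.prems] by (auto simp: algebra_simps)
    have m: "?l \<le> ?m" "?m \<le> ?u" using h by (auto simp: algebra_simps)
    have contx: "continuous_on {a..b} (\<lambda>t. g t x)"
    proof -
      have "continuous_on {a..b} ((\<lambda>(t, x). g t x) \<circ> (\<lambda>t. (t, x)))"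
        using x by (intro continuous_on_compose continuous_intros continuous_on_subset[OF cont]) auto
      then show ?thesis by (simp add: comp_def)
    qed
    have intg: "(\<lambda>t. g t x) integrable_on {a..?u}"
      using l by (intro integrable_continuous_real continuous_on_subset[OF contx]) auto
    have intg': "(\<lambda>t. g t x) integrable_on {?l..?u}"
      using l by (intro integrable_continuous_real continuous_on_subset[OF contx]) auto
    have split: "integral {a..?u} (\<lambda>t. g t x) = integral {a..?l} (\<lambda>t. g t x) + integral {?l..?u} (\<lambda>t. g t x)"
      using Henstock_Kurzweil_Integration.integral_combine[OF l(1,2) intg] by simp
    have hul: "?u - ?l = h" by (simp add: algebra_simps)
    have "((\<lambda>t. g t x - g ?m x) has_integral (integral {?l..?u} (\<lambda>t. g t x) - (?u - ?l) *\<^sub>R g ?m x)) {?l..?u}"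
      using intg' has_integral_const_real[of "g ?m x" ?l ?u] l(2)
      by (intro has_integral_diff) (simp_all add: has_integral_integral)
    then have "norm (integral {?l..?u} (\<lambda>t. g t x) - (?u - ?l) *\<^sub>R g ?m x) \<le> (e / (b - a)) * measure lborel {?l..?u}"
    proof (rule has_integral_bound_real[rotated 2])
      fix t assume t: "t \<in> {?l..?u} - {}"
      have "t \<in> {?l..?u}" "?m \<in> {?l..?u}" using t m by auto
      then have "\<bar>t - ?m\<bar> < d" using h hul unfolding atLeastAtMost_iff abs_less_iff by linarith
      then have "dist (t, x) (?m, x) < d" by (simp add: dist_Pair_Pair dist_real_def)
      then show "norm (g t x - g ?m x) \<le> e / (b - a)"
        using ud[of "(?m, x)" "(t, x)"] t l m x by (simp add: dist_norm)
    qed (use e ab in auto)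
    then have step: "norm (integral {?l..?u} (\<lambda>t. g t x) - of_real h * g ?m x) \<le> h * (e / (b - a))"
      using l(2) by (simp only: measure_lborel_Icc hul scaleR_conv_of_real mult.commute[of h])
    have IH: "norm (integral {a..?l} (\<lambda>t. g t x) - of_real h * (\<Sum>k<n. g (a + (real k + 1/2) * h) x)) \<le> real n * (h * (e / (b - a)))"
      using Suc by auto
    have "integral {a..?u} (\<lambda>t. g t x) - of_real h * (\<Sum>k<Suc n. g (a + (real k + 1/2) * h) x) =
        (integral {a..?l} (\<lambda>t. g t x) - of_real h * (\<Sum>k<n. g (a + (real k + 1/2) * h) x))
        + (integral {?l..?u} (\<lambda>t. g t x) - of_real h * g ?m x)"
      unfolding split by (simp add: algebra_simps)
    then show ?case
      using norm_triangle_mono[OF IH step] by (simp add: algebra_simps add_divide_distrib)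
  qed simp
  show ?thesis
  proof (rule that[OF N0])
    fix x assume "x \<in> K"
    moreover have "real N * (h * (e / (b - a))) = e" using N0 ab by (simp add: h_def)
    ultimately show "norm (integral {a..b} (\<lambda>t. g t x)
        - of_real ((b - a) / N) * (\<Sum>k<N. g (a + (real k + 1/2) * ((b - a) / N)) x)) \<le> e"
      using main[of x N] unfolding hN by (simp add: h_def)
  qed
qed

text \<open>On the circle the kernel is the average of the Herglotz kernels at \<open>cis t\<close>
  and at its conjugate; unlike the Poisson kernel it is holomorphic in \<open>\<xi>\<close>, and it
  is even in \<open>t\<close>. The formula is Cauchy's for
  \<open>F w * (1 - \<xi>^2) / (1 - w * \<xi>)\<close>, whose extra factor is 1 at
  \<open>w = \<xi>\<close>.\<close>

lemma poisson_type_formula: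
  fixes F :: "complex \<Rightarrow> complex"
  assumes F: "F holomorphic_on U" "cball 0 1 \<subseteq> U" and x: "norm \<xi> < 1"
  shows "((\<lambda>t. F (cis t) * ((1 - \<xi>\<^sup>2) / (1 + \<xi>\<^sup>2 - 2 * of_real (cos t) * \<xi>))) has_integral 2 * pi * F \<xi>) {0..2 * pi}"
proof -
  have nz: "1 - w * \<xi> \<noteq> 0" if "norm w \<le> 1" for w
  proof
    assume "1 - w * \<xi> = 0"
    then have "norm w * norm \<xi> = 1" by (metis eq_iff_diff_eq_0 norm_mult norm_one)
    moreover have "norm w * norm \<xi> \<le> 1 * norm \<xi>" using that by (intro mult_right_mono) auto
    ultimately show False using x by simp
  qed
  let ?G = "\<lambda>w::complex. F w * (1 - \<xi>\<^sup>2) / (1 - w * \<xi>)"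
  have "?G holomorphic_on cball 0 1"
    using F nz by (intro holomorphic_intros holomorphic_on_subset[OF F(1)]) auto
  then have "((\<lambda>u. ?G u / (u - \<xi>)) has_contour_integral 2 * of_real pi * \<i> * ?G \<xi>) (circlepath 0 1)"
    using x by (intro Cauchy_integral_circlepath_simple) auto
  then have "((\<lambda>t. ?G (cis t) / (cis t - \<xi>) * \<i> * cis t) has_integral 2 * of_real pi * \<i> * ?G \<xi>) {0..2 * pi}"
    by (simp add: circlepath_def has_contour_integral_part_circlepath_iff)
  then have "((\<lambda>t. - \<i> * (?G (cis t) / (cis t - \<xi>) * \<i> * cis t)) has_integral - \<i> * (2 * of_real pi * \<i> * ?G \<xi>)) {0..2 * pi}"
    by (rule has_integral_mult_right)
  moreover have "- \<i> * (2 * of_real pi * \<i> * ?G \<xi>) = 2 * pi * F \<xi>"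
    using nz[of \<xi>] x by (simp add: power2_eq_square)
  moreover have "- \<i> * (?G (cis t) / (cis t - \<xi>) * \<i> * cis t) = F (cis t) * ((1 - \<xi>\<^sup>2) / (1 + \<xi>\<^sup>2 - 2 * of_real (cos t) * \<xi>))" for t
  proof -
    have c: "2 * of_real (cos t) = cis t + cis (- t)" "cis t * cis (- t) = 1"
      by (simp_all add: complex_eq_iff cis_mult)
    have "cis t * (1 + \<xi>\<^sup>2 - 2 * of_real (cos t) * \<xi>) = cis t + cis t * \<xi>\<^sup>2 - cis t * cis t * \<xi> - (cis t * cis (- t)) * \<xi>"
      unfolding c(1) by (simp add: algebra_simps)
    also have "\<dots> = (cis t - \<xi>) * (1 - cis t * \<xi>)"
      unfolding c(2) by (simp add: algebra_simps power2_eq_square)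
    finally have eq: "cis t * (1 + \<xi>\<^sup>2 - 2 * of_real (cos t) * \<xi>) = (cis t - \<xi>) * (1 - cis t * \<xi>)" .
    have "- \<i> * (?G (cis t) / (cis t - \<xi>) * \<i> * cis t) = F (cis t) * ((cis t * (1 - \<xi>\<^sup>2)) / ((cis t - \<xi>) * (1 - cis t * \<xi>)))"
      by (simp add: field_simps)
    also have "\<dots> = F (cis t) * ((1 - \<xi>\<^sup>2) / (1 + \<xi>\<^sup>2 - 2 * of_real (cos t) * \<xi>))"
      unfolding eq[symmetric] by simp
    finally show ?thesis .
  qed
  ultimately show ?thesis by simp
qed

section \<open>Transfer to the half plane by the Cayley transform\<close>

lemma cayley_rhp:
  assumes "norm \<xi> < 1"
  shows "Re ((1 + \<xi>) / (1 - \<xi>)) > 0"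
proof -
  have nz: "1 - \<xi> \<noteq> 0" using assms by auto
  have "(norm \<xi>)\<^sup>2 < 1" using assms by (simp add: power_less_one_iff)
  then have "Re ((1 + \<xi>) * cnj (1 - \<xi>)) > 0" unfolding cmod_power2 by (simp add: algebra_simps power2_eq_square)
  then show ?thesis using nz by (subst Re_complex_div_gt_0) auto
qed

lemma cayley_disc:
  assumes "Re z > 0"
  shows "norm ((z - 1) / (z + 1)) < 1"
proof -
  have "(norm (z - 1))\<^sup>2 < (norm (z + 1))\<^sup>2"
    using assms unfolding cmod_power2 by (simp add: power2_eq_square algebra_simps)
  then have "norm (z - 1) < norm (z + 1)" by (rule power_less_imp_less_base) simp
  moreover have "z + 1 \<noteq> 0" using assms by (auto simp: complex_eq_iff)
  ultimately show ?thesis by (simp add: norm_divide)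
qed

lemma half_plane_kernel_nonzero:
  assumes "Re z > 0" "-1 \<le> c" "c \<le> 1"
  shows "of_real (1 - c) * z\<^sup>2 + of_real (1 + c) \<noteq> 0"
proof
  assume *: "of_real (1 - c) * z\<^sup>2 + of_real (1 + c) = 0"
  then have "Im (of_real (1 - c) * z\<^sup>2 + of_real (1 + c)) = 0" "Re (of_real (1 - c) * z\<^sup>2 + of_real (1 + c)) = 0" by simp_all
  then have 1: "c = 1 \<or> Re z = 0 \<or> Im z = 0" and 2: "(1 - c) * ((Re z)\<^sup>2 - (Im z)\<^sup>2) + (1 + c) = 0"
    by (auto simp: power2_eq_square)
  have "c \<noteq> 1" using 2 by auto
  then have "Im z = 0" using 1 assms(1) by auto
  with 2 have "(1 - c) * (Re z)\<^sup>2 + (1 + c) = 0" by simp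
  moreover have "(1 - c) * (Re z)\<^sup>2 > 0" using \<open>c \<noteq> 1\<close> assms by (intro mult_pos_pos) auto
  ultimately show False using assms by linarith
qed

text \<open>For \<open>c < 1\<close> the right side has its poles at
  \<open>z^2 = - (1 + c) / (1 - c)\<close>, on the imaginary axis; this is the origin of the terms
  \<open>b z / (z^2 + y)\<close>.\<close>

lemma cayley_kernel:
  assumes z: "Re z > 0" and \<xi>: "\<xi> = (z - 1) / (z + 1)" and c: "-1 \<le> c" "c \<le> 1"
  shows "(1 - \<xi>\<^sup>2) / (1 + \<xi>\<^sup>2 - 2 * of_real c * \<xi>) = 2 * z / (of_real (1 - c) * z\<^sup>2 + of_real (1 + c))"
proof -
  have z1: "z + 1 \<noteq> 0" using z by (auto simp: complex_eq_iff)
  have a: "1 - \<xi>\<^sup>2 = 2 * (2 * z) / (z + 1)\<^sup>2"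
    using z1 by (simp add: \<xi> power_divide field_simps) (simp add: power2_eq_square algebra_simps)
  have b: "1 + \<xi>\<^sup>2 - 2 * of_real c * \<xi> = 2 * (of_real (1 - c) * z\<^sup>2 + of_real (1 + c)) / (z + 1)\<^sup>2"
  proof -
    have "\<xi> * (z + 1) = z - 1" using z1 by (simp add: \<xi>)
    moreover have "(1 + \<xi>\<^sup>2 - 2 * of_real c * \<xi>) * (z + 1)\<^sup>2 = (z + 1)\<^sup>2 + (\<xi> * (z + 1))\<^sup>2 - 2 * of_real c * (\<xi> * (z + 1)) * (z + 1)"
      by (simp add: power2_eq_square algebra_simps)
    ultimately have "(1 + \<xi>\<^sup>2 - 2 * of_real c * \<xi>) * (z + 1)\<^sup>2 = (z + 1)\<^sup>2 + (z - 1)\<^sup>2 - 2 * of_real c * (z - 1) * (z + 1)"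
      by simp
    also have "\<dots> = 2 * (of_real (1 - c) * z\<^sup>2 + of_real (1 + c))"
      by (simp add: power2_eq_square algebra_simps)
    finally have "(1 + \<xi>\<^sup>2 - 2 * of_real c * \<xi>) * (z + 1)\<^sup>2 = 2 * (of_real (1 - c) * z\<^sup>2 + of_real (1 + c))" .
    then show ?thesis using z1 by (simp add: eq_divide_eq)
  qed
  show ?thesis unfolding a b using z1 half_plane_kernel_nonzero[OF z c]
    by (simp del: of_real_diff of_real_add distrib_left_numeral)
qed

text \<open>Reflecting \<open>t\<close> to \<open>2 * pi - t\<close> permutes the nodes, conjugates
  \<open>F\<close> and preserves the cosine; averaging each node with its mirror image leaves real
  weights.\<close>

lemma sum_midpoints_symmetric:
  fixes F :: "complex \<Rightarrow> complex" and P :: "real \<Rightarrow> complex" and N :: nat and \<theta> :: "nat \<Rightarrow> real"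
  assumes sym: "\<And>w. norm w = 1 \<Longrightarrow> F (cnj w) = cnj (F w)" and N: "N > 0"
    and \<theta>: "\<And>k. \<theta> k = (real k + 1/2) * (2 * pi / N)"
  shows "(\<Sum>k<N. F (cis (\<theta> k)) * P (cos (\<theta> k))) = (\<Sum>k<N. of_real (Re (F (cis (\<theta> k)))) * P (cos (\<theta> k)))"
proof -
  have refl: "\<theta> (N - Suc k) = 2 * pi - \<theta> k" if "k < N" for k
  proof -
    have "real (N - Suc k) = real N - (real k + 1)" using that by simp
    then show ?thesis unfolding \<theta> using N by (simp add: field_simps)
  qed
  have "(\<Sum>k<N. F (cis (\<theta> k)) * P (cos (\<theta> k))) = (\<Sum>k<N. F (cis (\<theta> (N - Suc k))) * P (cos (\<theta> (N - Suc k))))"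
    by (rule sum.nat_diff_reindex[symmetric])
  also have "\<dots> = (\<Sum>k<N. cnj (F (cis (\<theta> k))) * P (cos (\<theta> k)))"
  proof (rule sum.cong[OF HOL.refl])
    fix k assume "k \<in> {..<N}"
    then have r: "\<theta> (N - Suc k) = 2 * pi - \<theta> k" using refl by simp
    have "cis (2 * pi - \<theta> k) = cnj (cis (\<theta> k))" by (simp add: complex_eq_iff)
    then show "F (cis (\<theta> (N - Suc k))) * P (cos (\<theta> (N - Suc k))) = cnj (F (cis (\<theta> k))) * P (cos (\<theta> k))"
      unfolding r using sym[of "cis (\<theta> k)"] by simp
  qed
  finally have "2 * (\<Sum>k<N. F (cis (\<theta> k)) * P (cos (\<theta> k))) = (\<Sum>k<N. (F (cis (\<theta> k)) + cnj (F (cis (\<theta> k)))) * P (cos (\<theta> k)))"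
    by (simp add: sum.distrib distrib_right)
  also have "\<dots> = 2 * (\<Sum>k<N. of_real (Re (F (cis (\<theta> k)))) * P (cos (\<theta> k)))"
    unfolding complex_add_cnj by (simp add: sum_distrib_left mult.assoc)
  finally show ?thesis by simp
qed

text \<open>A discretised Herglotz representation: the weights come from values of
  \<open>Re V\<close> at points inside the half plane, hence are nonnegative, and a finite sum on a
  compact set takes the place of the representing measure.\<close>

theorem positive_real_approx:
  assumes V: "V holomorphic_on {z. Re z > 0}" and pos: "\<And>z. Re z > 0 \<Longrightarrow> Re (V z) \<ge> 0"
    and sym: "\<And>z. Re z > 0 \<Longrightarrow> V (cnj z) = cnj (V z)"
    and K: "compact K" "K \<subseteq> {z. Re z > 0}" and e: "e > 0"
  obtains N :: nat and b y :: "nat \<Rightarrow> real" where "\<And>k. k < N \<Longrightarrow> b k \<ge> 0" "\<And>k. k < N \<Longrightarrow> y k \<ge> 0"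
    "\<And>z. z \<in> K \<Longrightarrow> norm (V z - (\<Sum>k<N. of_real (b k) * z / (z\<^sup>2 + of_real (y k)))) \<le> e"
proof -
  define Z :: "complex \<Rightarrow> complex" where "Z = (\<lambda>\<xi>. (1 + \<xi>) / (1 - \<xi>))"
  define T :: "complex \<Rightarrow> complex" where "T = (\<lambda>z. (z - 1) / (z + 1))"
  have T: "norm (T z) < 1" if "Re z > 0" for z unfolding T_def by (rule cayley_disc[OF that])
  have ZT: "Z (T z) = z" if "Re z > 0" for z
  proof -
    have "z + 1 \<noteq> 0" using that by (auto simp: complex_eq_iff)
    then have "1 + T z = 2 * z / (z + 1)" "1 - T z = 2 / (z + 1)" by (simp_all add: T_def field_simps)
    then show ?thesis using \<open>z + 1 \<noteq> 0\<close> by (simp add: Z_def)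
  qed
  have ReZ: "Re (Z \<xi>) > 0" if "norm \<xi> < 1" for \<xi> unfolding Z_def by (rule cayley_rhp[OF that])
  have holVZ: "(\<lambda>\<xi>. V (Z \<xi>)) holomorphic_on ball 0 1"
  proof -
    have "Z holomorphic_on ball 0 1" unfolding Z_def by (intro holomorphic_intros) auto
    then have "(V \<circ> Z) holomorphic_on ball 0 1"
      by (rule holomorphic_on_compose_gen[OF _ V]) (use ReZ in auto)
    then show ?thesis by (simp add: comp_def)
  qed
  have rT: "norm (of_real r * T z) < 1" if "0 \<le> r" "r \<le> 1" "z \<in> K" for r z
  proof -
    have "norm (of_real r * T z) \<le> 1 * norm (T z)"
      using that unfolding norm_mult by (intro mult_right_mono) auto
    then show ?thesis using T[of z] that K by auto
  qed
  have contT: "continuous_on K T"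
    unfolding T_def using K(2) by (intro continuous_intros) (auto simp: complex_eq_iff)
  \<comment> \<open>Shrinking by \<open>r < 1\<close> makes \<open>F\<close> below holomorphic
    across the unit circle; uniform continuity keeps the loss within \<open>e / 2\<close>.\<close>
  obtain r where r: "0 < r" "r < 1" and rV: "\<And>z. z \<in> K \<Longrightarrow> norm (V z - V (Z (of_real r * T z))) \<le> e / 2"
  proof -
    have "continuous_on ({0..1} \<times> K) ((\<lambda>\<xi>. V (Z \<xi>)) \<circ> (\<lambda>p. of_real (fst p) * T (snd p)))"
    proof (intro continuous_on_compose continuous_on_subset[OF holomorphic_on_imp_continuous_on[OF holVZ]])
      show "continuous_on ({0..1} \<times> K) (\<lambda>p. of_real (fst p) * T (snd p))"
        by (intro continuous_intros continuous_on_compose2[OF contT]) auto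
    qed (use rT in auto)
    then have "uniformly_continuous_on ({0..1} \<times> K) ((\<lambda>\<xi>. V (Z \<xi>)) \<circ> (\<lambda>p. of_real (fst p) * T (snd p)))"
      using K by (intro compact_uniformly_continuous compact_Times) auto
    then obtain d where d: "d > 0" and ud: "\<And>p p'. p \<in> {0..1} \<times> K \<Longrightarrow> p' \<in> {0..1} \<times> K \<Longrightarrow> dist p' p < d \<Longrightarrow>
        dist (V (Z (of_real (fst p') * T (snd p')))) (V (Z (of_real (fst p) * T (snd p)))) < e / 2"
      unfolding uniformly_continuous_on_def comp_def using e by (metis half_gt_zero)
    define r where "r = max (1/2) (1 - d / 2)"
    have r: "0 < r" "r < 1" "\<bar>1 - r\<bar> < d" using d by (auto simp: r_def)
    show ?thesis
    proof (rule that[OF r(1,2)])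
      fix z assume z: "z \<in> K"
      have "dist (1, z) (r, z) < d" using r by (simp add: dist_Pair_Pair dist_real_def)
      then show "norm (V z - V (Z (of_real r * T z))) \<le> e / 2"
        using ud[of "(r, z)" "(1, z)"] z r ZT[of z] K by (auto simp: dist_norm)
    qed
  qed
  define F where "F = (\<lambda>\<xi>. V (Z (of_real r * \<xi>)))"
  define U where "U = ball (0::complex) (1 / r)"
  have "1 < 1 / r" using r by simp
  then have U: "cball 0 1 \<subseteq> U" by (auto simp: U_def)
  have rU: "norm (of_real r * \<xi>) < 1" if "\<xi> \<in> U" for \<xi>
    using that r by (simp add: U_def norm_mult field_simps)
  have holF: "F holomorphic_on U"
  proof -
    have "(\<lambda>\<xi>. of_real r * \<xi>) holomorphic_on U" by (intro holomorphic_intros)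
    then have "((\<lambda>\<xi>. V (Z \<xi>)) \<circ> (\<lambda>\<xi>. of_real r * \<xi>)) holomorphic_on U"
      by (rule holomorphic_on_compose_gen[OF _ holVZ]) (use rU in auto)
    then show ?thesis by (simp add: comp_def F_def)
  qed
  have symF: "F (cnj w) = cnj (F w)" if "norm w = 1" for w
  proof -
    have "Re (Z (of_real r * w)) > 0" using that r by (intro ReZ) (simp add: norm_mult)
    moreover have "Z (of_real r * cnj w) = cnj (Z (of_real r * w))" by (simp add: Z_def)
    ultimately show ?thesis by (simp add: F_def sym)
  qed
  have posF: "Re (F (cis t)) \<ge> 0" for t
    unfolding F_def using r by (intro pos ReZ) (simp add: norm_mult)
  define P where "P = (\<lambda>c z. 2 * z / (of_real (1 - c) * z\<^sup>2 + of_real (1 + c)) :: complex)"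
  define g where "g = (\<lambda>t z. F (cis t) * P (cos t) z)"
  have intg: "((\<lambda>t. g t z) has_integral 2 * pi * F (T z)) {0..2 * pi}" if "z \<in> K" for z
  proof -
    have z: "Re z > 0" using that K by auto
    show ?thesis
      using poisson_type_formula[OF holF U T[OF z]]
      unfolding g_def P_def cayley_kernel[OF z T_def[THEN fun_cong] cos_ge_minus_one cos_le_one] .
  qed
  have contF: "continuous_on {0..2 * pi} (\<lambda>t. F (cis t))"
    by (rule continuous_on_compose2[OF holomorphic_on_imp_continuous_on[OF holF]])
       (use U in \<open>auto intro!: continuous_intros\<close>)
  have "continuous_on ({0..2 * pi} \<times> K) (\<lambda>p. F (cis (fst p)) * P (cos (fst p)) (snd p))"
  proof (intro continuous_on_mult)
    show "continuous_on ({0..2 * pi} \<times> K) (\<lambda>p. F (cis (fst p)))"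
      by (rule continuous_on_compose2[OF contF]) (auto intro!: continuous_intros)
    show "continuous_on ({0..2 * pi} \<times> K) (\<lambda>p. P (cos (fst p)) (snd p))"
      unfolding P_def using half_plane_kernel_nonzero[OF _ cos_ge_minus_one cos_le_one] K(2)
      by (intro continuous_intros) (auto simp del: of_real_diff of_real_add)
  qed
  then have contg: "continuous_on ({0..2 * pi} \<times> K) (\<lambda>(t, z). g t z)" by (simp add: g_def case_prod_unfold)
  \<comment> \<open>The integral formula carries the factor \<open>2 * pi\<close>, so an error of
    \<open>pi * e\<close> there means \<open>e / 2\<close> for \<open>F\<close>.\<close>
  have "pi * e > 0" using e by simp
  then obtain N :: nat where N: "N > 0" and Nz: "\<And>z. z \<in> K \<Longrightarrow> norm (integral {0..2 * pi} (\<lambda>t. g t z)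
        - of_real ((2 * pi - 0) / N) * (\<Sum>k<N. g (0 + (real k + 1/2) * ((2 * pi - 0) / N)) z)) \<le> pi * e"
    using midpoint_riemann_uniform[OF contg K(1), of "pi * e"] by (metis pi_gt_zero mult_pos_pos zero_less_numeral)
  define \<theta> where "\<theta> = (\<lambda>k::nat. (real k + 1/2) * (2 * pi / N))"
  \<comment> \<open>\<open>b\<close> and \<open>y\<close> arise on dividing numerator and
    denominator of the kernel by \<open>1 - cos (\<theta> k)\<close>; the \<open>2 * pi\<close> of
    the mesh cancels that of the integral formula.\<close>
  define b where "b = (\<lambda>k. Re (F (cis (\<theta> k))) * 2 / (real N * (1 - cos (\<theta> k))))"
  define y where "y = (\<lambda>k. (1 + cos (\<theta> k)) / (1 - cos (\<theta> k)))"
  \<comment> \<open>The midpoints lie strictly between 0 and \<open>2 * pi\<close>, so the divisor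
    is positive.\<close>
  have cos: "cos (\<theta> k) < 1" if "k < N" for k
  proof -
    have "0 < \<theta> k" using N by (simp add: \<theta>_def)
    moreover have "\<theta> k < 2 * pi"
    proof -
      have "(real k + 1/2) * (2 * pi / N) < real N * (2 * pi / N)"
        using that N by (intro mult_strict_right_mono) auto
      then show ?thesis using N by (simp add: \<theta>_def)
    qed
    ultimately have "cos (\<theta> k) \<noteq> 1"
    proof (intro notI)
      assume "cos (\<theta> k) = 1" and k: "0 < \<theta> k" "\<theta> k < 2 * pi"
      then obtain n :: int where n: "\<theta> k = of_int n * 2 * pi" unfolding cos_one_2pi_int by blast
      have "0 < of_int n * (2 * pi)" "of_int n * (2 * pi) < 1 * (2 * pi)" using k unfolding n by simp_all
      then have "0 < real_of_int n" "real_of_int n < 1"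
        using pi_gt_zero by (auto simp: zero_less_mult_iff mult_less_cancel_right)
      then show False by simp
    qed
    then show ?thesis using cos_le_one[of "\<theta> k"] by (simp add: order_less_le)
  qed
  show ?thesis
  proof (rule that[of N b y])
    show "b k \<ge> 0" if "k < N" for k
      unfolding b_def using cos[OF that] posF by (intro divide_nonneg_nonneg mult_nonneg_nonneg) auto
    show "y k \<ge> 0" if "k < N" for k
    proof -
      have "0 \<le> 1 + cos (\<theta> k)" using cos_ge_minus_one[of "\<theta> k"] by linarith
      then show ?thesis unfolding y_def using cos[OF that] by (intro divide_nonneg_nonneg) auto
    qed
    fix z assume z: "z \<in> K"
    have summand: "of_real (Re (F (cis (\<theta> k)))) * P (cos (\<theta> k)) z = of_real (real N) * (of_real (b k) * z / (z\<^sup>2 + of_real (y k)))"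
      if "k < N" for k
    proof -
      let ?c = "complex_of_real (1 - cos (\<theta> k))"
      have c0: "?c \<noteq> 0" using cos[OF that] by (simp only: of_real_eq_0_iff)
      have yk: "?c * (z\<^sup>2 + of_real (y k)) = ?c * z\<^sup>2 + of_real (1 + cos (\<theta> k))"
        using c0 by (simp add: y_def distrib_left del: of_real_diff of_real_add)
      have bk: "of_real (real N) * of_real (b k) = of_real (Re (F (cis (\<theta> k)))) * 2 / ?c"
        using N by (simp add: b_def del: of_real_diff)
      have "P (cos (\<theta> k)) z = 2 * z / (?c * (z\<^sup>2 + of_real (y k)))" unfolding yk P_def ..
      then have "of_real (Re (F (cis (\<theta> k)))) * P (cos (\<theta> k)) z = (of_real (Re (F (cis (\<theta> k)))) * 2 / ?c) * z / (z\<^sup>2 + of_real (y k))"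
        by simp
      then show ?thesis unfolding bk[symmetric] by simp
    qed
    have "(\<Sum>k<N. g (0 + (real k + 1/2) * ((2 * pi - 0) / N)) z) = (\<Sum>k<N. of_real (Re (F (cis (\<theta> k)))) * P (cos (\<theta> k)) z)"
      using sum_midpoints_symmetric[where F = F and \<theta> = \<theta> and P = "\<lambda>c. P c z", OF symF N \<theta>_def[THEN fun_cong]]
      by (simp add: g_def \<theta>_def)
    also have "\<dots> = of_real (real N) * (\<Sum>k<N. of_real (b k) * z / (z\<^sup>2 + of_real (y k)))"
      unfolding sum_distrib_left using summand by (intro sum.cong) auto
    finally have S: "of_real ((2 * pi - 0) / N) * (\<Sum>k<N. g (0 + (real k + 1/2) * ((2 * pi - 0) / N)) z) =
        2 * of_real pi * (\<Sum>k<N. of_real (b k) * z / (z\<^sup>2 + of_real (y k)))"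
      using N by simp
    have "norm (2 * of_real pi * (F (T z) - (\<Sum>k<N. of_real (b k) * z / (z\<^sup>2 + of_real (y k))))) \<le> pi * e"
      using Nz[OF z] unfolding S integral_unique[OF intg[OF z]] right_diff_distrib by simp
    then have "norm (F (T z) - (\<Sum>k<N. of_real (b k) * z / (z\<^sup>2 + of_real (y k)))) \<le> e / 2"
      by (simp add: norm_mult)
    moreover have "norm (V z - F (T z)) \<le> e / 2" using rV[OF z] by (simp add: F_def)
    ultimately show "norm (V z - (\<Sum>k<N. of_real (b k) * z / (z\<^sup>2 + of_real (y k)))) \<le> e"
      using norm_triangle_mono[of "V z - F (T z)" "e/2" "F (T z) - (\<Sum>k<N. of_real (b k) * z / (z\<^sup>2 + of_real (y k)))" "e/2"] by simp
  qed
qed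


section \<open>Laplace transforms of powers of gamma sums\<close>

definition gamma_pairs :: "nat \<Rightarrow> (nat \<Rightarrow> real) \<Rightarrow> (nat \<Rightarrow> real) \<Rightarrow> (real \<times> real) list" where
  "gamma_pairs n \<beta> b = map (\<lambda>i. (b i, \<beta> i)) [0..<n]"

lemma gamma_pairs_simps [simp]:
  "gamma_pairs 0 \<beta> b = []" "gamma_pairs (Suc n) \<beta> b = gamma_pairs n \<beta> b @ [(b n, \<beta> n)]"
  by (simp_all add: gamma_pairs_def)

lemma positive_gamma_pairs: "(\<And>i. i < n \<Longrightarrow> \<beta> i > 0 \<and> b i > 0) \<Longrightarrow> positive_pairs (gamma_pairs n \<beta> b)"
  by (auto simp: positive_pairs_def gamma_pairs_def)

lemma gops_append: "gops (L @ M) A = gops L (gops M A)"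
proof (induction L)
  case (Cons a L)
  then show ?case by (cases a) simp
qed simp

lemma integral_gamma_distribution:
  assumes "\<beta> > 0" "b > 0" and H: "H \<in> borel_measurable borel"
  shows "(\<integral>t. H (of_real (y + t)) \<partial>gamma_distribution \<beta> b) =
    of_real (b powr \<beta> / Gamma \<beta>) * gop (of_real b / 1) \<beta> H (of_real y)"
proof -
  have G: "Gamma \<beta> > 0" using assms by (simp add: Gamma_real_pos)
  have [measurable]: "(\<lambda>t. H (of_real (y + t))) \<in> borel_measurable borel" using H by measurable
  have "(\<integral>t. H (of_real (y + t)) \<partial>gamma_distribution \<beta> b) = (\<integral>t. gamma_density \<beta> b t *\<^sub>R H (of_real (y + t)) \<partial>lborel)"
    unfolding gamma_distribution_def using G
    by (subst integral_density) (auto simp: gamma_density_def simp del: of_real_add)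
  also have "\<dots> = (\<integral>t. of_real (b powr \<beta> / Gamma \<beta>) *
      (of_real (pw \<beta> t) * exp (- (of_real b / 1) * of_real t) * H (of_real y + of_real t)) \<partial>lborel)"
  proof (rule Bochner_Integration.integral_cong[OF refl])
    fix t
    have "gamma_density \<beta> b t = b powr \<beta> / Gamma \<beta> * (pw \<beta> t * exp (- b * t))"
      by (simp add: gamma_density_def pw_def)
    moreover have "exp (- (complex_of_real b / 1) * of_real t) = of_real (exp (- b * t))"
      by (simp flip: exp_of_real)
    ultimately show "gamma_density \<beta> b t *\<^sub>R H (of_real (y + t)) = of_real (b powr \<beta> / Gamma \<beta>) *
      (of_real (pw \<beta> t) * exp (- (of_real b / 1) * of_real t) * H (of_real y + of_real t))"
      by (simp only: scaleR_conv_of_real of_real_mult of_real_add mult.assoc)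
  qed
  also have "\<dots> = of_real (b powr \<beta> / Gamma \<beta>) * gop (of_real b / 1) \<beta> H (of_real y)"
    unfolding gop_def by (rule integral_mult_right_zero)
  finally show ?thesis .
qed

text \<open>The last coordinate is integrated out and becomes the innermost operator, whose image
  replaces \<open>H\<close>; this is why \<open>H\<close> and its bound vary in the
  induction.\<close>

lemma product_integral_gamma:
  assumes pos: "\<And>i. i < n \<Longrightarrow> \<beta> i > 0 \<and> b i > 0"
    and H: "H \<in> borel_measurable borel" and C: "\<And>t::real. norm (H (of_real t)) \<le> C"
  shows "(\<integral>\<omega>. H (of_real (x + (\<Sum>i<n. \<omega> i))) \<partial>PiM {..<n} (\<lambda>i. gamma_distribution (\<beta> i) (b i))) =
    of_real (rate_const (gamma_pairs n \<beta> b)) * gops (scale_pairs 1 (gamma_pairs n \<beta> b)) H (of_real x)"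
  using pos H C
proof (induction n arbitrary: H C)
  case 0
  then show ?case by (simp add: PiM_empty lebesgue_integral_count_space_finite)
next
  case (Suc n)
  \<comment> \<open>The product locale requires a probability measure at every index, so those out
    of range receive an arbitrary one.\<close>
  define G where "G i = (if i < Suc n then gamma_distribution (\<beta> i) (b i) else gamma_distribution 1 1)" for i
  have prG: "prob_space (G i)" for i
    using Suc.prems(1)[of i] by (auto simp: G_def intro!: prob_space_gamma_distribution)
  interpret product_prob_space G by (rule product_prob_spaceI, rule prG)
  have G_sets: "sets (G i) = sets borel" for i by (simp add: G_def)
  interpret Q: prob_space "PiM (insert n {..<n}) G" by (intro prob_space_PiM prG)
  note Hm[measurable] = Suc.prems(2)
  have bn: "\<beta> n > 0" "b n > 0" using Suc.prems(1)[of n] by auto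
  let ?f = "\<lambda>\<omega>. H (of_real (x + (\<Sum>i<Suc n. \<omega> i)))"
  have meas: "(\<lambda>\<omega>. \<Sum>i<Suc n. \<omega> i :: real) \<in> borel_measurable (PiM (insert n {..<n}) G)"
  proof (intro borel_measurable_sum)
    fix i assume "i \<in> {..<Suc n}"
    then have "(\<lambda>\<omega>. \<omega> i) \<in> measurable (PiM (insert n {..<n}) G) (G i)"
      by (intro measurable_component_singleton) auto
    then show "(\<lambda>\<omega>. \<omega> i) \<in> borel_measurable (PiM (insert n {..<n}) G)"
      by (simp add: measurable_cong_sets[OF refl G_sets])
  qed
  have int: "integrable (PiM (insert n {..<n}) G) ?f"
  proof (rule Q.integrable_const_bound)
    show "AE \<omega> in PiM (insert n {..<n}) G. norm (?f \<omega>) \<le> C"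
      using Suc.prems(3) by (intro AE_I2) (simp only:)
    show "?f \<in> borel_measurable (PiM (insert n {..<n}) G)"
      by (rule measurable_compose[OF measurable_compose[OF borel_measurable_add[OF borel_measurable_const meas] borel_measurable_of_real] Hm])
  qed
  define A where "A = gop (of_real (b n) / 1) (\<beta> n) H"
  have Am: "A \<in> borel_measurable borel" unfolding A_def by (rule gop_measurable[OF Hm])
  have A_eq: "(\<integral>t. H (of_real (y + t)) \<partial>gamma_distribution (\<beta> n) (b n)) =
      of_real (b n powr \<beta> n / Gamma (\<beta> n)) * A (of_real y)" for y
    unfolding A_def by (rule integral_gamma_distribution[OF bn Hm])
  have c0: "b n powr \<beta> n / Gamma (\<beta> n) > 0" using bn by (simp add: Gamma_real_pos)
  have A_bd: "norm (A (of_real y)) \<le> C / (b n powr \<beta> n / Gamma (\<beta> n))" for y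
  proof -
    interpret g: prob_space "gamma_distribution (\<beta> n) (b n)" by (rule prob_space_gamma_distribution[OF bn])
    have m: "(\<lambda>t. H (of_real (y + t))) \<in> borel_measurable (gamma_distribution (\<beta> n) (b n))" by measurable
    have "norm (\<integral>t. H (of_real (y + t)) \<partial>gamma_distribution (\<beta> n) (b n)) \<le> (\<integral>t. C \<partial>gamma_distribution (\<beta> n) (b n))"
      using m
      by (intro Bochner_Integration.integral_norm_bound_integral g.integrable_const_bound[of _ C] AE_I2
            g.integrable_const Suc.prems(3))
    then have "norm (of_real (b n powr \<beta> n / Gamma (\<beta> n)) * A (of_real y)) \<le> C" unfolding A_eq by (simp add: g.prob_space)
    then have "(b n powr \<beta> n / Gamma (\<beta> n)) * norm (A (of_real y)) \<le> C"
      unfolding norm_mult norm_of_real abs_of_pos[OF c0] .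
    then show ?thesis using c0 by (simp add: pos_le_divide_eq mult.commute del: divide_divide_eq_right)
  qed
  have G_PiM: "PiM {..<n} G = PiM {..<n} (\<lambda>i. gamma_distribution (\<beta> i) (b i))"
    by (intro PiM_cong) (auto simp: G_def)
  have "PiM {..<Suc n} (\<lambda>i. gamma_distribution (\<beta> i) (b i)) = PiM (insert n {..<n}) G"
    by (intro PiM_cong) (auto simp: G_def lessThan_Suc)
  then have "(\<integral>\<omega>. ?f \<omega> \<partial>PiM {..<Suc n} (\<lambda>i. gamma_distribution (\<beta> i) (b i))) = (\<integral>\<omega>. (\<integral>t. ?f (fun_upd \<omega> n t) \<partial>G n) \<partial>PiM {..<n} G)"
    using product_integral_insert[OF _ _ int] by simp
  also have "\<dots> = (\<integral>\<omega>. of_real (b n powr \<beta> n / Gamma (\<beta> n)) * A (of_real (x + (\<Sum>i<n. \<omega> i))) \<partial>PiM {..<n} (\<lambda>i. gamma_distribution (\<beta> i) (b i)))"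
    unfolding G_PiM
  proof (rule Bochner_Integration.integral_cong[OF refl])
    fix \<omega> :: "nat \<Rightarrow> real"
    have "(\<Sum>i<Suc n. (fun_upd \<omega> n t) i) = (\<Sum>i<n. \<omega> i) + t" for t by simp
    then show "(\<integral>t. ?f (fun_upd \<omega> n t) \<partial>G n) = of_real (b n powr \<beta> n / Gamma (\<beta> n)) * A (of_real (x + (\<Sum>i<n. \<omega> i)))"
      using A_eq[of "x + (\<Sum>i<n. \<omega> i)"] by (simp only: add.assoc[symmetric]) (simp add: G_def)
  qed
  also have "\<dots> = of_real (b n powr \<beta> n / Gamma (\<beta> n)) *
      (of_real (rate_const (gamma_pairs n \<beta> b)) * gops (scale_pairs 1 (gamma_pairs n \<beta> b)) A (of_real x))"
    unfolding integral_mult_right_zero using Suc.IH[OF _ Am A_bd] Suc.prems(1) by simp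
  also have "\<dots> = of_real (rate_const (gamma_pairs (Suc n) \<beta> b)) * gops (scale_pairs 1 (gamma_pairs (Suc n) \<beta> b)) H (of_real x)"
    by (simp add: gops_append A_def scale_pairs_def rate_const_def)
  finally show ?case .
qed

lemma measurable_sum_gamma:
  "(\<lambda>\<omega>. \<Sum>i<n. \<omega> i) \<in> borel_measurable (PiM {..<n} (\<lambda>i. gamma_distribution (\<beta> i) (b i)))"
proof (intro borel_measurable_sum)
  fix i assume "i \<in> {..<n}"
  then have "(\<lambda>\<omega>. \<omega> i) \<in> measurable (PiM {..<n} (\<lambda>i. gamma_distribution (\<beta> i) (b i))) (gamma_distribution (\<beta> i) (b i))"
    by (intro measurable_component_singleton) auto
  then show "(\<lambda>\<omega>. \<omega> i) \<in> borel_measurable (PiM {..<n} (\<lambda>i. gamma_distribution (\<beta> i) (b i)))"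
    by (simp add: measurable_cong_sets[OF refl sets_gamma_distribution])
qed

lemma integral_gamma_sum:
  assumes pos: "\<And>i. i < n \<Longrightarrow> \<beta> i > 0 \<and> b i > 0"
    and H: "H \<in> borel_measurable borel" and C: "\<And>t::real. norm (H (of_real t)) \<le> C"
  shows "(\<integral>x. H (of_real x) \<partial>gamma_sum_distribution n \<beta> b) =
    of_real (rate_const (gamma_pairs n \<beta> b)) * gops (scale_pairs 1 (gamma_pairs n \<beta> b)) H 0"
proof -
  have "(\<lambda>x. H (of_real x)) \<in> borel_measurable borel" using H by measurable
  then show ?thesis
    unfolding gamma_sum_distribution_def
    using product_integral_gamma[where x = 0, OF pos H C] by (simp add: integral_distr[OF measurable_sum_gamma])
qed

section \<open>Characteristic functions and Laplace transforms of gamma sums\<close>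

lemma real_distribution_gamma_sum:
  assumes pos: "\<And>i. i < n \<Longrightarrow> \<beta> i > 0 \<and> b i > 0"
  shows "real_distribution (gamma_sum_distribution n \<beta> b)"
proof -
  interpret prob_space "PiM {..<n} (\<lambda>i. gamma_distribution (\<beta> i) (b i))"
    using pos by (intro prob_space_PiM prob_space_gamma_distribution) auto
  show ?thesis unfolding gamma_sum_distribution_def by (rule real_distribution_distr[OF measurable_sum_gamma])
qed

text \<open>Exponentials are eigenfunctions of the operators, with complex gamma integrals as
  eigenvalues.\<close>

lemma gops_exp:
  assumes L: "positive_pairs L" and a: "Re a = 0"
  shows "gops (scale_pairs 1 L) (\<lambda>z. exp (a * z)) z =
    exp (a * z) * (\<Prod>(b, \<beta>)\<leftarrow>L. of_real (Gamma \<beta>) * (of_real b - a) powr (- of_real \<beta>))"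
  using L
proof (induction L arbitrary: z)
  case (Cons p L)
  obtain b \<beta> where p: "p = (b, \<beta>)" by (cases p)
  have b: "b > 0" "\<beta> > 0" and L: "positive_pairs L" using Cons.prems by (auto simp: p)
  let ?P = "\<Prod>(b, \<beta>)\<leftarrow>L. of_real (Gamma \<beta>) * (of_real b - a) powr (- of_real \<beta>)"
  have "gops (scale_pairs 1 (p # L)) (\<lambda>z. exp (a * z)) z =
     (\<integral>t. (exp (a * z) * ?P) * (of_real (pw \<beta> t) * exp (- (of_real b - a) * of_real t)) \<partial>lborel)"
    unfolding p pairs_simps gops.simps gop_def Cons.IH[OF L]
    by (intro Bochner_Integration.integral_cong refl) (simp add: algebra_simps exp_add exp_diff exp_minus divide_inverse)
  also have "\<dots> = exp (a * z) * ?P * (of_real (Gamma \<beta>) * (of_real b - a) powr (- of_real \<beta>))"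
    using complex_gamma_integral[OF b(2), of "of_real b - a"] a b by simp
  finally show ?case by (simp add: p mult_ac)
qed simp

lemma char_gamma_sum:
  assumes pos: "\<And>i. i < n \<Longrightarrow> \<beta> i > 0 \<and> b i > 0"
  shows "char (gamma_sum_distribution n \<beta> b) u = (\<Prod>i<n. of_real (b i powr \<beta> i) * (of_real (b i) - \<i> * of_real u) powr (- of_real (\<beta> i)))"
proof -
  let ?H = "\<lambda>z. exp (\<i> * of_real u * z)"
  have "char (gamma_sum_distribution n \<beta> b) u = (\<integral>x. ?H (of_real x) \<partial>gamma_sum_distribution n \<beta> b)"
    by (simp add: char_def mult_ac)
  also have "\<dots> = of_real (rate_const (gamma_pairs n \<beta> b)) * gops (scale_pairs 1 (gamma_pairs n \<beta> b)) ?H 0"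
    by (rule integral_gamma_sum[OF pos, where C = 1]) auto
  also have "\<dots> = of_real (rate_const (gamma_pairs n \<beta> b)) *
      (\<Prod>(b, \<beta>)\<leftarrow>gamma_pairs n \<beta> b. of_real (Gamma \<beta>) * (of_real b - \<i> * of_real u) powr (- of_real \<beta>))"
    by (subst gops_exp[OF positive_gamma_pairs[OF pos]]) auto
  also have "\<dots> = (\<Prod>i<n. of_real (b i powr \<beta> i) * (of_real (b i) - \<i> * of_real u) powr (- of_real (\<beta> i)))"
    using pos
  proof (induction n)
    case (Suc n)
    have "Gamma (\<beta> n) > 0" using Suc.prems[of n] by (simp add: Gamma_real_pos)
    then have "Gamma (\<beta> n) \<noteq> 0" by simp
    moreover have "complex_of_real (rate_const (gamma_pairs n \<beta> b)) *
        (\<Prod>(b, \<beta>)\<leftarrow>gamma_pairs n \<beta> b. of_real (Gamma \<beta>) * (of_real b - \<i> * of_real u) powr (- of_real \<beta>)) =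
      (\<Prod>i<n. of_real (b i powr \<beta> i) * (of_real (b i) - \<i> * of_real u) powr (- of_real (\<beta> i)))"
      using Suc by simp
    ultimately show ?case by (simp add: rate_const_def)
  qed simp
  finally show ?thesis .
qed

lemma gops_cong_ray:
  assumes "\<And>t::real. t > 0 \<Longrightarrow> A (of_real t) = B (of_real t)"
  shows "x > 0 \<or> (x \<ge> 0 \<and> L \<noteq> []) \<Longrightarrow> gops L A (of_real x) = gops L B (of_real x)"
proof (induction L arbitrary: x)
  case (Cons a L)
  obtain w \<gamma> where a: "a = (w, \<gamma>)" by (cases a)
  have "gops L A (of_real x + of_real t) = gops L B (of_real x + of_real t)" if "t > 0" for t
    using Cons.IH[of "x + t"] Cons.prems that by auto
  then have "gop w \<gamma> (gops L A) (of_real x) = gop w \<gamma> (gops L B) (of_real x)" by (rule gop_cong)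
  then show ?case by (simp only: a gops.simps)
next
  case Nil
  then show ?case using assms by simp
qed

text \<open>\<open>expo\<close> and the bounded integrand agree on the positive ray only; for
  \<open>n > 0\<close> there is at least one integration, which does not see the point 0.\<close>

lemma psi_eq_integral:
  assumes pos: "\<And>i. i < n \<Longrightarrow> \<beta> i > 0 \<and> b i > 0" and n: "n > 0" and s: "Re s > 0"
  shows "psi q (gamma_pairs n \<beta> b) s = (\<integral>x. exp (- s * of_real (max 0 x powr q)) \<partial>gamma_sum_distribution n \<beta> b)"
proof -
  let ?H = "\<lambda>z. exp (- s * of_real (max 0 (Re z) powr q))"
  have "(\<integral>x. exp (- s * of_real (max 0 x powr q)) \<partial>gamma_sum_distribution n \<beta> b) = (\<integral>x. ?H (of_real x) \<partial>gamma_sum_distribution n \<beta> b)"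
    by simp
  also have "\<dots> = of_real (rate_const (gamma_pairs n \<beta> b)) * gops (scale_pairs 1 (gamma_pairs n \<beta> b)) ?H (of_real 0)"
    unfolding of_real_0 using s by (intro integral_gamma_sum[OF pos, where C = 1]) auto
  also have "gops (scale_pairs 1 (gamma_pairs n \<beta> b)) ?H (of_real 0) = gops (scale_pairs 1 (gamma_pairs n \<beta> b)) (expo q s) (of_real 0)"
    using n by (intro gops_cong_ray) (auto simp: expo_of_real gamma_pairs_def scale_pairs_def)
  finally show ?thesis by (simp add: psi_def)
qed


section \<open>Approximation of the Laplace transforms by those of gamma sums\<close>

lemma Re_csqrt_pos: "Re s > 0 \<Longrightarrow> Re (csqrt s) > 0"
proof (rule ccontr)
  assume s: "Re s > 0" and "\<not> Re (csqrt s) > 0"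
  then have "Re (csqrt s) = 0" using Re_csqrt[of s] by linarith
  then have "Re ((csqrt s)\<^sup>2) \<le> 0" by (simp add: power2_eq_square)
  then show False using s by simp
qed

text \<open>With \<open>s = z^2\<close> the logarithmic derivative of
  \<open>\<Phi> (csqrt s)\<close> is \<open>- V (csqrt s) / csqrt s\<close>, and a term
  \<open>b z / (z^2 + y)\<close> in the approximation of \<open>V\<close> becomes
  \<open>b / (s + y)\<close>. Integrating from \<open>\<delta>\<close> along a vertical segment and
  exponentiating gives the product.\<close>

lemma stieltjes_ratio_approx:
  assumes hol: "\<Phi> holomorphic_on {z. Re z > 0}" and nz: "\<And>z. Re z > 0 \<Longrightarrow> \<Phi> z \<noteq> 0"
    and decr: "\<And>z. Re z > 0 \<Longrightarrow> Re (deriv \<Phi> z * cnj (\<Phi> z)) \<le> 0"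
    and sym: "\<And>z. Re z > 0 \<Longrightarrow> \<Phi> (cnj z) = cnj (\<Phi> z)"
    and \<delta>: "\<delta> > 0" and e: "e > 0"
  obtains N :: nat and b y :: "nat \<Rightarrow> real" where "\<And>k. k < N \<Longrightarrow> b k \<ge> 0" "\<And>k. k < N \<Longrightarrow> y k > 0"
    "\<And>u. \<bar>u\<bar> \<le> R \<Longrightarrow> norm (\<Phi> (csqrt (of_real \<delta> - \<i> * of_real u)) / \<Phi> (csqrt (of_real \<delta>))
       - (\<Prod>k<N. of_real (y k powr b k) * (of_real (y k) - \<i> * of_real u) powr (- of_real (b k)))) \<le> e"
proof -
  let ?H = "{z. Re z > 0}"
  define V where "V = (\<lambda>z. - deriv \<Phi> z / (2 * \<Phi> z))"
  have holV: "V holomorphic_on ?H"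
    unfolding V_def using nz by (intro holomorphic_intros holomorphic_deriv hol open_rhp) auto
  have posV: "Re (V z) \<ge> 0" if "Re z > 0" for z
  proof -
    have "V z = - (deriv \<Phi> z * cnj (\<Phi> z)) / (2 * (\<Phi> z * cnj (\<Phi> z)))"
      using nz[OF that] by (simp add: V_def)
    also have "\<dots> = of_real (1 / (2 * (norm (\<Phi> z))\<^sup>2)) * - (deriv \<Phi> z * cnj (\<Phi> z))"
      unfolding complex_norm_square[symmetric] by simp
    finally have "Re (V z) = 1 / (2 * (norm (\<Phi> z))\<^sup>2) * - Re (deriv \<Phi> z * cnj (\<Phi> z))"
      by (simp only: Re_of_real_mult uminus_complex.sel)
    then show ?thesis using decr[OF that] by (simp only:) (intro mult_nonneg_nonneg, auto)
  qed
  have symV: "V (cnj z) = cnj (V z)" if z: "Re z > 0" for z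
  proof -
    have d: "(cnj \<circ> \<Phi> \<circ> cnj has_field_derivative cnj (deriv \<Phi> z)) (at (cnj z))"
      using has_field_derivative_cnj_cnj[where z = "cnj z" and f = \<Phi>] holomorphic_derivI[OF hol open_rhp, of z] z by simp
    have eq: "(cnj \<circ> \<Phi> \<circ> cnj) w = \<Phi> w" if "w \<in> ?H" for w
      using sym[of "cnj w"] that by simp
    have "(\<Phi> has_field_derivative cnj (deriv \<Phi> z)) (at (cnj z))"
      by (rule has_field_derivative_transform_within_open[OF d open_rhp _ eq]) (use z in simp_all)
    then have "deriv \<Phi> (cnj z) = cnj (deriv \<Phi> z)" by (rule DERIV_imp_deriv)
    then show ?thesis using sym[OF z] by (simp add: V_def)
  qed
  have hol_sqrt: "csqrt holomorphic_on ?H"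
    by (intro holomorphic_intros) (auto dest: rhp_not_nonpos)
  have "(\<Phi> \<circ> csqrt) holomorphic_on ?H"
    using hol_sqrt hol Re_csqrt_pos by (intro holomorphic_on_compose_gen[of csqrt ?H \<Phi> ?H]) auto
  then obtain g where holg: "g holomorphic_on ?H" and expg: "\<And>s. s \<in> ?H \<Longrightarrow> exp (g s) = (\<Phi> \<circ> csqrt) s"
    using holomorphic_logarithm_exists[OF convex_rhp open_rhp, of "\<Phi> \<circ> csqrt" 1] nz Re_csqrt_pos by (auto simp: comp_def)
  have dg: "(g has_field_derivative (- V (csqrt s) / csqrt s)) (at s)" if s: "Re s > 0" for s
  proof -
    have g': "(g has_field_derivative deriv g s) (at s)" using holomorphic_derivI[OF holg open_rhp] s by simp
    then have "((\<lambda>s. exp (g s)) has_field_derivative exp (g s) * deriv g s) (at s)"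
      by (auto intro!: derivative_eq_intros)
    then have 1: "(\<Phi> \<circ> csqrt has_field_derivative exp (g s) * deriv g s) (at s)"
      by (rule has_field_derivative_transform_within_open[OF _ open_rhp]) (use s expg in auto)
    have 2: "(\<Phi> \<circ> csqrt has_field_derivative deriv \<Phi> (csqrt s) * inverse (2 * csqrt s)) (at s)"
      by (intro DERIV_chain holomorphic_derivI[OF hol open_rhp] has_field_derivative_csqrt)
         (use s Re_csqrt_pos rhp_not_nonpos in auto)
    have "exp (g s) * deriv g s = deriv \<Phi> (csqrt s) * inverse (2 * csqrt s)" by (rule DERIV_unique[OF 1 2])
    moreover have "exp (g s) = \<Phi> (csqrt s)" using expg[of s] s by simp
    ultimately have "deriv g s = (deriv \<Phi> (csqrt s) * inverse (2 * csqrt s)) / \<Phi> (csqrt s)"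
      using nz[OF Re_csqrt_pos[OF s]] by (metis nonzero_mult_div_cancel_left)
    moreover have "d * inverse (2 * c) / p = - (- d / (2 * p)) / c" for d c p :: complex
      by (simp add: field_simps)
    ultimately have "deriv g s = - V (csqrt s) / csqrt s" by (simp only: V_def)
    then show ?thesis using g' by simp
  qed
  have "isCont (exp :: complex \<Rightarrow> complex) 0" by (rule isCont_exp)
  then obtain \<eta> where \<eta>: "\<eta> > 0" and exp\<eta>': "\<And>z::complex. dist z 0 < \<eta> \<Longrightarrow> dist (exp z) (exp 0) < e"
    using e unfolding continuous_at_eps_delta by blast
  have exp\<eta>: "norm (exp z - 1) \<le> e" if "norm z < \<eta>" for z :: complex
    using exp\<eta>'[of z] that by (simp add: dist_norm)
  \<comment> \<open>The segment on which the logarithms are compared. On it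
    \<open>|csqrt s| \<ge> sqrt \<delta>\<close>, which controls the division by
    \<open>csqrt s\<close>.\<close>
  define S where "S = cbox (Complex \<delta> (- R)) (Complex \<delta> R)"
  have S: "Re s = \<delta>" "Re s > 0" if "s \<in> S" for s using that \<delta> by (auto simp: S_def in_cbox_complex_iff)
  have K: "compact (csqrt ` S)" "csqrt ` S \<subseteq> ?H"
  proof -
    show "compact (csqrt ` S)"
      using S by (intro compact_continuous_image holomorphic_on_imp_continuous_on holomorphic_on_subset[OF hol_sqrt])
        (auto simp: S_def)
    show "csqrt ` S \<subseteq> ?H" unfolding image_subset_iff using S(2) Re_csqrt_pos by blast
  qed
  \<comment> \<open>Chosen so that the bound \<open>\<epsilon> / sqrt \<delta>\<close> on the
    derivative, times the distance \<open>|R| + 1\<close>, is \<open>\<eta> / 2\<close>.\<close>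
  define \<epsilon> where "\<epsilon> = \<eta> * sqrt \<delta> / (2 * (\<bar>R\<bar> + 1))"
  have \<epsilon>: "\<epsilon> > 0" using \<eta> \<delta> by (simp add: \<epsilon>_def)
  obtain N :: nat and b y :: "nat \<Rightarrow> real" where b: "\<And>k. k < N \<Longrightarrow> b k \<ge> 0" and y: "\<And>k. k < N \<Longrightarrow> y k \<ge> 0"
    and approx: "\<And>z. z \<in> csqrt ` S \<Longrightarrow> norm (V z - (\<Sum>k<N. of_real (b k) * z / (z\<^sup>2 + of_real (y k)))) \<le> \<epsilon>"
    using positive_real_approx[OF holV posV symV K \<epsilon>] by blast
  \<comment> \<open>the logarithm of the quotient of \<open>\<Phi> (sqrt s)\<close> and the approximating gamma transform\<close>
  define h where "h = (\<lambda>s. g s + (\<Sum>k<N. of_real (b k) * Ln (s + of_real (y k))))"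
  have Re_y: "Re (s + of_real (y k)) > 0" if "Re s > 0" "k < N" for s k using that y[of k] by simp
  have dh: "(h has_field_derivative (- V (csqrt s) / csqrt s + (\<Sum>k<N. of_real (b k) * (1 / (s + of_real (y k)))))) (at s)"
    if s: "Re s > 0" for s
    unfolding h_def
  proof (intro DERIV_add dg[OF s] DERIV_sum DERIV_cmult)
    fix k assume "k \<in> {..<N}"
    then have "s + of_real (y k) \<notin> \<real>\<^sub>\<le>\<^sub>0" using Re_y[OF s] rhp_not_nonpos by auto
    then show "((\<lambda>s. Ln (s + of_real (y k))) has_field_derivative 1 / (s + of_real (y k))) (at s)"
      by (auto intro!: derivative_eq_intros simp: divide_inverse)
  qed
  have dh_le: "norm (- V (csqrt s) / csqrt s + (\<Sum>k<N. of_real (b k) * (1 / (s + of_real (y k))))) \<le> \<epsilon> / sqrt \<delta>" if s: "s \<in> S" for s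
  proof -
    let ?z = "csqrt s"
    have z0: "?z \<noteq> 0" using Re_csqrt_pos[OF S(2)[OF s]] by auto
    have summand: "of_real (b k) * (1 / (s + of_real (y k))) = (of_real (b k) * ?z / (?z\<^sup>2 + of_real (y k))) / ?z" for k
      using z0 by simp
    have "- V ?z / ?z + (\<Sum>k<N. of_real (b k) * (1 / (s + of_real (y k)))) =
       - (V ?z - (\<Sum>k<N. of_real (b k) * ?z / (?z\<^sup>2 + of_real (y k)))) / ?z"
      unfolding summand sum_divide_distrib[symmetric] by (simp only: minus_diff_eq diff_divide_distrib minus_divide_left) simp
    also have "norm \<dots> \<le> \<epsilon> / sqrt \<delta>"
      unfolding norm_divide norm_minus_cancel
    proof (rule frac_le)
      show "norm (V ?z - (\<Sum>k<N. of_real (b k) * ?z / (?z\<^sup>2 + of_real (y k)))) \<le> \<epsilon>"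
        by (rule approx[OF imageI[OF s]])
      have "\<delta> \<le> norm s" using S(1)[OF s] complex_Re_le_cmod[of s] by simp
      then show "sqrt \<delta> \<le> norm ?z" by (simp add: norm_csqrt)
    qed (use \<epsilon> \<delta> in auto)
    finally show ?thesis .
  qed
  show ?thesis
  \<comment> \<open>Moving to \<open>Re s = \<delta>\<close> shifts all rates by
    \<open>\<delta>\<close>, which also turns \<open>y k = 0\<close> into a positive rate.\<close>
  proof (rule that[of N b "\<lambda>k. y k + \<delta>"])
    show "b k \<ge> 0" "y k + \<delta> > 0" if "k < N" for k using b[OF that] y[OF that] \<delta> by auto
    fix u :: real assume u: "\<bar>u\<bar> \<le> R"
    define s where "s = of_real \<delta> - \<i> * of_real u"
    have sS: "s \<in> S" "of_real \<delta> \<in> S" using u by (auto simp: s_def S_def in_cbox_complex_iff)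
    have "norm (h s - h (of_real \<delta>)) \<le> \<epsilon> / sqrt \<delta> * norm (s - of_real \<delta>)"
    proof (rule field_differentiable_bound[where S = S])
      show "(h has_field_derivative (- V (csqrt z) / csqrt z + (\<Sum>k<N. of_real (b k) * (1 / (z + of_real (y k)))))) (at z within S)"
        if "z \<in> S" for z using dh[OF S(2)[OF that]] by (rule DERIV_subset) auto
    qed (use sS dh_le in \<open>auto simp: S_def\<close>)
    also have "norm (s - of_real \<delta>) = \<bar>u\<bar>" by (simp add: s_def norm_mult)
    also have "\<epsilon> / sqrt \<delta> * \<bar>u\<bar> \<le> \<epsilon> / sqrt \<delta> * (\<bar>R\<bar> + 1)" using u \<epsilon> \<delta> by (intro mult_left_mono) auto
    also have "\<epsilon> / sqrt \<delta> * (\<bar>R\<bar> + 1) = \<eta> / 2"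
    proof -
      have "\<eta> * d / (2 * c) / d * c = \<eta> / 2" if "d > 0" "c > 0" for c d using that by simp
      from this[of "sqrt \<delta>" "\<bar>R\<bar> + 1"] show ?thesis using \<delta> unfolding \<epsilon>_def by simp
    qed
    finally have d: "norm (exp (h s - h (of_real \<delta>)) - 1) \<le> e" using \<eta> by (intro exp\<eta>) simp
    define Q where "Q = (\<Sum>k<N. of_real (b k) * (Ln (of_real \<delta> + of_real (y k)) - Ln (s + of_real (y k))))"
    have ratio: "\<Phi> (csqrt s) / \<Phi> (csqrt (of_real \<delta>)) = exp (h s - h (of_real \<delta>)) * exp Q"
    proof -
      have "h s - h (of_real \<delta>) + Q = g s - g (of_real \<delta>)"
        by (simp add: h_def Q_def right_diff_distrib sum_subtractf)
      moreover have "exp (g s) = \<Phi> (csqrt s)" "exp (g (of_real \<delta>)) = \<Phi> (csqrt (of_real \<delta>))"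
        using expg[of s] expg[of "of_real \<delta>"] S(2)[OF sS(1)] \<delta> by (simp_all del: csqrt_of_real)
      ultimately show ?thesis by (metis exp_add exp_diff)
    qed
    \<comment> \<open>\<open>exp Q\<close> is the approximating product; its modulus is at most 1,
      so the relative error of the ratio becomes an absolute one.\<close>
    have nQ: "norm (exp Q) \<le> 1"
    proof -
      have "Re (of_real (b k) * (Ln (of_real \<delta> + of_real (y k)) - Ln (s + of_real (y k)))) \<le> 0" if k: "k < N" for k
      proof -
        have 1: "Re (of_real \<delta> + of_real (y k)) > 0" "Re (s + of_real (y k)) > 0" using Re_y[OF S(2)[OF sS(1)] k] Re_y[OF S(2)[OF sS(2)] k] by auto
        then have 2: "of_real \<delta> + of_real (y k) \<noteq> (0::complex)" "s + of_real (y k) \<noteq> 0"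
          by (metis order.irrefl zero_complex.sel(1))+
        have "norm (of_real \<delta> + of_real (y k) :: complex) = Re (s + of_real (y k))"
          using 1(1) by (simp add: s_def flip: of_real_add)
        also have "\<dots> \<le> norm (s + of_real (y k))" by (rule complex_Re_le_cmod)
        finally have "ln (norm (of_real \<delta> + of_real (y k) :: complex)) \<le> ln (norm (s + of_real (y k)))"
          using 2 by (subst ln_le_cancel_iff) auto
        then show ?thesis unfolding Re_of_real_mult minus_complex.sel Re_Ln[OF 2(1)] Re_Ln[OF 2(2)]
          using b[OF k] by (intro mult_nonneg_nonpos) auto
      qed
      then have "Re Q \<le> 0" unfolding Q_def Re_sum by (intro sum_nonpos) auto
      then show ?thesis by simp
    qed
    have expQ: "exp Q = (\<Prod>k<N. of_real ((y k + \<delta>) powr b k) * (of_real (y k + \<delta>) - \<i> * of_real u) powr (- of_real (b k)))"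
      unfolding Q_def exp_sum[OF finite_lessThan]
    proof (intro prod.cong refl)
      fix k assume "k \<in> {..<N}"
      then have "k < N" by simp
      then have k: "y k + \<delta> > 0" "Re (s + of_real (y k)) > 0" using y[of k] \<delta> Re_y[OF S(2)[OF sS(1)], of k] by auto
      then have s0: "s + of_real (y k) \<noteq> 0" by (metis order.irrefl zero_complex.sel(1))
      have "complex_of_real (y k + \<delta>) \<noteq> 0" using k by (simp only: of_real_eq_0_iff)
      then have "complex_of_real (y k + \<delta>) powr (of_real (b k)) = exp (of_real (b k) * Ln (of_real (y k + \<delta>)))"
        by (simp only: powr_def if_False)
      then have "of_real ((y k + \<delta>) powr b k) = exp (of_real (b k) * Ln (of_real \<delta> + of_real (y k)))"
        using powr_of_real[of "y k + \<delta>" "b k"] k(1) by (simp add: add.commute)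
      moreover have "of_real (y k + \<delta>) - \<i> * of_real u = s + of_real (y k)" by (simp add: s_def)
      moreover have "(s + of_real (y k)) powr (- of_real (b k)) = exp (- of_real (b k) * Ln (s + of_real (y k)))"
        using s0 by (simp add: powr_def)
      ultimately show "exp (of_real (b k) * (Ln (of_real \<delta> + of_real (y k)) - Ln (s + of_real (y k)))) =
         of_real ((y k + \<delta>) powr b k) * (of_real (y k + \<delta>) - \<i> * of_real u) powr (- of_real (b k))"
        by (simp only: exp_add[symmetric]) (simp add: right_diff_distrib)
    qed
    have "norm (\<Phi> (csqrt s) / \<Phi> (csqrt (of_real \<delta>)) - exp Q) = norm (exp (h s - h (of_real \<delta>)) - 1) * norm (exp Q)"
      unfolding ratio norm_mult[symmetric] by (simp add: algebra_simps)
    also have "\<dots> \<le> e * 1" using d nQ e by (intro mult_mono) auto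
    finally show "norm (\<Phi> (csqrt (of_real \<delta> - \<i> * of_real u)) / \<Phi> (csqrt (of_real \<delta>)) -
      (\<Prod>k<N. of_real ((y k + \<delta>) powr b k) * (of_real (y k + \<delta>) - \<i> * of_real u) powr (- of_real (b k)))) \<le> e"
      unfolding expQ[symmetric] s_def[symmetric] by simp
  qed
qed

section \<open>Nonvanishing and symmetry of the transform\<close>

lemma psi_of_real:
  assumes pos: "\<And>i. i < n \<Longrightarrow> \<beta> i > 0 \<and> b i > 0" and n: "n > 0" and s: "s > 0"
  defines "N \<equiv> gamma_sum_distribution n \<beta> b"
  shows "psi q (gamma_pairs n \<beta> b) (of_real s) = of_real (\<integral>x. exp (- s * max 0 x powr q) \<partial>N)"
    and "(\<integral>x. exp (- s * max 0 x powr q) \<partial>N) > 0"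
proof -
  interpret N: real_distribution N unfolding N_def by (rule real_distribution_gamma_sum[OF pos])
  have "psi q (gamma_pairs n \<beta> b) (of_real s) = (\<integral>x. of_real (exp (- s * max 0 x powr q)) \<partial>N)"
    unfolding N_def using s by (subst psi_eq_integral[OF pos n]) (auto simp flip: exp_of_real)
  then show "psi q (gamma_pairs n \<beta> b) (of_real s) = of_real (\<integral>x. exp (- s * max 0 x powr q) \<partial>N)"
    by (simp only: integral_complex_of_real)
  have int: "integrable N (\<lambda>x. exp (- s * max 0 x powr q))"
    using s by (intro N.integrable_const_bound[of _ 1]) auto
  have "(\<integral>x. exp (- s * max 0 x powr q) \<partial>N) \<noteq> 0"
  proof
    assume "(\<integral>x. exp (- s * max 0 x powr q) \<partial>N) = 0"
    then have "AE x in N. False" using integral_nonneg_eq_0_iff_AE[OF int] by simp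
    then show False using N.AE_False by simp
  qed
  moreover have "(\<integral>x. exp (- s * max 0 x powr q) \<partial>N) \<ge> 0" by (intro integral_nonneg_AE) auto
  ultimately show "(\<integral>x. exp (- s * max 0 x powr q) \<partial>N) > 0" by linarith
qed

lemma Psi_csqrt:
  assumes "1 < q" "q < 2" "positive_pairs L" "L \<noteq> []" "Re s > 0"
  shows "Psi q L (csqrt s) = psi q L s"
proof (rule rhp_identity[OF _ _ _ assms(5), of "\<lambda>s. Psi q L (csqrt s)"])
  have "csqrt holomorphic_on {z. Re z > 0}"
    by (intro holomorphic_intros) (auto dest: rhp_not_nonpos)
  then have "(Psi q L \<circ> csqrt) holomorphic_on {z. Re z > 0}"
    by (rule holomorphic_on_compose_gen[OF _ Psi_holomorphic]) (use assms Re_csqrt_pos in auto)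
  then show "(\<lambda>s. Psi q L (csqrt s)) holomorphic_on {z. Re z > 0}" by (simp add: comp_def)
  show "psi q L holomorphic_on {z. Re z > 0}" using assms by (intro psi_holomorphic)
  show "Psi q L (csqrt (of_real t)) = psi q L (of_real t)" if "t > 0" for t
  proof -
    have "csqrt (of_real t) = of_real (sqrt t)" using that by (intro csqrt_of_real) auto
    then show ?thesis using Psi_of_real[of "sqrt t" L q] that assms by simp
  qed
qed

text \<open>Being decreasing in modulus, the transform either has no zero in the half plane or
  vanishes identically; one positive point excludes the latter.\<close>

lemma Psi_nonzero:
  assumes L: "1 < q" "q < 2" "positive_pairs L" "L \<noteq> []" and r: "r > 0" "Psi q L (of_real r) \<noteq> 0" and z: "Re \<zeta> > 0"
  shows "Psi q L \<zeta> \<noteq> 0"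
proof -
  define A where "A = (\<lambda>z. if Re z > 0 then Psi q L z else 0)"
  have hol: "A holomorphic_on {z. Re z > 0}"
    by (rule holomorphic_transform[OF Psi_holomorphic[OF L]]) (auto simp: A_def)
  have "rdecr A"
  proof (rule rdecrI[OF _ hol])
    show "A \<in> borel_measurable borel"
      unfolding A_def by (intro borel_measurable_continuous_on_rhp holomorphic_on_imp_continuous_on Psi_holomorphic L)
    fix z :: complex assume z: "Re z > 0"
    have "(A has_field_derivative deriv (Psi q L) z) (at z)"
      by (rule has_field_derivative_transform_within_open[OF holomorphic_derivI[OF Psi_holomorphic[OF L] open_rhp] open_rhp])
         (use z in \<open>auto simp: A_def\<close>)
    then show "Re (rderiv A z * cnj (A z)) \<le> 0"
      using Re_deriv_Psi[OF L z] z by (simp add: rderiv_eqI A_def)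
  qed
  then show ?thesis using rdecr_zero_or_nonzero[of A] r z by (force simp: A_def)
qed

text \<open>Schwarz reflection, obtained from the identity theorem.\<close>

lemma Psi_cnj:
  assumes L: "1 < q" "q < 2" "positive_pairs L" "L \<noteq> []" and real: "\<And>r. r > 0 \<Longrightarrow> Psi q L (of_real r) \<in> \<real>" and z: "Re \<zeta> > 0"
  shows "Psi q L (cnj \<zeta>) = cnj (Psi q L \<zeta>)"
proof -
  have "cnj ` {z. Re z > 0} = {z. Re z > 0}" by (auto intro: image_eqI[of _ _ "cnj _"])
  then have "cnj \<circ> Psi q L \<circ> cnj holomorphic_on {z. Re z > 0}"
    by (intro holomorphic_on_compose_cnj_cnj open_rhp) (simp add: Psi_holomorphic[OF L])
  from rhp_identity[OF this Psi_holomorphic[OF L] _ z] have "cnj (Psi q L (cnj \<zeta>)) = Psi q L \<zeta>"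
    using real by (simp add: Reals_cnj_iff)
  then show ?thesis by (metis complex_cnj_cnj)
qed


section \<open>Powers of generalized gamma convolutions\<close>

text \<open>A shape 0 contributes the factor 1 and is dropped, since \<open>is_gamma_sum\<close>
  asks for positive shapes.\<close>

lemma gamma_sum_zero_shapes:
  fixes N :: nat
  assumes "\<And>k. k < N \<Longrightarrow> b k \<ge> 0" "\<And>k. k < N \<Longrightarrow> y k > 0"
  obtains T where "is_gamma_sum T"
    "\<And>u. char T u = (\<Prod>k<N. of_real (y k powr b k) * (of_real (y k) - \<i> * of_real u) powr (- of_real (b k)))"
proof -
  define \<phi> where "\<phi> = (\<lambda>b y u. of_real (y powr b) * (of_real y - \<i> * of_real u) powr (- of_real b))"
  have "\<exists>(n::nat) \<beta> c. (\<forall>i<n. \<beta> i > 0 \<and> c i > 0) \<and> (\<forall>u. (\<Prod>i<n. \<phi> (\<beta> i) (c i) u) = (\<Prod>k<N. \<phi> (b k) (y k) u))"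
    using assms
  proof (induction N)
    case (Suc N)
    have "\<exists>(n::nat) \<beta> c. (\<forall>i<n. \<beta> i > 0 \<and> c i > 0) \<and> (\<forall>u. (\<Prod>i<n. \<phi> (\<beta> i) (c i) u) = (\<Prod>k<N. \<phi> (b k) (y k) u))"
      by (rule Suc.IH) (use Suc.prems in auto)
    then obtain n :: nat and \<beta> c where IH: "\<forall>i<n. \<beta> i > 0 \<and> c i > 0" "\<forall>u. (\<Prod>i<n. \<phi> (\<beta> i) (c i) u) = (\<Prod>k<N. \<phi> (b k) (y k) u)"
      by blast
    have N: "b N \<ge> 0" "y N > 0" using Suc.prems by auto
    show ?case
    proof (cases "b N = 0")
      case True
      have "of_real (y N) - \<i> * of_real u \<noteq> 0" for u using N by (auto simp: complex_eq_iff)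
      then have "\<phi> (b N) (y N) u = 1" for u using True N by (simp add: \<phi>_def)
      then show ?thesis using IH by (intro exI[of _ n] exI[of _ \<beta>] exI[of _ c]) simp
    next
      case False
      let ?\<beta> = "fun_upd \<beta> n (b N)" and ?c = "fun_upd c n (y N)"
      have "(\<Prod>i<n. \<phi> (?\<beta> i) (?c i) u) = (\<Prod>i<n. \<phi> (\<beta> i) (c i) u)" for u by (intro prod.cong) auto
      then have "(\<Prod>i<Suc n. \<phi> (?\<beta> i) (?c i) u) = (\<Prod>k<Suc N. \<phi> (b k) (y k) u)" for u using IH(2) by simp
      moreover have "\<forall>i<Suc n. ?\<beta> i > 0 \<and> ?c i > 0" using IH(1) N False by (auto simp: less_Suc_eq)
      ultimately show ?thesis by blast
    qed
  qed (auto intro!: exI[of _ 0])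
  then obtain n :: nat and \<beta> c where *: "\<forall>i<n. \<beta> i > 0 \<and> c i > 0" "\<And>u. (\<Prod>i<n. \<phi> (\<beta> i) (c i) u) = (\<Prod>k<N. \<phi> (b k) (y k) u)" by blast
  show ?thesis
  proof (rule that)
    show "is_gamma_sum (gamma_sum_distribution n \<beta> c)" using * unfolding is_gamma_sum_def by blast
    show "char (gamma_sum_distribution n \<beta> c) u = (\<Prod>k<N. of_real (y k powr b k) * (of_real (y k) - \<i> * of_real u) powr (- of_real (b k)))" for u
      using char_gamma_sum[of n \<beta> c u] * by (simp add: \<phi>_def)
  qed
qed

lemma real_distribution_is_gamma_sum: "is_gamma_sum T \<Longrightarrow> real_distribution T"
  by (auto simp: is_gamma_sum_def intro: real_distribution_gamma_sum)

text \<open>For a gamma sum \<open>X\<close> the quotient of \<open>psi\<close> at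
  \<open>\<delta> - \<i> u\<close> and at \<open>\<delta>\<close> is the characteristic function of
  the law of \<open>X powr q\<close> tilted by \<open>exp (- \<delta> x)\<close>. It is close to
  that of a gamma sum by \<open>stieltjes_ratio_approx\<close>, and to the untilted one for small
  \<open>\<delta>\<close>.\<close>

lemma gamma_sum_power_char_approx:
  assumes N: "is_gamma_sum N" and q: "1 < q" "q < 2" and e: "e > 0"
  obtains T where "is_gamma_sum T"
    "\<And>u. \<bar>u\<bar> \<le> R \<Longrightarrow> norm (char T u - (\<integral>x. exp (\<i> * of_real (u * max 0 x powr q)) \<partial>N)) \<le> e"
proof -
  obtain n \<beta> b where pos: "\<And>i. i < n \<Longrightarrow> \<beta> i > 0 \<and> b i > 0" and N_eq: "N = gamma_sum_distribution n \<beta> b"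
    using N unfolding is_gamma_sum_def by blast
  interpret N: real_distribution N by (rule real_distribution_is_gamma_sum[OF N])
  show ?thesis
  proof (cases "n = 0")
    \<comment> \<open>The point mass at 0, fixed by the power; the holomorphy of \<open>Psi\<close>
      was shown for nonempty lists.\<close>
    case True
    let ?H = "\<lambda>u z. exp (\<i> * of_real (u * max 0 (Re z) powr q))"
    have "(\<integral>x. ?H u (of_real x) \<partial>N) = 1" for u
      unfolding N_eq using True by (subst integral_gamma_sum[OF pos, where C = 1]) (auto simp: scale_pairs_def rate_const_def gamma_pairs_def)
    then have "(\<integral>x. exp (\<i> * of_real (u * max 0 x powr q)) \<partial>N) = 1" for u by simp
    moreover have "char N u = 1" for u unfolding N_eq using True by (subst char_gamma_sum[OF pos]) auto
    ultimately show ?thesis using that[OF N] e by simp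
  next
    case False
    then have n: "n > 0" by simp
    define L where "L = gamma_pairs n \<beta> b"
    have L: "positive_pairs L" "L \<noteq> []"
      using positive_gamma_pairs[OF pos] n by (auto simp: L_def gamma_pairs_def)
    define p where "p = (\<lambda>s::real. \<integral>x. exp (- s * max 0 x powr q) \<partial>N)"
    have psi_p: "psi q L (of_real s) = of_real (p s)" "p s > 0" if "s > 0" for s
      using psi_of_real[where q = q, OF pos n that] by (simp_all add: p_def N_eq L_def)
    have "(\<lambda>m. p (1 / real (Suc m))) \<longlonglongrightarrow> (\<integral>x. 1 \<partial>N)"
      unfolding p_def
    proof (rule integral_dominated_convergence[where w = "\<lambda>_. 1"])
      show "AE x in N. (\<lambda>m. exp (- (1 / real (Suc m)) * max 0 x powr q)) \<longlonglongrightarrow> 1"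
      proof (rule AE_I2)
        fix x :: real
        have "(\<lambda>m. 1 / real (Suc m)) \<longlonglongrightarrow> 0" by real_asymp
        then have "(\<lambda>m. exp (- (1 / real (Suc m)) * max 0 x powr q)) \<longlonglongrightarrow> exp (- 0 * max 0 x powr q)"
          by (intro tendsto_intros)
        then show "(\<lambda>m. exp (- (1 / real (Suc m)) * max 0 x powr q)) \<longlonglongrightarrow> 1" by simp
      qed
    qed auto
    moreover have "(\<integral>x. 1 \<partial>N) = (1::real)" using N.prob_space by simp
    ultimately have "(\<lambda>m. p (1 / real (Suc m))) \<longlonglongrightarrow> 1" by (simp only:)
    \<comment> \<open>The tilt and its normalisation each cost \<open>1 - p \<delta>\<close>; with
      \<open>e / 4\<close> they stay within \<open>e / 2\<close> together.\<close>
    then have "eventually (\<lambda>m. p (1 / real (Suc m)) > 1 - e / 4) sequentially"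
      by (rule order_tendstoD) (use e in auto)
    then obtain m where "p (1 / real (Suc m)) > 1 - e / 4" by (auto simp: eventually_sequentially)
    then obtain \<delta> where \<delta>: "\<delta> > 0" "1 - p \<delta> < e / 4" by (intro that[of "1 / real (Suc m)"]) auto
    have int: "integrable N (\<lambda>x. exp (- \<delta> * max 0 x powr q))"
      using \<delta> by (intro N.integrable_const_bound[of _ 1]) auto
    have close: "norm (psi q L (of_real \<delta> - \<i> * of_real u) / psi q L (of_real \<delta>) - (\<integral>x. exp (\<i> * of_real (u * max 0 x powr q)) \<partial>N)) \<le> e / 2" for u
    proof -
      define A where "A = psi q L (of_real \<delta> - \<i> * of_real u)"
      define B where "B = (\<integral>x. exp (\<i> * of_real (u * max 0 x powr q)) \<partial>N)"
      have A_eq: "A = (\<integral>x. exp (- (of_real \<delta> - \<i> * of_real u) * of_real (max 0 x powr q)) \<partial>N)"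
        unfolding A_def L_def N_eq using \<delta> by (intro psi_eq_integral[OF pos n]) auto
      have intA: "integrable N (\<lambda>x. exp (- (of_real \<delta> - \<i> * of_real u) * of_real (max 0 x powr q)))"
        using \<delta> by (intro N.integrable_const_bound[of _ 1]) auto
      have intB: "integrable N (\<lambda>x. exp (\<i> * of_real (u * max 0 x powr q)))"
        by (intro N.integrable_const_bound[of _ 1]) auto
      have nA: "norm A \<le> p \<delta>"
        unfolding A_eq p_def by (rule Bochner_Integration.integral_norm_bound_integral[OF intA int]) simp
      have "norm (A - B) \<le> (\<integral>x. 1 - exp (- \<delta> * max 0 x powr q) \<partial>N)"
        unfolding A_eq B_def Bochner_Integration.integral_diff[OF intA intB, symmetric]
      proof (rule Bochner_Integration.integral_norm_bound_integral)
        fix x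
        let ?v = "max 0 x powr q"
        have "- (of_real \<delta> - \<i> * of_real u) * of_real ?v = of_real (- \<delta> * ?v) + \<i> * of_real (u * ?v)"
          by (simp add: algebra_simps)
        then have "exp (- (of_real \<delta> - \<i> * of_real u) * of_real ?v) - exp (\<i> * of_real (u * ?v)) =
            of_real (exp (- \<delta> * ?v) - 1) * exp (\<i> * of_real (u * ?v))"
          by (simp only: exp_add exp_of_real of_real_diff of_real_1 left_diff_distrib mult_1)
        moreover have "exp (- \<delta> * ?v) \<le> 1" using \<delta> by simp
        ultimately show "norm (exp (- (of_real \<delta> - \<i> * of_real u) * of_real ?v) - exp (\<i> * of_real (u * ?v))) \<le> 1 - exp (- \<delta> * ?v)"
          by (simp only: norm_mult norm_of_real norm_exp_i) simp
      qed (use intA intB int in auto)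
      also have "\<dots> = 1 - p \<delta>"
        using int N.prob_space by (simp add: p_def)
      finally have AB: "norm (A - B) \<le> 1 - p \<delta>" .
      have p1: "p \<delta> \<le> 1" using AB norm_ge_zero[of "A - B"] by linarith
      have "A / of_real (p \<delta>) - A = A * of_real ((1 - p \<delta>) / p \<delta>)"
        using psi_p(2)[OF \<delta>(1)] by (simp add: field_simps)
      then have "norm (A / of_real (p \<delta>) - A) = norm A * ((1 - p \<delta>) / p \<delta>)"
        using psi_p(2)[OF \<delta>(1)] p1 by (simp only: norm_mult norm_of_real) simp
      also have "\<dots> \<le> p \<delta> * ((1 - p \<delta>) / p \<delta>)"
        using nA psi_p(2)[OF \<delta>(1)] p1 by (intro mult_right_mono) auto
      also have "\<dots> = 1 - p \<delta>" using psi_p(2)[OF \<delta>(1)] by simp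
      finally have "norm ((A / of_real (p \<delta>) - A) + (A - B)) \<le> (1 - p \<delta>) + (1 - p \<delta>)"
        using AB by (intro norm_triangle_mono)
      then have "norm (A / of_real (p \<delta>) - B) \<le> e / 2" using \<delta>(2) by simp
      then show ?thesis unfolding A_def B_def psi_p(1)[OF \<delta>(1)] .
    qed
    have nz: "Psi q L z \<noteq> 0" if "Re z > 0" for z
    proof (rule Psi_nonzero[OF q L _ _ that])
      show "Psi q L (of_real 1) \<noteq> 0" using Psi_of_real[of 1 L q] L psi_p[of 1] by simp
    qed simp
    have sym: "Psi q L (cnj z) = cnj (Psi q L z)" if "Re z > 0" for z
    proof (rule Psi_cnj[OF q L _ that])
      show "Psi q L (of_real r) \<in> \<real>" if "r > 0" for r
        using Psi_of_real[OF that L(1), of q] psi_p(1)[of "r\<^sup>2"] that by simp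
    qed
    obtain M :: nat and c y where c: "\<And>k. k < M \<Longrightarrow> c k \<ge> 0" "\<And>k. k < M \<Longrightarrow> y k > 0"
      and approx: "\<And>u. \<bar>u\<bar> \<le> R \<Longrightarrow> norm (Psi q L (csqrt (of_real \<delta> - \<i> * of_real u)) / Psi q L (csqrt (of_real \<delta>))
       - (\<Prod>k<M. of_real (y k powr c k) * (of_real (y k) - \<i> * of_real u) powr (- of_real (c k)))) \<le> e / 2"
    proof (rule stieltjes_ratio_approx[where \<Phi> = "Psi q L" and \<delta> = \<delta> and R = R and e = "e / 2"])
      note exM = that
      show "Psi q L holomorphic_on {z. Re z > 0}" by (rule Psi_holomorphic[OF q L])
      show "e / 2 > 0" using e by simp
      show thesis if "\<And>k. k < M \<Longrightarrow> c k \<ge> 0" "\<And>k. k < M \<Longrightarrow> y k > 0"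
        "\<And>u. \<bar>u\<bar> \<le> R \<Longrightarrow> norm (Psi q L (csqrt (of_real \<delta> - \<i> * of_real u)) / Psi q L (csqrt (of_real \<delta>))
       - (\<Prod>k<M. of_real (y k powr c k) * (of_real (y k) - \<i> * of_real u) powr (- of_real (c k)))) \<le> e / 2"
        for M :: nat and c y
        by (rule exM[OF that])
      show "Psi q L z \<noteq> 0" "Re (deriv (Psi q L) z * cnj (Psi q L z)) \<le> 0" "Psi q L (cnj z) = cnj (Psi q L z)"
        if "Re z > 0" for z by (rule nz[OF that], rule Re_deriv_Psi[OF q L that], rule sym[OF that])
    qed (rule \<delta>(1))
    obtain T where T: "is_gamma_sum T"
      "\<And>u. char T u = (\<Prod>k<M. of_real (y k powr c k) * (of_real (y k) - \<i> * of_real u) powr (- of_real (c k)))"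
    proof (rule gamma_sum_zero_shapes[of M c y])
      note exT = that
      show thesis if "is_gamma_sum T"
        "\<And>u. char T u = (\<Prod>k<M. of_real (y k powr c k) * (of_real (y k) - \<i> * of_real u) powr (- of_real (c k)))" for T
        by (rule exT[OF that])
    qed (rule c, assumption)+
    show ?thesis
    proof (rule that[OF T(1)])
      fix u :: real assume u: "\<bar>u\<bar> \<le> R"
      have "Psi q L (csqrt (of_real \<delta> - \<i> * of_real u)) / Psi q L (csqrt (of_real \<delta>)) = psi q L (of_real \<delta> - \<i> * of_real u) / psi q L (of_real \<delta>)"
        using \<delta> by (subst (1 2) Psi_csqrt[OF q L]) auto
      then have "norm (psi q L (of_real \<delta> - \<i> * of_real u) / psi q L (of_real \<delta>) - char T u) \<le> e / 2"
        using approx[OF u] unfolding T(2) by simp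
      from norm_triangle_mono[OF this[unfolded norm_minus_commute[of _ "char T u"]] close[of u]]
      show "norm (char T u - (\<integral>x. exp (\<i> * of_real (u * max 0 x powr q)) \<partial>N)) \<le> e" by simp
    qed
  qed
qed

text \<open>
  The maximum makes the integrand continuous also at negative arguments, where \<open>powr\<close> takes junk
  values; the laws in question do not charge them.
\<close>

lemma isCont_exp_max_powr:
  assumes "q > 0"
  shows "isCont (\<lambda>x. exp (\<i> * of_real (u * max 0 x powr q))) (x :: real)"
proof -
  have "continuous_on UNIV (\<lambda>x::real. max 0 x powr q)"
    using assms by (intro continuous_on_powr' continuous_intros) auto
  then have "continuous_on UNIV (\<lambda>x::real. exp (\<i> * of_real (u * max 0 x powr q)))"
    by (intro continuous_on_exp continuous_on_mult continuous_on_const continuous_on_of_real)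
  then show ?thesis by (simp add: continuous_on_eq_continuous_at)
qed

text \<open>One index serves two approximations: \<open>S k\<close> for \<open>N\<close>, and
  \<open>T k\<close> for the power of \<open>S k\<close>, on the frequencies
  \<open>|u| \<le> k\<close> with error \<open>1 / (k + 1)\<close>. A fixed \<open>u\<close>
  eventually lies in this range, which suffices for Levy's continuity theorem.\<close>

lemma generalized_gamma_convolution_powr_lt_2:
  assumes N: "generalized_gamma_convolution N" and q: "1 < q" "q < 2"
  shows "generalized_gamma_convolution (distr N borel (\<lambda>x. x powr q))"
proof -
  let ?f = "\<lambda>u x. exp (\<i> * of_real (u * max 0 x powr q))"
  interpret N: real_distribution N using N by (simp add: generalized_gamma_convolution_def)
  obtain S where S: "\<And>k. is_gamma_sum (S k)" "weak_conv_m S N"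
    using N unfolding generalized_gamma_convolution_def by blast
  have [measurable]: "(\<lambda>x::real. x powr q) \<in> borel_measurable N" by simp
  interpret D: real_distribution "distr N borel (\<lambda>x. x powr q)" by (rule N.real_distribution_distr) simp
  have D1: "measure (distr N borel (\<lambda>x. x powr q)) {0..} = 1"
    using N.prob_space by (subst measure_distr) (auto simp: vimage_def)
  have "\<exists>T. is_gamma_sum T \<and> (\<forall>u. \<bar>u\<bar> \<le> real k \<longrightarrow> norm (char T u - (\<integral>x. ?f u x \<partial>S k)) \<le> 1 / real (Suc k))" for k
    using gamma_sum_power_char_approx[OF S(1)[of k] q, of "1 / real (Suc k)" "real k"]
    by (metis of_nat_0_less_iff zero_less_Suc zero_less_divide_1_iff)
  then obtain T where T: "\<And>k. is_gamma_sum (T k)"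
    "\<And>k u. \<bar>u\<bar> \<le> real k \<Longrightarrow> norm (char (T k) u - (\<integral>x. ?f u x \<partial>S k)) \<le> 1 / real (Suc k)"
    by metis
  \<comment> \<open>The law charges no negative reals, so the maximum in the integrand can be
    removed in the limit.\<close>
  have "AE x in N. 0 \<le> x"
    using N N.AE_in_set_eq_1[of "{0..}"] by (simp add: generalized_gamma_convolution_def)
  then have char_D: "char (distr N borel (\<lambda>x. x powr q)) u = (\<integral>x. ?f u x \<partial>N)" for u
    unfolding char_def
    by (subst integral_distr) (auto intro!: integral_cong_AE elim!: eventually_mono simp: max_def)
  have "weak_conv_m T (distr N borel (\<lambda>x. x powr q))"
  proof (rule levy_continuity)
    show "real_distribution (T k)" for k by (rule real_distribution_is_gamma_sum[OF T(1)])
    show "real_distribution (distr N borel (\<lambda>x. x powr q))" by (rule D.real_distribution_axioms)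
    fix u :: real
    have lim: "(\<lambda>k. \<integral>x. ?f u x \<partial>S k) \<longlonglongrightarrow> (\<integral>x. ?f u x \<partial>N)"
      using S(2) q by (intro weak_conv_imp_integral_bdd_continuous_conv[where B = 1] real_distribution_is_gamma_sum[OF S(1)]
        N.real_distribution_axioms isCont_exp_max_powr) (auto simp flip: of_real_mult)
    have "(\<lambda>k. char (T k) u - (\<integral>x. ?f u x \<partial>S k)) \<longlonglongrightarrow> 0"
    proof (rule Lim_null_comparison)
      show "eventually (\<lambda>k. norm (char (T k) u - (\<integral>x. ?f u x \<partial>S k)) \<le> 1 / real (Suc k)) sequentially"
        using eventually_ge_at_top[of "nat \<lceil>\<bar>u\<bar>\<rceil>"]
      proof eventually_elim
        case (elim k)
        then have "\<bar>u\<bar> \<le> real k" by linarith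
        then show ?case by (rule T(2))
      qed
      show "(\<lambda>k. 1 / real (Suc k)) \<longlonglongrightarrow> 0" by real_asymp
    qed
    from tendsto_add[OF this lim] show "(\<lambda>k. char (T k) u) \<longlonglongrightarrow> char (distr N borel (\<lambda>x. x powr q)) u"
      by (simp add: char_D)
  qed
  then show ?thesis
    unfolding generalized_gamma_convolution_def using D.real_distribution_axioms D1 T(1) by blast
qed

lemma generalized_gamma_convolution_powr_iterate:
  assumes N: "generalized_gamma_convolution N" and q: "1 < q" "q < 2"
  shows "generalized_gamma_convolution (distr N borel (\<lambda>x. x powr (q ^ Suc n)))"
proof (induction n)
  case 0
  then show ?case using generalized_gamma_convolution_powr_lt_2[OF N q] by simp
next
  case (Suc n)
  have s: "sets N = sets borel"
    using N by (auto simp: generalized_gamma_convolution_def real_distribution_def real_distribution_axioms_def)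
  have "generalized_gamma_convolution (distr (distr N borel (\<lambda>x. x powr (q ^ Suc n))) borel (\<lambda>x. x powr q))"
    by (rule generalized_gamma_convolution_powr_lt_2[OF Suc q])
  also have "distr (distr N borel (\<lambda>x. x powr (q ^ Suc n))) borel (\<lambda>x. x powr q) = distr N borel (\<lambda>x. x powr (q ^ Suc (Suc n)))"
    by (subst distr_distr) (auto simp: comp_def powr_powr mult_ac measurable_cong_sets[OF s refl])
  finally show ?case .
qed

theorem theorem1:
  fixes M :: "'a measure" and X :: "'a \<Rightarrow> real" and q :: real
  assumes "prob_space M"
    and "X \<in> borel_measurable M"
    and "\<And>\<omega>. \<omega> \<in> space M \<Longrightarrow> X \<omega> \<ge> 0"
    and "generalized_gamma_convolution (distr M borel X)"
    and "q \<ge> 1"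
  shows "generalized_gamma_convolution (distr M borel (\<lambda>\<omega>. X \<omega> powr q))"
proof (cases "q = 1")
  case True
  have "distr M borel (\<lambda>\<omega>. X \<omega> powr q) = distr M borel X"
    using assms(3) True by (intro distr_cong) auto
  then show ?thesis using assms(4) by simp
next
  case False
  then have q: "q > 1" using assms(5) by simp
  \<comment> \<open>A root of \<open>q\<close> of high enough order lies strictly between 1 and 2;
    iterating its power reaches \<open>q\<close>.\<close>
  have "(\<lambda>n. q powr (1 / real (Suc n))) \<longlonglongrightarrow> q powr 0"
    using q by (intro tendsto_intros) (real_asymp, auto)
  then have "eventually (\<lambda>n. q powr (1 / real (Suc n)) < 2) sequentially"
    using q by (intro order_tendstoD) auto
  then obtain n where n: "q powr (1 / real (Suc n)) < 2" by (auto simp: eventually_sequentially)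
  define r where "r = q powr (1 / real (Suc n))"
  have "q powr 0 < q powr (1 / real (Suc n))" using q by (intro powr_less_mono) auto
  then have r: "1 < r" "r < 2" using n q by (auto simp: r_def)
  have "r ^ Suc n = r powr real (Suc n)" using r by (intro powr_realpow[symmetric]) auto
  also have "\<dots> = q" using q by (simp add: r_def powr_powr del: of_nat_Suc)
  finally have rq: "r ^ Suc n = q" .
  have "distr (distr M borel X) borel (\<lambda>x. x powr q) = distr M borel (\<lambda>\<omega>. X \<omega> powr q)"
    using assms(2) by (subst distr_distr) (auto simp: comp_def)
  then show ?thesis
    using generalized_gamma_convolution_powr_iterate[OF assms(4) r, of n] unfolding rq by simp
qed


end
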